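(* There exist constants $c_0\in(0,1)$ and $C>0$ (absolute, i.e. depending only on the fixed constant $M$ in the definition of $\dot K^{\pm}_{N,L}$) such that the following holds. Let $N_1,N_2,L_1,L_2>0$, let $\pm_1,\pm_2$ be any signs, let $r>0$, $\omega\in\mathbb S^1$, and let $I_0\subset\mathbb R$ be a compact interval. Assume $r\le c_0\min(N_1,N_2)$, and let $u_1,u_2\in L^2(\mathbb R^{1+2})$ satisfy $\operatorname{supp}\widehat{u_j}\subset\dot K^{\pm_j}_{N_j,L_j}$ for $j=1,2$. Then $$\left\|\mathbf P_{\xi_0\cdot\omega\in I_0}\,\mathfrak B_{\theta_{12}\ll1}\bigl(\mathbf P_{\mathbb R\times T_r(\omega)}u_1,\,u_2\bigr)\right\|\le C\,(rL_1L_2)^{1/2}\left(\sup_{I_1}\left\|\mathbf P_{\xi_1\cdot\omega\in I_1}u_1\right\|\right)\|u_2\|,$$ where the supremum is over all translates $I_1$ of $I_0$, and where $\mathfrak B_{\theta_{12}\ll1}$ is the null form restricted to interactions with $\theta_{12}\le c_0$.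
   Context: Points of $\mathbb R^{1+2}$ are written $X=(\tau,\xi)$ with $\tau\in\mathbb R$, $\xi\in\mathbb R^2$. $\|\cdot\|$ is the norm on $L^2(\mathbb R^{1+2})$, $\widehat u$ is the space-time Fourier transform $\widehat u(\tau,\xi)=\iint e^{-i(t\tau+x\cdot\xi)}u(t,x)\,dt\,dx$, and $\mathbf P_A$ is defined by $\widehat{\mathbf P_Au}=\chi_A\widehat u$; thus $\mathbf P_{\xi_j\cdot\omega\in I}$ restricts the Fourier transform of its argument to the set of $(\tau_j,\xi_j)$ with $\xi_j\cdot\omega\in I$. Thickened truncated null cones: for $N,L>0$ and a sign $\pm$, $$\dot K^{\pm}_{N,L}=\{(\tau,\xi)\in\mathbb R^{1+2}:|\xi|\sim N,\ \tau=\pm|\xi|+O(L)\},$$ i.e. $M^{-1}N\le|\xi|\le MN$ and $|\tau\mp|\xi||\le ML$, for a fixed absolute constant $M\ge1$. $T_r(\omega)\subset\mathbb R^2$ is the strip of width $r$ centered on the line $\mathbb R\omega$. For nonzero $a,b\in\mathbb R^2$, $\theta(a,b)\in[0,\pi]$ denotes the angle between them, and $\theta_{12}=\theta(\pm_1\xi_1,\pm_2\xi_2)$. The restricted bilinear null form $\mathfrak B_{\theta_{12}\ll1}$ is defined by (up to a fixed normalizing constant) $$\mathcal F\bigl[\mathfrak B_{\theta_{12}\ll1}(u_1,u_2)\bigr](X_0)=\int \theta_{12}\,\chi_{\{\theta_{12}\le c_0\}}\,\widehat{u_1}(X_1)\,\widehat{u_2}(X_2)\,\delta(X_0-X_1-X_2)\,dX_1\,dX_2,\qquad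 X_j=(\tau_j,\xi_j),$$ where $\mathcal F$ is the space-time Fourier transform and $\delta$ is the Dirac delta on $\mathbb R^{1+2}$ (so the integral is over $X_1+X_2=X_0$). *)

theory Defs
  imports "HOL-Analysis.Analysis"
begin

text \<open>Points of space-time are pairs of a (dual) time and a (dual) position, so that
  the inner product of \<open>(t, x)\<close> and \<open>(\<tau>, \<xi>)\<close> is \<open>t * \<tau> + x \<bullet> \<xi>\<close>.\<close>

type_synonym spacetime = "real \<times> (real ^ 2)"

text \<open>The norm takes extended values, so that an upper bound on it contains the claim that
  the function is square integrable.\<close>

definition L2_norm :: "(spacetime \<Rightarrow> complex) \<Rightarrow> ennreal" where
  "L2_norm u =
     (let I = \<integral>\<^sup>+ X. ennreal ((cmod (u X))\<^sup>2) \<partial>lborel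
      in if I = \<infinity> then \<infinity> else ennreal (sqrt (enn2real I)))"

definition L2_space :: "(spacetime \<Rightarrow> complex) set" where
  "L2_space = {u \<in> borel_measurable lborel. L2_norm u < \<infinity>}"

definition fourier_integral :: "(spacetime \<Rightarrow> complex) \<Rightarrow> spacetime \<Rightarrow> complex" where
  "fourier_integral u X = (LINT Y|lborel. exp (- (\<i> * complex_of_real (X \<bullet> Y))) * u Y)"

text \<open>For \<open>u \<in> L2_space\<close> the Fourier integral need not converge. The transform is the limit in
  \<open>L2_space\<close> of the Fourier integrals of the truncations of \<open>u\<close> to balls; it is
  determined up to null sets, and a representative is chosen.\<close>

definition L2_fourier :: "(spacetime \<Rightarrow> complex) \<Rightarrow> spacetime \<Rightarrow> complex" where
  "L2_fourier u =
     (SOME v. v \<in> L2_space \<and>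
        ((\<lambda>R. L2_norm (\<lambda>X. fourier_integral (\<lambda>Y. indicator (cball 0 R) Y * u Y) X - v X))
           \<longlongrightarrow> 0) at_top)"

definition L2_inv_fourier :: "(spacetime \<Rightarrow> complex) \<Rightarrow> spacetime \<Rightarrow> complex" where
  "L2_inv_fourier f = (SOME w. w \<in> L2_space \<and> (AE X in lborel. L2_fourier w X = f X))"

definition fourier_proj ::
    "spacetime set \<Rightarrow> (spacetime \<Rightarrow> complex) \<Rightarrow> spacetime \<Rightarrow> complex" where
  "fourier_proj A u = L2_inv_fourier (\<lambda>X. indicator A X * L2_fourier u X)"

text \<open>The support of an almost-everywhere equivalence class of functions: the complement of
  the largest open set on which the function vanishes almost everywhere.\<close>

definition ess_support :: "(spacetime \<Rightarrow> complex) \<Rightarrow> spacetime set" where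
  "ess_support f =
     - \<Union>{U. open U \<and> (AE X in lborel. X \<in> U \<longrightarrow> f X = 0)}"

text \<open>The sign is a real number \<open>s\<close>, equal to \<open>1\<close> or \<open>-1\<close>, and \<open>M\<close> is the
  implicit constant in \<open>|\<xi>| \<sim> N\<close> and \<open>\<tau> = s|\<xi>| + O(L)\<close>.\<close>

definition thick_cone :: "real \<Rightarrow> real \<Rightarrow> real \<Rightarrow> real \<Rightarrow> spacetime set" where
  "thick_cone M s N L =
     {(\<tau>, \<xi>). N / M \<le> norm \<xi> \<and> norm \<xi> \<le> M * N \<and> \<bar>\<tau> - s * norm \<xi>\<bar> \<le> M * L}"

definition strip :: "real \<Rightarrow> real ^ 2 \<Rightarrow> (real ^ 2) set" where
  "strip r \<omega> = {\<xi>. infdist \<xi> (span {\<omega>}) \<le> r / 2}"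

definition slab :: "real ^ 2 \<Rightarrow> real set \<Rightarrow> spacetime set" where
  "slab \<omega> I = {(\<tau>, \<xi>). \<xi> \<bullet> \<omega> \<in> I}"

definition angle :: "real ^ 2 \<Rightarrow> real ^ 2 \<Rightarrow> real" where
  "angle a b = arccos (a \<bullet> b / (norm a * norm b))"

text \<open>The delta measure is resolved by integrating over \<open>X1\<close> with \<open>X2 = X0 - X1\<close>, and
  the normalizing constant is taken to be \<open>1\<close>. The form is meant for \<open>u1, u2 \<in> L2_space\<close>
  for which the integral below is a square integrable function of \<open>X0\<close>; this holds when
  their transforms have bounded support.\<close>

definition null_form ::
    "real \<Rightarrow> real \<Rightarrow> real \<Rightarrow> (spacetime \<Rightarrow> complex) \<Rightarrow> (spacetime \<Rightarrow> complex)
      \<Rightarrow> spacetime \<Rightarrow> complex" where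
  "null_form c0 s1 s2 u1 u2 =
     L2_inv_fourier (\<lambda>X0. LINT X1|lborel.
       (let X2 = X0 - X1; \<theta> = angle (s1 *\<^sub>R snd X1) (s2 *\<^sub>R snd X2)
        in complex_of_real (if \<theta> \<le> c0 then \<theta> else 0) * L2_fourier u1 X1 * L2_fourier u2 X2))"

end

theory Submission
  imports Defs "HOL-Probability.Characteristic_Functions"
begin

text \<open>On the Fourier side the estimate is one application of Cauchy--Schwarz in \<open>X1\<close>. The output at
  \<open>X0\<close> is the integral of \<open>\<theta>\<close> against \<open>F(X1) G(X0 - X1)\<close>; its square is at most the integral of
  \<open>\<theta>^2\<close> over the admissible \<open>X1\<close>, times the integral of \<open>F(X1)^2 G(X0 - X1)^2\<close>. For fixed \<open>X2\<close> the
  condition \<open>\<xi>0 \<bullet> \<omega> \<in> I\<close> confines \<open>\<xi>1 \<bullet> \<omega>\<close> to a translate of \<open>I\<close>, so the second factor integrates to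
  at most the supremum over translates times the norm of \<open>u2\<close>. It remains to bound the first factor
  by a multiple of \<open>r L1 L2\<close>, uniformly in \<open>X0\<close>.

  Integrating in \<open>\<tau>1\<close> leaves \<open>min L1 L2\<close> times a planar integral of \<open>\<theta>^2\<close> over part of the strip
  where the phase \<open>\<phi>(\<xi>1) = s1 |\<xi>1| + s2 |\<xi>0 - \<xi>1|\<close> lies in an interval of length comparable to
  \<open>max L1 L2\<close>. The gradient of \<open>\<phi>\<close> is the difference \<open>e1 - e2\<close> of two unit vectors at angle \<open>\<theta>\<close>,
  and \<open>e1\<close> is within \<open>\<beta> = M r / (2 N1)\<close> of the direction of \<open>\<omega>\<close>. This forces \<open>\<theta>^2\<close> to be at
  most a multiple of the derivative of \<open>\<phi>\<close> along \<open>\<omega>\<close> plus \<open>\<beta>\<close> times its derivative across \<open>\<omega>\<close>.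
  Along a coordinate line \<open>\<phi>\<close> has at most two monotone pieces, so the first term integrates along
  \<open>\<omega>\<close> to \<open>O(L)\<close> and then across the strip to \<open>O(r L)\<close>, and the second integrates across \<open>\<omega>\<close> to
  \<open>O(\<beta> L)\<close> and then along \<open>\<omega>\<close> to \<open>O(N1 \<beta> L) = O(r L)\<close>.

  The transfer between a function and its transform is Plancherel's theorem. It is obtained for
  integrable square integrable functions by damping with a Gaussian, and it extends to the limit of
  truncations because the transforms of the truncations form a Cauchy sequence. Only functions with
  bounded support have to be inverted, and for those the inverse is an explicit integral.\<close>

section \<open>Continuity of translations and the Fourier transform of a Gaussian\<close>

text \<open>Estimates run on the squared norm, on which Plancherel, Fubini and Fatou act directly;
  conversion lemmas lead back to \<open>L2_norm\<close>.\<close>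

definition L2sq :: "('a::euclidean_space \<Rightarrow> complex) \<Rightarrow> ennreal" where
  "L2sq u = (\<integral>\<^sup>+ x. ennreal ((cmod (u x))\<^sup>2) \<partial>lborel)"

text \<open>Young's inequality \<open>2 |a| |b| \<le> d |a|^2 + |b|^2 / d\<close> does the work of
  Minkowski's inequality for squared norms: \<open>d = 1\<close> gives a crude triangle inequality,
  and \<open>d\<close> tending to 0 recovers the sharp constant in limits of norms.\<close>

lemma power2_norm_add_le_weighted:
  fixes a b :: "'a::real_normed_vector"
  assumes "0 < d"
  shows "(norm (a + b))\<^sup>2 \<le> (1 + d) * (norm a)\<^sup>2 + (1 + 1 / d) * (norm b)\<^sup>2"
proof -
  have "(norm (a + b))\<^sup>2 \<le> (norm a + norm b)\<^sup>2"
    by (intro power_mono norm_triangle_ineq) auto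
  moreover have "0 \<le> (sqrt d * norm a - norm b / sqrt d)\<^sup>2" by simp
  moreover have "(sqrt d * norm a - norm b / sqrt d)\<^sup>2 = d * (norm a)\<^sup>2 + (norm b)\<^sup>2 / d - 2 * norm a * norm b"
    using assms by (simp add: power2_diff power_mult_distrib power_divide)
  ultimately show ?thesis
    by (simp add: algebra_simps power2_sum)
qed

lemma nn_integral_power2_norm_add_le:
  fixes u v :: "'a \<Rightarrow> 'b::{real_normed_vector, second_countable_topology}"
  assumes [measurable]: "u \<in> borel_measurable M" "v \<in> borel_measurable M" and "0 < d"
  shows "(\<integral>\<^sup>+ x. ennreal ((norm (u x + v x))\<^sup>2) \<partial>M)
    \<le> ennreal (1 + d) * (\<integral>\<^sup>+ x. ennreal ((norm (u x))\<^sup>2) \<partial>M)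
      + ennreal (1 + 1 / d) * (\<integral>\<^sup>+ x. ennreal ((norm (v x))\<^sup>2) \<partial>M)"
proof -
  have "(\<integral>\<^sup>+ x. ennreal ((norm (u x + v x))\<^sup>2) \<partial>M)
    \<le> (\<integral>\<^sup>+ x. ennreal (1 + d) * ennreal ((norm (u x))\<^sup>2)
        + ennreal (1 + 1 / d) * ennreal ((norm (v x))\<^sup>2) \<partial>M)"
    using assms(3) power2_norm_add_le_weighted[OF assms(3)]
    by (intro nn_integral_mono) (simp flip: ennreal_mult' ennreal_plus)
  also have "\<dots> = ennreal (1 + d) * (\<integral>\<^sup>+ x. ennreal ((norm (u x))\<^sup>2) \<partial>M)
      + ennreal (1 + 1 / d) * (\<integral>\<^sup>+ x. ennreal ((norm (v x))\<^sup>2) \<partial>M)"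
    by (simp add: nn_integral_add nn_integral_cmult)
  finally show ?thesis .
qed

lemma nn_integral_lborel_translation:
  fixes f :: "'a::euclidean_space \<Rightarrow> ennreal"
  assumes [measurable]: "f \<in> borel_measurable borel"
  shows "(\<integral>\<^sup>+ x. f (x - h) \<partial>lborel) = (\<integral>\<^sup>+ x. f x \<partial>lborel)"
proof -
  have "(\<integral>\<^sup>+ x. f x \<partial>lborel) = (\<integral>\<^sup>+ x. f x \<partial>distr lborel borel ((+) (- h)))"
    by (simp add: lborel_distr_plus)
  also have "\<dots> = (\<integral>\<^sup>+ x. f (x - h) \<partial>lborel)"
    by (subst nn_integral_distr) auto
  finally show ?thesis ..
qed

section \<open>Continuity of translations in L2\<close>

text \<open>The squared L2 modulus of continuity. It is set up for real functions, whose
  approximants can be clamped with \<open>max\<close> and \<open>min\<close>; complex functions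
  enter later through \<open>Re\<close> and \<open>Im\<close>.\<close>

definition translation_defect :: "('a::euclidean_space \<Rightarrow> real) \<Rightarrow> 'a \<Rightarrow> ennreal" where
  "translation_defect f h = (\<integral>\<^sup>+ x. ennreal ((f x - f (x - h))\<^sup>2) \<partial>lborel)"

text \<open>Inserting \<open>g\<close> and its translate splits the difference into three; the two
  occurrences of \<open>f - g\<close> contribute equally by translation invariance, whence
  \<open>6 = 3 + 3\<close>.\<close>

lemma translation_defect_le:
  fixes f g :: "'a::euclidean_space \<Rightarrow> real"
  assumes [measurable]: "f \<in> borel_measurable borel" "g \<in> borel_measurable borel"
  shows "translation_defect f h
    \<le> 6 * (\<integral>\<^sup>+ x. ennreal ((f x - g x)\<^sup>2) \<partial>lborel) + 3 * translation_defect g h"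
proof -
  have *: "(a - b)\<^sup>2 \<le> 3 * (a - c)\<^sup>2 + 3 * (b - d)\<^sup>2 + 3 * (c - d)\<^sup>2" for a b c d :: real
  proof -
    have "3 * (a - c)\<^sup>2 + 3 * (b - d)\<^sup>2 + 3 * (c - d)\<^sup>2 - (a - b)\<^sup>2
      = ((a - c) + (b - d))\<^sup>2 + ((a - c) - (c - d))\<^sup>2 + ((b - d) + (c - d))\<^sup>2"
      by (simp add: power2_eq_square algebra_simps)
    thus ?thesis by (smt (verit) zero_le_power2)
  qed
  have "translation_defect f h \<le> (\<integral>\<^sup>+ x. 3 * ennreal ((f x - g x)\<^sup>2)
      + 3 * ennreal ((f (x - h) - g (x - h))\<^sup>2) + 3 * ennreal ((g x - g (x - h))\<^sup>2) \<partial>lborel)"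
    unfolding translation_defect_def
    using * by (intro nn_integral_mono) (simp flip: ennreal_mult' ennreal_plus ennreal_numeral)
  also have "\<dots> = 3 * (\<integral>\<^sup>+ x. ennreal ((f x - g x)\<^sup>2) \<partial>lborel)
      + 3 * (\<integral>\<^sup>+ x. ennreal ((f (x - h) - g (x - h))\<^sup>2) \<partial>lborel)
      + 3 * translation_defect g h"
    by (simp add: nn_integral_add nn_integral_cmult translation_defect_def)
  also have "(\<integral>\<^sup>+ x. ennreal ((f (x - h) - g (x - h))\<^sup>2) \<partial>lborel)
      = (\<integral>\<^sup>+ x. ennreal ((f x - g x)\<^sup>2) \<partial>lborel)"
    by (rule nn_integral_lborel_translation) auto
  also have "3 * (\<integral>\<^sup>+ x. ennreal ((f x - g x)\<^sup>2) \<partial>lborel)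
      + 3 * (\<integral>\<^sup>+ x. ennreal ((f x - g x)\<^sup>2) \<partial>lborel)
      = 6 * (\<integral>\<^sup>+ x. ennreal ((f x - g x)\<^sup>2) \<partial>lborel)"
    by (simp flip: distrib_right)
  finally show ?thesis .
qed

text \<open>Vanishing of the defect survives L2 limits: the approximant \<open>g n\<close> is fixed
  first, and only then is the shift made small.\<close>

lemma translation_defect_tendsto_closure:
  fixes f :: "'a::euclidean_space \<Rightarrow> real" and g :: "nat \<Rightarrow> 'a \<Rightarrow> real"
  assumes [measurable]: "f \<in> borel_measurable borel" "\<And>n. g n \<in> borel_measurable borel"
    and lim: "(\<lambda>n. \<integral>\<^sup>+ x. ennreal ((f x - g n x)\<^sup>2) \<partial>lborel) \<longlonglongrightarrow> 0"
    and g: "\<And>n. (\<lambda>k. translation_defect (g n) (h k)) \<longlonglongrightarrow> 0"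
  shows "(\<lambda>k. translation_defect f (h k)) \<longlonglongrightarrow> 0"
proof (rule order_tendstoI)
  fix e :: ennreal assume "0 < e"
  \<comment> \<open>The cap at 1 makes the tolerance finite, hence a real number \<open>r\<close>;
    the thresholds \<open>r / 24\<close> and \<open>r / 12\<close> then contribute a quarter of
    \<open>r\<close> each.\<close>
  define e' where "e' = min e 1"
  have e': "0 < e'" "e' < \<infinity>" "e' \<le> e"
    using \<open>0 < e\<close> le_less_trans[OF min.cobounded2 ennreal_one_less_top]
    by (auto simp: e'_def)
  obtain r where r: "e' = ennreal r" "0 < r" using e' by (cases e') auto
  have d: "0 < ennreal (r / 24)" "0 < ennreal (r / 12)" using r(2) by auto
  obtain n where n: "(\<integral>\<^sup>+ x. ennreal ((f x - g n x)\<^sup>2) \<partial>lborel) < ennreal (r / 24)"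
    using order_tendstoD(2)[OF lim d(1)] eventually_sequentially by auto
  have "eventually (\<lambda>k. translation_defect (g n) (h k) < ennreal (r / 12)) sequentially"
    using order_tendstoD(2)[OF g d(2)] .
  thus "eventually (\<lambda>k. translation_defect f (h k) < e) sequentially"
  proof eventually_elim
    case (elim k)
    have "translation_defect f (h k)
      \<le> 6 * (\<integral>\<^sup>+ x. ennreal ((f x - g n x)\<^sup>2) \<partial>lborel) + 3 * translation_defect (g n) (h k)"
      by (rule translation_defect_le) auto
    also have "\<dots> \<le> 6 * ennreal (r / 24) + 3 * ennreal (r / 12)"
      using n elim by (intro add_mono mult_left_mono) auto
    also have "\<dots> = ennreal (6 * (r / 24) + 3 * (r / 12))"
      using r(2) by (simp flip: ennreal_mult' ennreal_plus ennreal_numeral)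
    also have "\<dots> < ennreal r" using r(2) by (simp add: ennreal_less_iff)
    finally show ?case using e'(3) r(1) by auto
  qed
qed auto

text \<open>The shifts are bounded by some \<open>m\<close>, so all differences are bounded and
  vanish outside the ball of radius \<open>R + m\<close>; dominated convergence applies, with
  pointwise limits from continuity.\<close>

lemma translation_defect_tendsto_continuous:
  fixes f :: "'a::euclidean_space \<Rightarrow> real"
  assumes cont: "continuous_on UNIV f" and bd: "\<And>x. \<bar>f x\<bar> \<le> K"
    and supp: "\<And>x. x \<notin> cball 0 R \<Longrightarrow> f x = 0" and h: "h \<longlonglongrightarrow> 0"
  shows "(\<lambda>k. translation_defect f (h k)) \<longlonglongrightarrow> 0"
proof -
  obtain m where m: "\<And>k. norm (h k) \<le> m"
    using convergent_imp_Bseq[OF convergentI[OF h]] by (auto simp: Bseq_def)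
  have [measurable]: "f \<in> borel_measurable borel"
    using cont by (rule borel_measurable_continuous_onI)
  have isCont: "isCont f x" for x
    using cont by (simp add: continuous_on_eq_continuous_at)
  have [measurable]: "cball (0::'a) (R + m) \<in> sets borel" by (rule borel_closed) auto
  have "(\<lambda>k. translation_defect f (h k)) \<longlonglongrightarrow> (\<integral>\<^sup>+ (x::'a). 0 \<partial>lborel)"
    unfolding translation_defect_def
  proof (rule nn_integral_dominated_convergence
      [where w = "\<lambda>x. ennreal ((2 * K)\<^sup>2) * indicator (cball 0 (R + m)) x"])
    show "AE x in lborel. ennreal ((f x - f (x - h k))\<^sup>2)
        \<le> ennreal ((2 * K)\<^sup>2) * indicator (cball 0 (R + m)) x" for k
    proof (rule AE_I2)
      fix x :: 'a
      show "ennreal ((f x - f (x - h k))\<^sup>2) \<le> ennreal ((2 * K)\<^sup>2) * indicator (cball 0 (R + m)) x"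
      proof (cases "x \<in> cball 0 (R + m)")
        case True
        have "\<bar>f x - f (x - h k)\<bar> \<le> 2 * K" using bd[of x] bd[of "x - h k"] by linarith
        hence "(f x - f (x - h k))\<^sup>2 \<le> (2 * K)\<^sup>2" by (rule abs_le_square_iff[THEN iffD1, OF order_trans[OF _ abs_ge_self]])
        thus ?thesis using True by (simp add: ennreal_leI)
      next
        case False
        hence "x \<notin> cball 0 R" "x - h k \<notin> cball 0 R"
          using m[of k] norm_triangle_ineq2[of x "h k"] order_trans[OF norm_ge_zero m[of 0]] by auto
        thus ?thesis by (simp add: supp)
      qed
    qed
    have "(\<integral>\<^sup>+ x. ennreal ((2 * K)\<^sup>2) * indicator (cball (0::'a) (R + m)) x \<partial>lborel)
      = ennreal ((2 * K)\<^sup>2) * emeasure lborel (cball (0::'a) (R + m))"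
      by (rule nn_integral_cmult_indicator) auto
    also have "\<dots> < \<infinity>"
      using emeasure_bounded_finite[OF bounded_cball] by (auto simp: ennreal_mult_less_top)
    finally show "(\<integral>\<^sup>+ x. ennreal ((2 * K)\<^sup>2) * indicator (cball (0::'a) (R + m)) x \<partial>lborel) < \<infinity>" .
    show "AE x in lborel. (\<lambda>k. ennreal ((f x - f (x - h k))\<^sup>2)) \<longlonglongrightarrow> 0"
    proof (rule AE_I2)
      fix x
      have "(\<lambda>k. x - h k) \<longlonglongrightarrow> x - 0" by (intro tendsto_intros h)
      hence "(\<lambda>k. f (x - h k)) \<longlonglongrightarrow> f x"
        using isCont_tendsto_compose[OF isCont[of x]] by simp
      hence "(\<lambda>k. ennreal ((f x - f (x - h k))\<^sup>2)) \<longlonglongrightarrow> ennreal ((f x - f x)\<^sup>2)"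
        by (intro tendsto_intros)
      thus "(\<lambda>k. ennreal ((f x - f (x - h k))\<^sup>2)) \<longlonglongrightarrow> 0" by simp
    qed
  qed auto
  thus ?thesis by simp
qed

text \<open>A bounded measurable function is an almost everywhere limit of continuous ones; clamping
  these to height \<open>K\<close> and cutting them off near the support makes them dominated, so
  they converge in L2 too.\<close>

lemma translation_defect_tendsto_bounded:
  fixes f :: "'a::euclidean_space \<Rightarrow> real"
  assumes [measurable]: "f \<in> borel_measurable borel" and bd: "\<And>x. \<bar>f x\<bar> \<le> K"
    and supp: "\<And>x. x \<notin> cball 0 R \<Longrightarrow> f x = 0" and h: "h \<longlonglongrightarrow> 0"
  shows "(\<lambda>k. translation_defect f (h k)) \<longlonglongrightarrow> 0"
proof -
  have "f measurable_on UNIV"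
    by (rule lebesgue_measurable_imp_measurable_on_real)
      (auto intro: measurable_completion)
  then obtain N g where N: "negligible N" and g: "\<And>n. continuous_on UNIV (g n)"
    and lim: "\<And>x. x \<notin> N \<Longrightarrow> (\<lambda>n. g n x) \<longlonglongrightarrow> f x"
    unfolding measurable_on_def by auto
  have K: "0 \<le> K" using bd[of 0] by linarith
  \<comment> \<open>A continuous cutoff, 1 on the ball of radius \<open>R\<close> and 0 outside
    radius \<open>R + 1\<close>; being 1 wherever \<open>f\<close> may be nonzero, it leaves the
    limit intact.\<close>
  define c where "c x = max 0 (min 1 (R + 1 - norm x))" for x :: 'a
  define g' where "g' n x = c x * max (- K) (min K (g n x))" for n x
  have c: "0 \<le> c x" "c x \<le> 1" "x \<notin> cball 0 (R + 1) \<Longrightarrow> c x = 0" "x \<in> cball 0 R \<Longrightarrow> c x = 1" for x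
    by (auto simp: c_def)
  have g'_bd: "\<bar>g' n x\<bar> \<le> K" for n x
  proof -
    have "\<bar>c x\<bar> * \<bar>max (- K) (min K (g n x))\<bar> \<le> 1 * K"
      using K c[of x] by (intro mult_mono) auto
    thus ?thesis by (simp add: g'_def abs_mult)
  qed
  have g'_cont: "continuous_on UNIV (g' n)" for n
    unfolding g'_def c_def by (intro continuous_intros g)
  have g'_supp: "g' n x = 0" if "x \<notin> cball 0 (R + 1)" for n x
    using c(3)[OF that] by (simp add: g'_def)
  have [measurable]: "g' n \<in> borel_measurable borel" for n
    using g'_cont by (rule borel_measurable_continuous_onI)
  have g'_lim: "(\<lambda>n. g' n x) \<longlonglongrightarrow> f x" if "x \<notin> N" for x
  proof -
    have "(\<lambda>n. g' n x) \<longlonglongrightarrow> c x * max (- K) (min K (f x))"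
      unfolding g'_def by (intro tendsto_intros tendsto_max tendsto_min lim that)
    moreover have "c x * max (- K) (min K (f x)) = f x"
      using bd[of x] c(4)[of x] supp[of x] K by (cases "x \<in> cball 0 R") (auto simp: max_def min_def)
    ultimately show ?thesis by simp
  qed
  have [measurable]: "cball (0::'a) (R + 1) \<in> sets borel" by (rule borel_closed) auto
  have "(\<lambda>n. \<integral>\<^sup>+ x. ennreal ((f x - g' n x)\<^sup>2) \<partial>lborel) \<longlonglongrightarrow> (\<integral>\<^sup>+ (x::'a). 0 \<partial>lborel)"
  proof (rule nn_integral_dominated_convergence
      [where w = "\<lambda>x. ennreal ((2 * K)\<^sup>2) * indicator (cball 0 (R + 1)) x"])
    show "AE x in lborel. ennreal ((f x - g' n x)\<^sup>2)
        \<le> ennreal ((2 * K)\<^sup>2) * indicator (cball 0 (R + 1)) x" for n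
    proof (rule AE_I2)
      fix x :: 'a
      show "ennreal ((f x - g' n x)\<^sup>2) \<le> ennreal ((2 * K)\<^sup>2) * indicator (cball 0 (R + 1)) x"
      proof (cases "x \<in> cball 0 (R + 1)")
        case True
        have "\<bar>f x - g' n x\<bar> \<le> 2 * K" using bd[of x] g'_bd[of n x] by linarith
        hence "(f x - g' n x)\<^sup>2 \<le> (2 * K)\<^sup>2" by (rule abs_le_square_iff[THEN iffD1, OF order_trans[OF _ abs_ge_self]])
        thus ?thesis using True by (simp add: ennreal_leI)
      qed (auto simp: supp g'_supp)
    qed
    have "(\<integral>\<^sup>+ x. ennreal ((2 * K)\<^sup>2) * indicator (cball (0::'a) (R + 1)) x \<partial>lborel)
      = ennreal ((2 * K)\<^sup>2) * emeasure lborel (cball (0::'a) (R + 1))"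
      by (rule nn_integral_cmult_indicator) auto
    also have "\<dots> < \<infinity>"
      using emeasure_bounded_finite[OF bounded_cball] by (auto simp: ennreal_mult_less_top)
    finally show "(\<integral>\<^sup>+ x. ennreal ((2 * K)\<^sup>2) * indicator (cball (0::'a) (R + 1)) x \<partial>lborel) < \<infinity>" .
    have "AE x in lebesgue. x \<notin> N"
      using N negligible_iff_null_sets AE_not_in by blast
    hence "AE x in lborel. x \<notin> N" by (simp add: AE_completion_iff)
    thus "AE x in lborel. (\<lambda>n. ennreal ((f x - g' n x)\<^sup>2)) \<longlonglongrightarrow> 0"
    proof eventually_elim
      case (elim x)
      have "(\<lambda>n. ennreal ((f x - g' n x)\<^sup>2)) \<longlonglongrightarrow> ennreal ((f x - f x)\<^sup>2)"
        by (intro tendsto_intros g'_lim elim)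
      thus ?case by simp
    qed
  qed auto
  hence "(\<lambda>n. \<integral>\<^sup>+ x. ennreal ((f x - g' n x)\<^sup>2) \<partial>lborel) \<longlonglongrightarrow> 0" by simp
  moreover have "(\<lambda>k. translation_defect (g' n) (h k)) \<longlonglongrightarrow> 0" for n
    by (rule translation_defect_tendsto_continuous[OF g'_cont g'_bd g'_supp h])
  ultimately show ?thesis
    by (intro translation_defect_tendsto_closure[where f = f and g = g']) measurable
qed

text \<open>Truncation in height and radius at \<open>n\<close> reduces to the bounded case; the
  error is dominated by \<open>f^2\<close> and is eventually 0 at each point.\<close>

lemma translation_defect_tendsto:
  fixes f :: "'a::euclidean_space \<Rightarrow> real"
  assumes [measurable]: "f \<in> borel_measurable borel"
    and fin: "(\<integral>\<^sup>+ x. ennreal ((f x)\<^sup>2) \<partial>lborel) < \<infinity>" and h: "h \<longlonglongrightarrow> 0"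
  shows "(\<lambda>k. translation_defect f (h k)) \<longlonglongrightarrow> 0"
proof -
  define g where "g n x = (if \<bar>f x\<bar> \<le> real n \<and> norm x \<le> real n then f x else 0)" for n x
  have [measurable]: "g n \<in> borel_measurable borel" for n
    unfolding g_def by measurable
  have "(\<lambda>n. \<integral>\<^sup>+ x. ennreal ((f x - g n x)\<^sup>2) \<partial>lborel) \<longlonglongrightarrow> (\<integral>\<^sup>+ (x::'a). 0 \<partial>lborel)"
  proof (rule nn_integral_dominated_convergence[where w = "\<lambda>x. ennreal ((f x)\<^sup>2)"])
    show "AE x in lborel. ennreal ((f x - g n x)\<^sup>2) \<le> ennreal ((f x)\<^sup>2)" for n
      by (auto simp: g_def)
    show "AE x in lborel. (\<lambda>n. ennreal ((f x - g n x)\<^sup>2)) \<longlonglongrightarrow> 0"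
    proof (rule AE_I2)
      fix x
      obtain m :: nat where "max \<bar>f x\<bar> (norm x) \<le> real m" using real_arch_simple by blast
      hence "eventually (\<lambda>n. ennreal ((f x - g n x)\<^sup>2) = 0) sequentially"
        unfolding eventually_sequentially g_def
        by (intro exI[of _ m]) (force dest: order_trans[OF _ of_nat_mono])
      thus "(\<lambda>n. ennreal ((f x - g n x)\<^sup>2)) \<longlonglongrightarrow> 0" by (rule tendsto_eventually)
    qed
  qed (use fin in auto)
  hence "(\<lambda>n. \<integral>\<^sup>+ x. ennreal ((f x - g n x)\<^sup>2) \<partial>lborel) \<longlonglongrightarrow> 0" by simp
  moreover have "(\<lambda>k. translation_defect (g n) (h k)) \<longlonglongrightarrow> 0" for n
    by (rule translation_defect_tendsto_bounded[OF _ _ _ h, where K = "real n" and R = "real n"])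
      (auto simp: g_def)
  ultimately show ?thesis
    by (intro translation_defect_tendsto_closure[where f = f and g = g]) measurable
qed

section \<open>Fourier transform of the Gaussian\<close>

text \<open>This is the characteristic function of the standard normal distribution at
  \<open>- t\<close>, with the factor \<open>sqrt (2 * pi)\<close> of the density restored.\<close>

lemma gaussian_fourier_real:
  fixes t :: real
  shows "integrable lborel (\<lambda>x. exp (- (\<i> * complex_of_real (t * x))) * complex_of_real (exp (- x\<^sup>2 / 2)))"
    and "(LINT x|lborel. exp (- (\<i> * complex_of_real (t * x))) * complex_of_real (exp (- x\<^sup>2 / 2)))
      = complex_of_real (sqrt (2 * pi) * exp (- t\<^sup>2 / 2))"
proof -
  let ?f = "\<lambda>x::real. exp (- (\<i> * complex_of_real (t * x)))"
  have [measurable]: "?f \<in> borel_measurable borel" by measurable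
  have eq: "?f x * complex_of_real (exp (- x\<^sup>2 / 2))
    = complex_of_real (sqrt (2 * pi)) * (std_normal_density x *\<^sub>R ?f x)" for x
    by (simp add: std_normal_density_def scaleR_conv_of_real of_real_mult[symmetric] field_simps del: of_real_mult)
  have int: "integrable lborel (\<lambda>x. std_normal_density x *\<^sub>R ?f x)"
    by (rule Bochner_Integration.integrable_bound[OF integrable_normal_density[of 1 0]])
      (auto simp: norm_exp_eq_Re)
  show "integrable lborel (\<lambda>x. ?f x * complex_of_real (exp (- x\<^sup>2 / 2)))"
    unfolding eq using int by (rule integrable_mult_right)
  have "(LINT x|lborel. std_normal_density x *\<^sub>R ?f x) = (LINT x|std_normal_distribution. ?f x)"
    by (subst integral_density) (auto simp: normal_density_nonneg)
  also have "\<dots> = char std_normal_distribution (- t)"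
    by (simp add: char_def)
  also have "\<dots> = complex_of_real (exp (- t\<^sup>2 / 2))"
    by (simp add: char_std_normal_distribution)
  finally show "(LINT x|lborel. ?f x * complex_of_real (exp (- x\<^sup>2 / 2)))
      = complex_of_real (sqrt (2 * pi) * exp (- t\<^sup>2 / 2))"
    unfolding eq integral_mult_right_zero by (simp only: of_real_mult)
qed

text \<open>Lebesgue measure is the image of a product measure over \<open>Basis\<close>, and the
  integrand is a product over coordinates, so the one-dimensional formula is multiplied up.\<close>

lemma gaussian_fourier:
  fixes h :: "'a::euclidean_space"
  shows "(LINT x|lborel. exp (- (\<i> * complex_of_real (h \<bullet> x))) * complex_of_real (exp (- (norm x)\<^sup>2 / 2)))
      = complex_of_real (sqrt (2 * pi) ^ DIM('a) * exp (- (norm h)\<^sup>2 / 2))" (is ?eq)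
    and "integrable lborel (\<lambda>x::'a. exp (- (norm x)\<^sup>2 / 2))" (is ?int)
proof -
  define F where "F b y = exp (- (\<i> * complex_of_real ((h \<bullet> b) * y))) * complex_of_real (exp (- y\<^sup>2 / 2))"
    for b :: 'a and y
  define G where "G x = exp (- (\<i> * complex_of_real (h \<bullet> x))) * complex_of_real (exp (- (norm x)\<^sup>2 / 2))"
    for x :: 'a
  interpret product_sigma_finite "\<lambda>b::'a. lborel :: real measure" ..
  have [measurable]: "G \<in> borel_measurable borel" unfolding G_def by measurable
  have F: "integrable lborel (F b)" "(LINT x|lborel. F b x) = complex_of_real (sqrt (2 * pi) * exp (- (h \<bullet> b)\<^sup>2 / 2))" for b
    unfolding F_def by (rule gaussian_fourier_real)+
  have norm_sum: "(norm x)\<^sup>2 = (\<Sum>b\<in>Basis. (x \<bullet> b)\<^sup>2)" for x :: 'a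
    unfolding power2_norm_eq_inner by (subst euclidean_inner) (simp add: power2_eq_square)
  have G_prod: "G x = (\<Prod>b\<in>Basis. F b (x \<bullet> b))" for x
  proof -
    have "G x = exp (\<Sum>b\<in>Basis. - (\<i> * complex_of_real ((h \<bullet> b) * (x \<bullet> b))) + complex_of_real (- (x \<bullet> b)\<^sup>2 / 2))"
      unfolding G_def norm_sum exp_of_real[symmetric] exp_add[symmetric] euclidean_inner[of h x]
      by (simp add: sum_subtractf sum_negf sum_distrib_left sum_divide_distrib)
    also have "\<dots> = (\<Prod>b\<in>Basis. F b (x \<bullet> b))"
      unfolding F_def by (simp only: exp_sum exp_add exp_of_real finite_Basis)
    finally show ?thesis .
  qed
  have comp: "G (\<Sum>b\<in>Basis. f b *\<^sub>R b) = (\<Prod>b\<in>Basis. F b (f b))" for f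
    unfolding G_prod by (intro prod.cong) auto
  have "integrable (\<Pi>\<^sub>M b\<in>Basis. lborel) (\<lambda>f. \<Prod>b\<in>(Basis::'a set). F b (f b))"
    by (rule product_integrable_prod) (auto simp: F)
  hence int: "integrable lborel G"
    by (subst lborel_eq, subst integrable_distr_eq) (auto simp: comp)
  hence "integrable lborel (\<lambda>x. norm (G x))" by (rule integrable_norm)
  thus ?int by (simp add: G_def norm_mult norm_exp_eq_Re)
  have "(LINT x|lborel. G x) = (LINT f|(\<Pi>\<^sub>M b\<in>Basis. lborel). (\<Prod>b\<in>(Basis::'a set). F b (f b)))"
    by (subst lborel_eq, subst integral_distr) (auto simp: comp)
  also have "\<dots> = (\<Prod>b\<in>(Basis::'a set). LINT x|lborel. F b x)"
    by (rule product_integral_prod) (auto simp: F)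
  also have "\<dots> = complex_of_real (\<Prod>b\<in>(Basis::'a set). sqrt (2 * pi) * exp (- (h \<bullet> b)\<^sup>2 / 2))"
    by (simp only: F of_real_prod)
  also have "(\<Prod>b\<in>(Basis::'a set). sqrt (2 * pi) * exp (- (h \<bullet> b)\<^sup>2 / 2))
      = sqrt (2 * pi) ^ DIM('a) * exp (\<Sum>b\<in>Basis. - (h \<bullet> b)\<^sup>2 / 2)"
    by (simp only: prod.distrib prod_constant exp_sum finite_Basis)
  also have "(\<Sum>b\<in>Basis. - (h \<bullet> b)\<^sup>2 / 2) = - (norm h)\<^sup>2 / 2"
    by (simp add: norm_sum sum_negf sum_divide_distrib)
  finally show ?eq by (simp add: G_def)
qed

lemma lborel_integral_scaleR:
  fixes f :: "'a::euclidean_space \<Rightarrow> 'b::{banach, second_countable_topology}"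
  assumes [measurable]: "f \<in> borel_measurable borel" and "0 < c"
  shows "(LINT x|lborel. f x) = c ^ DIM('a) *\<^sub>R (LINT x|lborel. f (c *\<^sub>R x))"
proof -
  have "(LINT x|lborel. f x)
    = (LINT x|density (distr lborel borel (\<lambda>x. 0 + c *\<^sub>R x)) (\<lambda>_. ennreal (\<bar>c\<bar> ^ DIM('a))). f x)"
    using lborel_affine[of c "0::'a"] assms(2) by simp
  also have "\<dots> = (LINT x|distr lborel borel (\<lambda>x::'a. 0 + c *\<^sub>R x). \<bar>c\<bar> ^ DIM('a) *\<^sub>R f x)"
    by (rule integral_density) auto
  also have "\<dots> = c ^ DIM('a) *\<^sub>R (LINT x|lborel. f (c *\<^sub>R x))"
    using assms(2) by (subst integral_distr) auto
  finally show ?thesis .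
qed

section \<open>Plancherel's theorem for integrable functions\<close>

lemma borel_measurable_cnj [measurable (raw)]:
  assumes "f \<in> borel_measurable M"
  shows "(\<lambda>x. cnj (f x)) \<in> borel_measurable M"
  by (rule borel_measurable_continuous_on[OF _ assms]) (intro continuous_intros)

lemma L2sq_eq_integral:
  assumes [measurable]: "u \<in> borel_measurable borel" and "L2sq u < \<infinity>"
  shows "integrable lborel (\<lambda>x. (cmod (u x))\<^sup>2)" "L2sq u = ennreal (LINT x|lborel. (cmod (u x))\<^sup>2)"
proof -
  show int: "integrable lborel (\<lambda>x. (cmod (u x))\<^sup>2)"
    using assms(2) by (intro integrableI_nonneg) (auto simp: L2sq_def)
  show "L2sq u = ennreal (LINT x|lborel. (cmod (u x))\<^sup>2)"
    unfolding L2sq_def by (rule nn_integral_eq_integral[OF int]) auto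
qed

lemma integrable_mult_bounded:
  fixes f k :: "'a \<Rightarrow> complex"
  assumes "integrable M f" and [measurable]: "k \<in> borel_measurable M" and "\<And>x. cmod (k x) \<le> K"
  shows "integrable M (\<lambda>x. k x * f x)"
proof (rule Bochner_Integration.integrable_bound[of M "\<lambda>x. K * cmod (f x)"])
  show "AE x in M. norm (k x * f x) \<le> norm (K * cmod (f x))"
    using order_trans[OF assms(3) abs_ge_self] by (auto simp: norm_mult abs_mult intro!: mult_right_mono)
qed (use assms in auto)

lemma integrable_pair_bounded:
  fixes f :: "'a::euclidean_space \<Rightarrow> complex" and g :: "'b::euclidean_space \<Rightarrow> complex"
  assumes f: "integrable lborel f" and g: "integrable lborel g"
    and [measurable]: "k \<in> borel_measurable (lborel \<Otimes>\<^sub>M lborel)" and k: "\<And>z. cmod (k z) \<le> K"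
  shows "integrable (lborel \<Otimes>\<^sub>M lborel) (\<lambda>(x, y). k (x, y) * (f x * g y))"
proof -
  have [measurable]: "f \<in> borel_measurable lborel" "g \<in> borel_measurable lborel" using f g by auto
  have "integrable (lborel \<Otimes>\<^sub>M lborel) (\<lambda>(x, y). f x * g y)"
    by (rule lborel_pair.Fubini_integrable) (use f g in \<open>auto simp: norm_mult\<close>)
  hence "integrable (lborel \<Otimes>\<^sub>M lborel) (\<lambda>z. k z * (case z of (x, y) \<Rightarrow> f x * g y))"
    by (rule integrable_mult_bounded) (use k in auto)
  thus ?thesis by (simp add: case_prod_beta')
qed

section \<open>Autocorrelation and Gaussian damping\<close>

text \<open>The convolution of \<open>f\<close> with its reflected conjugate: its transform is the
  squared modulus of the transform of \<open>f\<close>, and its value at 0 is the squared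
  norm.\<close>

definition autocorrelation :: "('a::euclidean_space \<Rightarrow> complex) \<Rightarrow> 'a \<Rightarrow> complex" where
  "autocorrelation f h = (LINT y|lborel. f y * cnj (f (y - h)))"

text \<open>For each \<open>y\<close> the integral of \<open>|f (y - h)|\<close> over
  \<open>h\<close> is the L1 norm of \<open>f\<close>, by reflection and translation, so the
  iterated integral is the square of that norm.\<close>

lemma integrable_autocorrelation_kernel:
  fixes f :: "'a::euclidean_space \<Rightarrow> complex"
  assumes f: "integrable lborel f"
  shows "integrable (lborel \<Otimes>\<^sub>M lborel) (\<lambda>(y, h). f y * cnj (f (y - h)))"
proof -
  have [measurable]: "f \<in> borel_measurable borel" using f by auto
  have refl: "has_bochner_integral lborel (\<lambda>h. g (y - h)) (LINT h|lborel. g h)"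
    if g: "integrable lborel g" for g :: "'a \<Rightarrow> real" and y
  proof -
    have [measurable]: "g \<in> borel_measurable borel" using g by auto
    have eq: "lborel = distr lborel borel (\<lambda>x. y + (- 1) *\<^sub>R x)"
      using lborel_affine[of "-1" y] by (simp add: density_1)
    have "integrable (distr lborel borel (\<lambda>x. y + (- 1) *\<^sub>R x)) g"
      using g eq by simp
    hence "integrable lborel (\<lambda>h. g (y - h))" by (subst (asm) integrable_distr_eq) auto
    moreover have "(LINT h|lborel. g h) = (LINT h|lborel. g (y - h))"
      by (subst eq, subst integral_distr) auto
    ultimately show ?thesis by (simp add: has_bochner_integral_iff)
  qed
  have [measurable]: "(\<lambda>(y, h). f y * cnj (f (y - h))) \<in> borel_measurable (lborel \<Otimes>\<^sub>M lborel)"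
    by measurable
  have "integrable lborel (\<lambda>h. cmod (f h))" using f by simp
  note r = refl[OF this]
  have "integrable lborel (\<lambda>h. f (y - h))" for y
    using r[of y] by (subst integrable_norm_iff[symmetric]) (auto simp: has_bochner_integral_iff)
  moreover have "(LINT h|lborel. cmod (f (y - h))) = (LINT h|lborel. cmod (f h))" for y
    using r[of y] by (simp add: has_bochner_integral_iff)
  ultimately show ?thesis
    by (intro lborel_pair.Fubini_integrable) (use f in \<open>auto simp: norm_mult\<close>)
qed

lemma integrable_autocorrelation:
  fixes f :: "'a::euclidean_space \<Rightarrow> complex"
  assumes f: "integrable lborel f"
  shows "integrable lborel (autocorrelation f)"
  using lborel_pair.integrable_snd[OF integrable_autocorrelation_kernel[OF f]]
  by (simp add: autocorrelation_def[abs_def])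

lemma fourier_integral_measurable [measurable]:
  assumes [measurable]: "f \<in> borel_measurable borel"
  shows "fourier_integral f \<in> borel_measurable borel"
  unfolding fourier_integral_def by measurable

lemma cmod_fourier_integral_le: "cmod (fourier_integral f X) \<le> (LINT Y|lborel. cmod (f Y))"
  unfolding fourier_integral_def
  by (rule order_trans[OF integral_norm_bound]) (simp add: norm_mult norm_exp_eq_Re)

text \<open>After the substitution \<open>y - h\<close> in the conjugated factor, made separately
  for each \<open>y\<close>, the two exponentials combine to one in \<open>h\<close> alone, and
  Fubini collects the \<open>y\<close> integral into the autocorrelation.\<close>

lemma fourier_integral_mult_cnj:
  assumes f: "integrable lborel f"
  shows "fourier_integral f X * cnj (fourier_integral f X) = fourier_integral (autocorrelation f) X"
proof -
  let ?e = "\<lambda>Y. exp (- (\<i> * complex_of_real (X \<bullet> Y)))"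
  have [measurable]: "f \<in> borel_measurable borel" using f by auto
  have cnj: "cnj (fourier_integral f X) = (LINT h|lborel. cnj (?e (y - h)) * cnj (f (y - h)))" for y
  proof -
    have eq: "lborel = distr lborel borel (\<lambda>x. y + (- 1) *\<^sub>R x :: spacetime)"
      using lborel_affine[of "-1" y] by (simp add: density_1)
    have "cnj (fourier_integral f X) = (LINT h|lborel. cnj (?e h * f h))"
      unfolding fourier_integral_def by (rule Bochner_Integration.integral_cnj[symmetric])
    also have "\<dots> = (LINT h|lborel. cnj (?e (y - h) * f (y - h)))"
      by (subst eq, subst integral_distr) auto
    finally show ?thesis by simp
  qed
  have e: "?e y * cnj (?e (y - h)) = ?e h" for y h
    by (simp add: exp_cnj inner_diff_right algebra_simps flip: exp_add)
  have "fourier_integral f X * cnj (fourier_integral f X)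
    = (LINT y|lborel. ?e y * f y * cnj (fourier_integral f X))"
    by (simp add: fourier_integral_def)
  also have "\<dots> = (LINT y|lborel. (LINT h|lborel. ?e h * (f y * cnj (f (y - h)))))"
  proof (rule Bochner_Integration.integral_cong)
    fix y :: spacetime
    have "?e y * f y * cnj (fourier_integral f X)
      = (LINT h|lborel. (?e y * f y) * (cnj (?e (y - h)) * cnj (f (y - h))))"
      unfolding cnj[of y] by (rule integral_mult_right_zero[symmetric])
    also have "\<dots> = (LINT h|lborel. ?e h * (f y * cnj (f (y - h))))"
    proof -
      have "(?e y * f y) * (cnj (?e (y - h)) * cnj (f (y - h)))
        = (?e y * cnj (?e (y - h))) * (f y * cnj (f (y - h)))" for h
        by (simp only: ac_simps)
      thus ?thesis unfolding e by (simp only:)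
    qed
    finally show "?e y * f y * cnj (fourier_integral f X)
      = (LINT h|lborel. ?e h * (f y * cnj (f (y - h))))" .
  qed simp
  also have "\<dots> = (LINT h|lborel. (LINT y|lborel. ?e h * (f y * cnj (f (y - h)))))"
  proof (rule lborel_pair.Fubini_integral[symmetric])
    have "integrable (lborel \<Otimes>\<^sub>M lborel) (\<lambda>z. ?e (snd z) * (case z of (y, h) \<Rightarrow> f y * cnj (f (y - h))))"
      by (rule integrable_mult_bounded[OF integrable_autocorrelation_kernel[OF f], where K = 1])
        (auto simp: norm_exp_eq_Re)
    thus "integrable (lborel \<Otimes>\<^sub>M lborel) (\<lambda>(y, h). ?e h * (f y * cnj (f (y - h))))"
      by (simp add: case_prod_beta')
  qed
  also have "\<dots> = fourier_integral (autocorrelation f) X"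
    by (simp add: fourier_integral_def autocorrelation_def)
  finally show ?thesis .
qed

lemma lborel_integrable_scaleR:
  fixes f :: "'a::euclidean_space \<Rightarrow> 'b::{banach, second_countable_topology}"
  assumes f: "integrable lborel f" and c: "0 < c"
  shows "integrable lborel (\<lambda>x. f (c *\<^sub>R x))"
proof -
  have [measurable]: "f \<in> borel_measurable borel" using f by auto
  have "integrable (density (distr lborel borel (\<lambda>x::'a. 0 + c *\<^sub>R x)) (\<lambda>_. ennreal (\<bar>c\<bar> ^ DIM('a)))) f"
    using lborel_affine[of c "0::'a"] c f by simp
  hence "integrable lborel (\<lambda>x. c ^ DIM('a) *\<^sub>R f (c *\<^sub>R x))"
    using c by (subst (asm) integrable_density) (auto simp: integrable_distr_eq)
  hence "integrable lborel (\<lambda>x. (1 / c ^ DIM('a)) *\<^sub>R c ^ DIM('a) *\<^sub>R f (c *\<^sub>R x))"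
    by (rule integrable_scaleR_right)
  thus ?thesis using c by simp
qed

text \<open>Fubini moves the transform from \<open>f\<close> to the dilated Gaussian, which
  transforms to a Gaussian of inverse width; after rescaling, the right side samples
  \<open>f\<close> ever closer to 0 as \<open>s\<close> shrinks.\<close>

lemma gaussian_fourier_integral:
  assumes s: "0 < s" and f: "integrable lborel f"
  shows "(LINT X|lborel. complex_of_real (exp (- (norm (s *\<^sub>R X))\<^sup>2 / 2)) * fourier_integral f X)
    = complex_of_real (sqrt (2 * pi) ^ 3) * (LINT h|lborel. f (s *\<^sub>R h) * complex_of_real (exp (- (norm h)\<^sup>2 / 2)))"
proof -
  let ?e = "\<lambda>X Y :: spacetime. exp (- (\<i> * complex_of_real (X \<bullet> Y)))"
  let ?G = "\<lambda>X :: spacetime. complex_of_real (exp (- (norm X)\<^sup>2 / 2))"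
  have [measurable]: "f \<in> borel_measurable borel" using f by auto
  have dim: "DIM(spacetime) = 3" by simp
  define H where "H h = (LINT X|lborel. ?e h X * ?G (s *\<^sub>R X))" for h
  have [measurable]: "H \<in> borel_measurable borel" unfolding H_def by measurable
  have G_int: "integrable lborel (\<lambda>X. ?G (s *\<^sub>R X))"
    by (rule lborel_integrable_scaleR[OF integrable_of_real[OF gaussian_fourier(2)] s])
  \<comment> \<open>The factor \<open>s ^ 3\<close> is the Jacobian of the dilation in dimension 3;
    it reappears when the integral over \<open>h\<close> is rescaled below.\<close>
  have H: "s ^ 3 *\<^sub>R H (s *\<^sub>R h) = complex_of_real (sqrt (2 * pi) ^ 3) * ?G h" for h
  proof -
    have "s ^ 3 *\<^sub>R H (s *\<^sub>R h) = s ^ DIM(spacetime) *\<^sub>R (LINT X|lborel. ?e h (s *\<^sub>R X) * ?G (s *\<^sub>R X))"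
      unfolding dim H_def by (simp only: inner_scaleR_left inner_scaleR_right)
    also have "\<dots> = (LINT X|lborel. ?e h X * ?G X)"
      by (rule lborel_integral_scaleR[symmetric]) (use s in auto)
    also have "\<dots> = complex_of_real (sqrt (2 * pi) ^ 3) * ?G h"
      unfolding gaussian_fourier(1) dim by simp
    finally show ?thesis .
  qed
  have "(LINT X|lborel. ?G (s *\<^sub>R X) * fourier_integral f X)
    = (LINT X|lborel. (LINT h|lborel. ?e X h * (?G (s *\<^sub>R X) * f h)))"
  proof (rule Bochner_Integration.integral_cong)
    fix X :: spacetime
    have "?G (s *\<^sub>R X) * fourier_integral f X = (LINT h|lborel. ?G (s *\<^sub>R X) * (?e X h * f h))"
      unfolding fourier_integral_def by (rule integral_mult_right_zero[symmetric])
    thus "?G (s *\<^sub>R X) * fourier_integral f X = (LINT h|lborel. ?e X h * (?G (s *\<^sub>R X) * f h))"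
      by (simp only: ac_simps)
  qed simp
  also have "\<dots> = (LINT h|lborel. (LINT X|lborel. ?e X h * (?G (s *\<^sub>R X) * f h)))"
    using integrable_pair_bounded[OF G_int f, of "\<lambda>z. ?e (fst z) (snd z)" 1]
    by (intro lborel_pair.Fubini_integral[symmetric]) (simp add: norm_exp_eq_Re)
  also have "\<dots> = (LINT h|lborel. f h * H h)"
  proof -
    have "(LINT X|lborel. ?e X h * (?G (s *\<^sub>R X) * f h)) = f h * H h" for h
    proof -
      have "(LINT X|lborel. ?e X h * (?G (s *\<^sub>R X) * f h)) = (LINT X|lborel. f h * (?e h X * ?G (s *\<^sub>R X)))"
        by (simp only: inner_commute ac_simps)
      thus ?thesis unfolding H_def integral_mult_right_zero .
    qed
    thus ?thesis by simp
  qed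
  also have "\<dots> = s ^ DIM(spacetime) *\<^sub>R (LINT h|lborel. f (s *\<^sub>R h) * H (s *\<^sub>R h))"
    by (rule lborel_integral_scaleR) (use s in auto)
  also have "\<dots> = (LINT h|lborel. f (s *\<^sub>R h) * (s ^ 3 *\<^sub>R H (s *\<^sub>R h)))"
    unfolding dim by (simp only: integral_scaleR_right[symmetric] mult_scaleR_right)
  also have "\<dots> = (LINT h|lborel. complex_of_real (sqrt (2 * pi) ^ 3) * (f (s *\<^sub>R h) * ?G h))"
    unfolding H by (simp only: ac_simps)
  finally show ?thesis unfolding integral_mult_right_zero .
qed

text \<open>\<open>D\<close> is the squared distance between \<open>f\<close> and its translate. Writing the autocorrelation through it
  replaces the limit at \<open>0\<close> by continuity of translations and spares Cauchy--Schwarz.\<close>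

lemma Re_autocorrelation:
  fixes f :: "'a::euclidean_space \<Rightarrow> complex"
  assumes [measurable]: "f \<in> borel_measurable borel" and fin: "L2sq f < \<infinity>"
  defines "N \<equiv> LINT x|lborel. (cmod (f x))\<^sup>2"
  obtains D where "\<And>h. Re (autocorrelation f h) = N - D h / 2"
    and "\<And>h. 0 \<le> D h" "\<And>h. D h \<le> 4 * N"
    and "\<And>h::nat \<Rightarrow> 'a. h \<longlonglongrightarrow> 0 \<Longrightarrow> (\<lambda>k. D (h k)) \<longlonglongrightarrow> 0"
proof -
  define D where "D h = (LINT x|lborel. (cmod (f x - f (x - h)))\<^sup>2)" for h
  have int: "integrable lborel (\<lambda>x. (cmod (f x))\<^sup>2)"
    by (rule L2sq_eq_integral(1)[OF assms(1) fin])
  have trans: "has_bochner_integral lborel (\<lambda>x. (cmod (f (x - h)))\<^sup>2) N" for h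
  proof -
    have eq: "lborel = distr lborel borel (\<lambda>x. - h + x)"
      by (rule lborel_distr_plus[symmetric])
    have "integrable (distr lborel borel (\<lambda>x. - h + x)) (\<lambda>x. (cmod (f x))\<^sup>2)"
      using int eq by simp
    hence "integrable lborel (\<lambda>x. (cmod (f (x - h)))\<^sup>2)" by (subst (asm) integrable_distr_eq) auto
    moreover have "N = (LINT x|lborel. (cmod (f (x - h)))\<^sup>2)"
      unfolding N_def by (subst eq, subst integral_distr) auto
    ultimately show ?thesis by (simp add: has_bochner_integral_iff)
  qed
  have le: "(cmod (a - b))\<^sup>2 \<le> 2 * (cmod a)\<^sup>2 + 2 * (cmod b)\<^sup>2" for a b :: complex
    using power2_norm_add_le_weighted[of 1 a "- b"] by simp
  have Dint: "integrable lborel (\<lambda>x. (cmod (f x - f (x - h)))\<^sup>2)" for h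
  proof (rule Bochner_Integration.integrable_bound)
    show "integrable lborel (\<lambda>x. 2 * (cmod (f x))\<^sup>2 + 2 * (cmod (f (x - h)))\<^sup>2)"
      using int trans[of h] by (auto simp: has_bochner_integral_iff)
  qed (use le in auto)
  \<comment> \<open>Polarisation expresses the real part through squared moduli and so turns
    correlation into distance.\<close>
  have polar: "Re (a * cnj b) = ((cmod a)\<^sup>2 + (cmod b)\<^sup>2 - (cmod (a - b))\<^sup>2) / 2" for a b
    by (simp add: cmod_power2 power2_diff)
  have ac: "integrable lborel (\<lambda>x. f x * cnj (f (x - h)))" for h
  proof (rule Bochner_Integration.integrable_bound)
    show "integrable lborel (\<lambda>x. (cmod (f x))\<^sup>2 + (cmod (f (x - h)))\<^sup>2)"
      using int trans[of h] by (auto simp: has_bochner_integral_iff)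
    have "cmod a * cmod b \<le> (cmod a)\<^sup>2 + (cmod b)\<^sup>2" for a b
      using sum_squares_bound[of "cmod a" "cmod b"] mult_nonneg_nonneg[of "cmod a" "cmod b"]
      unfolding mult.assoc by (smt (verit) norm_ge_zero)
    thus "AE x in lborel. norm (f x * cnj (f (x - h))) \<le> norm ((cmod (f x))\<^sup>2 + (cmod (f (x - h)))\<^sup>2)"
      by (simp add: norm_mult)
  qed auto
  have Re_eq: "Re (autocorrelation f h) = N - D h / 2" for h
  proof -
    have "Re (autocorrelation f h) = (LINT x|lborel. Re (f x * cnj (f (x - h))))"
      unfolding autocorrelation_def by (rule integral_Re[symmetric, OF ac])
    also have "\<dots> = (N + N - D h) / 2"
      unfolding polar D_def
      using int trans[of h] Dint[of h]
      by (simp add: has_bochner_integral_iff N_def)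
    finally show ?thesis by simp
  qed
  have "D h \<le> (LINT x|lborel. 2 * (cmod (f x))\<^sup>2 + 2 * (cmod (f (x - h)))\<^sup>2)" for h
    unfolding D_def
    using int trans[of h] le by (intro integral_mono Dint) (auto simp: has_bochner_integral_iff)
  also have "(LINT x|lborel. 2 * (cmod (f x))\<^sup>2 + 2 * (cmod (f (x - h)))\<^sup>2) = 4 * N" for h
    using int trans[of h] by (simp add: has_bochner_integral_iff N_def)
  finally have D_le: "D h \<le> 4 * N" for h .
  have D_eq: "ennreal (D h) = translation_defect (\<lambda>x. Re (f x)) h + translation_defect (\<lambda>x. Im (f x)) h" for h
  proof -
    have "ennreal (D h) = (\<integral>\<^sup>+ x. ennreal ((cmod (f x - f (x - h)))\<^sup>2) \<partial>lborel)"
      unfolding D_def by (rule nn_integral_eq_integral[OF Dint, symmetric]) auto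
    also have "\<dots> = (\<integral>\<^sup>+ x. ennreal ((Re (f x) - Re (f (x - h)))\<^sup>2)
        + ennreal ((Im (f x) - Im (f (x - h)))\<^sup>2) \<partial>lborel)"
      by (simp add: cmod_power2 flip: ennreal_plus)
    also have "\<dots> = translation_defect (\<lambda>x. Re (f x)) h + translation_defect (\<lambda>x. Im (f x)) h"
      unfolding translation_defect_def by (rule nn_integral_add) auto
    finally show ?thesis .
  qed
  have fin_part: "(\<integral>\<^sup>+ x. ennreal ((g x)\<^sup>2) \<partial>lborel) < \<infinity>" if "\<And>x. \<bar>g x\<bar> \<le> cmod (f x)" for g
  proof -
    have "(\<integral>\<^sup>+ x. ennreal ((g x)\<^sup>2) \<partial>lborel) \<le> L2sq f"
      unfolding L2sq_def using that
      by (intro nn_integral_mono ennreal_leI) (auto simp: abs_le_square_iff[symmetric])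
    thus ?thesis using fin by (rule order_le_less_trans)
  qed
  have D_lim: "(\<lambda>k. D (h k)) \<longlonglongrightarrow> 0" if "h \<longlonglongrightarrow> 0" for h :: "nat \<Rightarrow> 'a"
  proof -
    have "(\<lambda>k. translation_defect (\<lambda>x. Re (f x)) (h k) + translation_defect (\<lambda>x. Im (f x)) (h k)) \<longlonglongrightarrow> 0 + 0"
      by (intro tendsto_add translation_defect_tendsto fin_part that abs_Re_le_cmod abs_Im_le_cmod) measurable
    hence "(\<lambda>k. ennreal (D (h k))) \<longlonglongrightarrow> ennreal 0" unfolding D_eq by simp
    thus ?thesis by (rule tendsto_ennrealD) (auto simp: D_def)
  qed
  show thesis by (rule that[of D, OF Re_eq _ D_le D_lim]) (auto simp: D_def)
qed

text \<open>The Gaussian-damped energy \<open>E k\<close> is evaluated twice: monotone convergence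
  takes it to the squared norm of the transform, and the autocorrelation identity with dominated
  convergence takes it to \<open>(2 * pi) ^ 3 * N\<close>.\<close>

theorem plancherel_L1_L2:
  assumes f: "integrable lborel f" and fin: "L2sq f < \<infinity>"
  shows "L2sq (fourier_integral f) = ennreal ((2 * pi) ^ 3) * L2sq f"
proof -
  let ?G = "\<lambda>X :: spacetime. exp (- (norm X)\<^sup>2 / 2)"
  let ?g = "sqrt (2 * pi) ^ 3"
  have dim: "DIM(spacetime) = 3" by simp
  have [measurable]: "f \<in> borel_measurable borel" using f by auto
  define N where "N = (LINT x|lborel. (cmod (f x))\<^sup>2)"
  have N: "L2sq f = ennreal N" "0 \<le> N" using fin by (auto simp: N_def L2sq_eq_integral)
  obtain D where D: "\<And>h. Re (autocorrelation f h) = N - D h / 2"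
    "\<And>h. 0 \<le> D h" "\<And>h. D h \<le> 4 * N"
    "\<And>h::nat \<Rightarrow> spacetime. h \<longlonglongrightarrow> 0 \<Longrightarrow> (\<lambda>k. D (h k)) \<longlonglongrightarrow> 0"
    using Re_autocorrelation[OF _ fin] unfolding N_def by auto
  have [measurable]: "autocorrelation f \<in> borel_measurable borel"
    using integrable_autocorrelation[OF f] by auto
  define s where "s k = 1 / real (Suc k)" for k
  have s: "0 < s k" for k by (simp add: s_def)
  have s_lim: "s \<longlonglongrightarrow> 0" unfolding s_def using LIMSEQ_Suc[OF lim_1_over_n] by simp
  define E where "E k = (LINT X|lborel. ?G (s k *\<^sub>R X) * (cmod (fourier_integral f X))\<^sup>2)" for k
  have G_int: "integrable lborel ?G" by (rule gaussian_fourier(2))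
  have G_total: "(LINT h|lborel. ?G h) = ?g"
  proof -
    have "complex_of_real (LINT h|lborel. ?G h) = complex_of_real ?g"
      using gaussian_fourier(1)[of "0::spacetime"] unfolding integral_complex_of_real[symmetric] dim by simp
    thus ?thesis by (simp only: of_real_eq_iff)
  qed
  have bound: "cmod (fourier_integral f X) \<le> (LINT Y|lborel. cmod (f Y))" for X
    by (rule cmod_fourier_integral_le)
  \<comment> \<open>The transform is bounded by the L1 norm of \<open>f\<close>, so damping makes
    its square integrable before its L2 norm is known to be finite.\<close>
  have E_int: "integrable lborel (\<lambda>X. ?G (s k *\<^sub>R X) * (cmod (fourier_integral f X))\<^sup>2)" for k
  proof (rule Bochner_Integration.integrable_bound)
    show "integrable lborel (\<lambda>X. (LINT Y|lborel. cmod (f Y))\<^sup>2 * ?G (s k *\<^sub>R X))"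
      using lborel_integrable_scaleR[OF G_int s[of k]] by (rule integrable_mult_right)
    have "?G (s k *\<^sub>R X) * (cmod (fourier_integral f X))\<^sup>2
      \<le> ?G (s k *\<^sub>R X) * (LINT Y|lborel. cmod (f Y))\<^sup>2" for X
      using bound by (intro mult_left_mono power_mono) simp_all
    thus "AE X in lborel. norm (?G (s k *\<^sub>R X) * (cmod (fourier_integral f X))\<^sup>2)
      \<le> norm ((LINT Y|lborel. cmod (f Y))\<^sup>2 * ?G (s k *\<^sub>R X))"
      by (simp add: mult.commute abs_mult del: norm_scaleR)
  qed measurable
  have E: "E k = ?g * (LINT h|lborel. Re (autocorrelation f (s k *\<^sub>R h)) * ?G h)" for k
  proof -
    have "complex_of_real (E k)
      = (LINT X|lborel. complex_of_real (?G (s k *\<^sub>R X)) * fourier_integral (autocorrelation f) X)"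
      unfolding E_def integral_complex_of_real[symmetric] of_real_mult complex_norm_square
        fourier_integral_mult_cnj[OF f] ..
    also have "\<dots> = complex_of_real ?g
        * (LINT h|lborel. autocorrelation f (s k *\<^sub>R h) * complex_of_real (?G h))"
      by (rule gaussian_fourier_integral[OF s integrable_autocorrelation[OF f]])
    finally have "E k = Re (complex_of_real ?g
        * (LINT h|lborel. autocorrelation f (s k *\<^sub>R h) * complex_of_real (?G h)))"
      by (metis Re_complex_of_real)
    also have "\<dots> = ?g * Re (LINT h|lborel. autocorrelation f (s k *\<^sub>R h) * complex_of_real (?G h))"
      by simp
    also have "Re (LINT h|lborel. autocorrelation f (s k *\<^sub>R h) * complex_of_real (?G h))
      = (LINT h|lborel. Re (autocorrelation f (s k *\<^sub>R h) * complex_of_real (?G h)))"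
    proof (rule integral_Re[symmetric])
      have "integrable lborel (\<lambda>h. complex_of_real (?G h) * autocorrelation f (s k *\<^sub>R h))"
        by (rule integrable_mult_bounded[where K = 1])
          (use lborel_integrable_scaleR[OF integrable_autocorrelation[OF f] s[of k]] in simp_all)
      thus "integrable lborel (\<lambda>h. autocorrelation f (s k *\<^sub>R h) * complex_of_real (?G h))"
        by (simp only: mult.commute)
    qed
    finally show ?thesis by simp
  qed
  have "(\<lambda>k. LINT h|lborel. Re (autocorrelation f (s k *\<^sub>R h)) * ?G h) \<longlonglongrightarrow> (LINT h|lborel. N * ?G h)"
  proof (rule integral_dominated_convergence[where w = "\<lambda>h. 3 * N * ?G h"])
    show "integrable lborel (\<lambda>h. 3 * N * ?G h)" using G_int by simp
    show "AE h in lborel. norm (Re (autocorrelation f (s k *\<^sub>R h)) * ?G h) \<le> 3 * N * ?G h" for k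
    proof (rule AE_I2)
      fix h :: spacetime
      \<comment> \<open>Since \<open>0 \<le> D \<le> 4 * N\<close>, the real part lies between
        \<open>- N\<close> and \<open>N\<close>; \<open>3 * N\<close> is a comfortable
        majorant.\<close>
      have "\<bar>Re (autocorrelation f (s k *\<^sub>R h))\<bar> \<le> 3 * N"
        unfolding D(1) using D(2,3)[of "s k *\<^sub>R h"] N(2) by (auto simp: abs_le_iff)
      thus "norm (Re (autocorrelation f (s k *\<^sub>R h)) * ?G h) \<le> 3 * N * ?G h"
        by (simp add: abs_mult)
    qed
    show "AE h in lborel. (\<lambda>k. Re (autocorrelation f (s k *\<^sub>R h)) * ?G h) \<longlonglongrightarrow> N * ?G h"
    proof (rule AE_I2)
      fix h :: spacetime
      have "(\<lambda>k. s k *\<^sub>R h) \<longlonglongrightarrow> 0 *\<^sub>R h" by (intro tendsto_intros s_lim)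
      hence "(\<lambda>k. (N - D (s k *\<^sub>R h) / 2) * ?G h) \<longlonglongrightarrow> (N - 0 / 2) * ?G h"
        by (intro tendsto_intros D(4)) simp_all
      thus "(\<lambda>k. Re (autocorrelation f (s k *\<^sub>R h)) * ?G h) \<longlonglongrightarrow> N * ?G h"
        by (simp add: D(1))
    qed
  qed auto
  \<comment> \<open>One factor \<open>?g\<close> comes from the transform of the Gaussian, the other
    is its total mass.\<close>
  hence "E \<longlonglongrightarrow> ?g * (N * ?g)"
    unfolding E[abs_def] integral_mult_right_zero G_total by (rule tendsto_mult_left)
  hence lim: "(\<lambda>k. ennreal (E k)) \<longlonglongrightarrow> ennreal (?g * (N * ?g))"
    by (rule tendsto_ennrealI)
  have "(\<lambda>k. \<integral>\<^sup>+ X. ennreal (?G (s k *\<^sub>R X) * (cmod (fourier_integral f X))\<^sup>2) \<partial>lborel)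
    \<longlonglongrightarrow> L2sq (fourier_integral f)"
    unfolding L2sq_def
  proof (rule nn_integral_LIMSEQ)
    show "incseq (\<lambda>k X. ennreal (?G (s k *\<^sub>R X) * (cmod (fourier_integral f X))\<^sup>2))"
    proof (intro incseq_SucI le_funI ennreal_leI mult_right_mono)
      fix k and X :: spacetime
      have "s (Suc k) * norm X \<le> s k * norm X"
        by (intro mult_right_mono) (simp_all add: s_def frac_le)
      hence "norm (s (Suc k) *\<^sub>R X) ^ 2 \<le> norm (s k *\<^sub>R X) ^ 2"
        by (intro power_mono) (simp_all add: abs_of_pos[OF s] less_imp_le[OF s])
      thus "?G (s k *\<^sub>R X) \<le> ?G (s (Suc k) *\<^sub>R X)"
        by simp
    qed simp
    show "(\<lambda>k. ennreal (?G (s k *\<^sub>R X) * (cmod (fourier_integral f X))\<^sup>2))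
      \<longlonglongrightarrow> ennreal ((cmod (fourier_integral f X))\<^sup>2)" for X
    proof -
      have "(\<lambda>k. ennreal (?G (s k *\<^sub>R X) * (cmod (fourier_integral f X))\<^sup>2))
        \<longlonglongrightarrow> ennreal (?G (0 *\<^sub>R X) * (cmod (fourier_integral f X))\<^sup>2)"
        by (intro tendsto_intros s_lim) simp
      thus ?thesis by simp
    qed
  qed measurable
  moreover have "(\<integral>\<^sup>+ X. ennreal (?G (s k *\<^sub>R X) * (cmod (fourier_integral f X))\<^sup>2) \<partial>lborel) = ennreal (E k)" for k
    unfolding E_def by (rule nn_integral_eq_integral[OF E_int]) simp
  ultimately have "L2sq (fourier_integral f) = ennreal (?g * (N * ?g))"
    using LIMSEQ_unique[OF _ lim] by simp
  moreover have "?g * (N * ?g) = (2 * pi) ^ 3 * N"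
  proof -
    have "?g * ?g = (2 * pi) ^ 3" unfolding power_mult_distrib[symmetric] by simp
    moreover have "?g * (N * ?g) = ?g * ?g * N" by (simp only: ac_simps)
    ultimately show ?thesis by (simp only:)
  qed
  moreover have "ennreal ((2 * pi) ^ 3 * N) = ennreal ((2 * pi) ^ 3) * L2sq f"
    unfolding N(1) by (intro ennreal_mult N(2)) simp
  ultimately show ?thesis by (simp only:)
qed

section \<open>The Fourier transform on square integrable functions\<close>

lemma borel_measurable_L2_space: "u \<in> L2_space \<Longrightarrow> u \<in> borel_measurable borel"
  by (simp add: L2_space_def)

lemma L2_norm_L2sq:
  "L2_norm u = (if L2sq u = \<infinity> then \<infinity> else ennreal (sqrt (enn2real (L2sq u))))"
  by (simp add: L2_norm_def L2sq_def Let_def)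

lemma L2_norm_less_iff:
  assumes "0 < k"
  shows "L2_norm u < ennreal k \<longleftrightarrow> L2sq u < ennreal (k\<^sup>2)"
proof (cases "L2sq u")
  case (real x)
  thus ?thesis
    using assms by (simp add: L2_norm_L2sq ennreal_less_iff real_sqrt_less_iff flip: real_less_rsqrt)
      (metis less_eq_real_def real_sqrt_less_iff real_sqrt_unique)
qed (simp add: L2_norm_L2sq)

lemma L2_norm_le_iff:
  assumes "0 \<le> k"
  shows "L2_norm u \<le> ennreal k \<longleftrightarrow> L2sq u \<le> ennreal (k\<^sup>2)"
proof (cases "L2sq u")
  case (real x)
  have "sqrt x \<le> k \<longleftrightarrow> x \<le> k\<^sup>2"
    using assms real(2) by (metis real_le_lsqrt real_sqrt_le_iff real_sqrt_unique)
  thus ?thesis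
    using assms real by (simp add: L2_norm_L2sq)
qed (simp add: L2_norm_L2sq top_unique)

lemma L2_space_iff: "u \<in> L2_space \<longleftrightarrow> u \<in> borel_measurable borel \<and> L2sq u < \<infinity>"
  by (auto simp: L2_space_def L2_norm_L2sq less_top)

lemma ennreal_tendsto_0I:
  fixes f :: "'b \<Rightarrow> ennreal"
  assumes "\<And>e::real. 0 < e \<Longrightarrow> eventually (\<lambda>x. f x < ennreal e) F"
  shows "(f \<longlongrightarrow> 0) F"
proof (rule order_tendstoI)
  fix a :: ennreal assume "0 < a"
  then obtain e :: real where e: "0 < e" "ennreal e \<le> a"
    by (cases a) (auto intro: that[of 1])
  show "eventually (\<lambda>x. f x < a) F"
    using assms[OF e(1)] by eventually_elim (use e(2) in auto)
qed simp

lemma L2_norm_tendsto_0_iff: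
  "((\<lambda>R. L2_norm (f R)) \<longlongrightarrow> 0) F \<longleftrightarrow> ((\<lambda>R. L2sq (f R)) \<longlongrightarrow> 0) F" (is "?L \<longleftrightarrow> ?R")
proof
  assume L: ?L
  show ?R
  proof (rule ennreal_tendsto_0I)
    fix e :: real assume "0 < e"
    hence "eventually (\<lambda>R. L2_norm (f R) < ennreal (sqrt e)) F"
      by (intro order_tendstoD(2)[OF L]) simp
    thus "eventually (\<lambda>R. L2sq (f R) < ennreal e) F"
      using \<open>0 < e\<close> by (simp add: L2_norm_less_iff)
  qed
next
  assume R: ?R
  show ?L
  proof (rule ennreal_tendsto_0I)
    fix e :: real assume e: "0 < e"
    hence "eventually (\<lambda>R. L2sq (f R) < ennreal (e\<^sup>2)) F"
      by (intro order_tendstoD(2)[OF R]) simp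
    thus "eventually (\<lambda>R. L2_norm (f R) < ennreal e) F"
      using e by (simp add: L2_norm_less_iff)
  qed
qed

lemma L2sq_add_le:
  assumes "u \<in> borel_measurable borel" "v \<in> borel_measurable borel" "0 < d"
  shows "L2sq (\<lambda>x. u x + v x) \<le> ennreal (1 + d) * L2sq u + ennreal (1 + 1 / d) * L2sq v"
  unfolding L2sq_def by (rule nn_integral_power2_norm_add_le) (use assms in auto)

lemma L2sq_minus_commute: "L2sq (\<lambda>x. u x - v x) = L2sq (\<lambda>x. v x - u x)"
  by (simp add: L2sq_def norm_minus_commute)

lemma L2sq_triangle:
  assumes "u \<in> borel_measurable borel" "v \<in> borel_measurable borel" "w \<in> borel_measurable borel"
  shows "L2sq (\<lambda>x. u x - w x) \<le> 2 * L2sq (\<lambda>x. u x - v x) + 2 * L2sq (\<lambda>x. v x - w x)"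
  using L2sq_add_le[of "\<lambda>x. u x - v x" "\<lambda>x. v x - w x" 1] assms by simp

lemma L2sq_limit_unique:
  assumes [measurable]: "\<And>n. f n \<in> borel_measurable borel" "v \<in> borel_measurable borel" "w \<in> borel_measurable borel"
    and v: "((\<lambda>n. L2sq (\<lambda>x. f n x - v x)) \<longlongrightarrow> 0) F" and w: "((\<lambda>n. L2sq (\<lambda>x. f n x - w x)) \<longlongrightarrow> 0) F"
    and F: "F \<noteq> bot"
  shows "AE x in lborel. v x = w x"
proof -
  have "((\<lambda>n. 2 * L2sq (\<lambda>x. f n x - v x) + 2 * L2sq (\<lambda>x. f n x - w x)) \<longlongrightarrow> 2 * 0 + 2 * 0) F"
    by (intro tendsto_add ennreal_tendsto_cmult v w) auto
  moreover have "L2sq (\<lambda>x. v x - w x) \<le> 2 * L2sq (\<lambda>x. f n x - v x) + 2 * L2sq (\<lambda>x. f n x - w x)" for n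
    using L2sq_triangle[of v "f n" w] by (simp add: L2sq_minus_commute[of v])
  ultimately have "L2sq (\<lambda>x. v x - w x) \<le> 2 * 0 + 2 * 0"
    by (intro tendsto_lowerbound[OF _ always_eventually F]) auto
  hence "L2sq (\<lambda>x. v x - w x) = 0" by simp
  thus ?thesis
    unfolding L2sq_def by (subst (asm) nn_integral_0_iff_AE) auto
qed

text \<open>Comparing \<open>f n\<close> and \<open>v\<close> both ways with weight \<open>d\<close>
  gives each inequality up to the factor \<open>1 + d\<close>, which is then sent to 1.\<close>

lemma L2sq_limit_norm:
  assumes [measurable]: "\<And>n. f n \<in> borel_measurable borel" "v \<in> borel_measurable borel"
    and v: "((\<lambda>n. L2sq (\<lambda>x. f n x - v x)) \<longlongrightarrow> 0) F" and N: "((\<lambda>n. L2sq (f n)) \<longlongrightarrow> N) F"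
    and F: "F \<noteq> bot"
  shows "L2sq v = N"
proof -
  have le: "a \<le> b" if d: "\<And>d. 0 < d \<Longrightarrow> a \<le> ennreal (1 + d) * b" for a b
  proof (rule tendsto_lowerbound[where F = sequentially])
    have "(\<lambda>n. ennreal (1 + 1 / real (Suc n)) * b) \<longlonglongrightarrow> ennreal (1 + 0) * b"
      by (intro tendsto_mult_ennreal tendsto_ennrealI tendsto_add tendsto_const LIMSEQ_Suc[OF lim_1_over_n]) auto
    thus "(\<lambda>n. ennreal (1 + 1 / real (Suc n)) * b) \<longlonglongrightarrow> b" by simp
    show "eventually (\<lambda>n. a \<le> ennreal (1 + 1 / real (Suc n)) * b) sequentially"
      by (intro always_eventually allI d) simp
  qed simp
  show ?thesis
  proof (rule antisym; rule le)
    fix d :: real assume d: "0 < d"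
    have "((\<lambda>n. ennreal (1 + d) * L2sq (f n) + ennreal (1 + 1 / d) * L2sq (\<lambda>x. f n x - v x))
        \<longlongrightarrow> ennreal (1 + d) * N + ennreal (1 + 1 / d) * 0) F"
      by (intro tendsto_add ennreal_tendsto_cmult v N) auto
    moreover have "L2sq v \<le> ennreal (1 + d) * L2sq (f n) + ennreal (1 + 1 / d) * L2sq (\<lambda>x. f n x - v x)" for n
      using L2sq_add_le[of "f n" "\<lambda>x. v x - f n x" d] d by (simp add: L2sq_minus_commute[of v])
    ultimately show "L2sq v \<le> ennreal (1 + d) * N"
      using tendsto_lowerbound[OF _ always_eventually F] by fastforce
    have "((\<lambda>n. ennreal (1 + d) * L2sq v + ennreal (1 + 1 / d) * L2sq (\<lambda>x. f n x - v x))
        \<longlongrightarrow> ennreal (1 + d) * L2sq v + ennreal (1 + 1 / d) * 0) F"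
      by (intro tendsto_add ennreal_tendsto_cmult tendsto_const v) auto
    moreover have "L2sq (f n) \<le> ennreal (1 + d) * L2sq v + ennreal (1 + 1 / d) * L2sq (\<lambda>x. f n x - v x)" for n
      using L2sq_add_le[of v "\<lambda>x. f n x - v x" d] d by simp
    ultimately show "N \<le> ennreal (1 + d) * L2sq v"
      using tendsto_le[OF F _ N] by fastforce
  qed
qed

section \<open>Completeness of L2\<close>

text \<open>Riesz--Fischer: a rapidly Cauchy subsequence converges almost everywhere, and Fatou's
  lemma upgrades this to L2 convergence of the whole sequence.\<close>

lemma L2_complete:
  fixes f :: "nat \<Rightarrow> 'a::euclidean_space \<Rightarrow> complex"
  assumes [measurable]: "\<And>n. f n \<in> borel_measurable borel"
    and Cauchy: "\<And>e::real. 0 < e \<Longrightarrow> \<exists>N. \<forall>m\<ge>N. \<forall>n\<ge>N. L2sq (\<lambda>x. f m x - f n x) < ennreal e"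
  obtains v where "v \<in> borel_measurable borel" "(\<lambda>n. L2sq (\<lambda>x. f n x - v x)) \<longlonglongrightarrow> 0"
proof -
  \<comment> \<open>The rate \<open>(1 / 8) ^ k\<close> leaves room for a weight
    \<open>4 ^ k\<close>: the weighted sum of squares still has finite integral, and where it is
    finite it forces the increments below a multiple of \<open>(1 / 2) ^ k\<close>.\<close>
  define P where "P k N \<longleftrightarrow> (\<forall>m\<ge>N. \<forall>n\<ge>N. L2sq (\<lambda>x. f m x - f n x) < ennreal ((1 / 8) ^ k))" for k N
  obtain r where r: "strict_mono r" "\<And>k::nat. P k (r k)"
  proof -
    have "\<exists>r. strict_mono r \<and> (\<forall>k. P k (r k))"
    proof -
      define N0 where "N0 k = (SOME N. P k N)" for k
      have N0: "P k (N0 k)" for k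
        unfolding N0_def P_def by (rule someI_ex) (use Cauchy[of "(1 / 8) ^ k"] in auto)
      \<comment> \<open>Summing the thresholds makes \<open>r k\<close> dominate
        \<open>N0 k\<close>; adding \<open>k\<close> makes it strictly increasing.\<close>
      define r where "r k = (\<Sum>i\<le>k. N0 i) + k" for k
      have "N0 k \<le> r k" for k unfolding r_def by (cases k) auto
      hence "P k (r k)" for k using N0[of k] unfolding P_def by (meson order_trans)
      moreover have "strict_mono r" unfolding strict_mono_Suc_iff r_def by simp
      ultimately show ?thesis by blast
    qed
    thus ?thesis using that by blast
  qed
  define d where "d k x = f (r (Suc k)) x - f (r k) x" for k x
  have [measurable]: "d k \<in> borel_measurable borel" for k unfolding d_def by measurable
  have "(\<integral>\<^sup>+ x. (\<Sum>k. ennreal (4 ^ k) * ennreal ((cmod (d k x))\<^sup>2)) \<partial>lborel)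
    = (\<Sum>k. ennreal (4 ^ k) * L2sq (d k))"
    by (subst nn_integral_suminf) (simp_all add: nn_integral_cmult L2sq_def)
  also have "\<dots> \<le> (\<Sum>k. ennreal ((1 / 2) ^ k))"
  proof (rule suminf_le)
    fix k
    have "L2sq (d k) \<le> ennreal ((1 / 8) ^ k)"
      using r(2)[of k] strict_monoD[OF r(1), of k "Suc k"] unfolding P_def d_def by (auto intro: less_imp_le)
    hence "ennreal (4 ^ k) * L2sq (d k) \<le> ennreal (4 ^ k) * ennreal ((1 / 8) ^ k)"
      by (rule mult_left_mono) simp
    also have "\<dots> = ennreal ((1 / 2) ^ k)"
      by (simp add: ennreal_mult'[symmetric] power_mult_distrib[symmetric] del: power_divide)
    finally show "ennreal (4 ^ k) * L2sq (d k) \<le> ennreal ((1 / 2) ^ k)" .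
  qed auto
  also have "\<dots> < \<infinity>"
    by (subst suminf_ennreal2) (auto intro: summable_geometric)
  finally have "AE x in lborel. (\<Sum>k. ennreal (4 ^ k) * ennreal ((cmod (d k x))\<^sup>2)) \<noteq> \<infinity>"
    by (intro nn_integral_PInf_AE) auto
  hence conv: "AE x in lborel. convergent (\<lambda>k. f (r k) x)"
  proof eventually_elim
    case (elim x)
    then obtain K where K: "(\<Sum>k. ennreal (4 ^ k) * ennreal ((cmod (d k x))\<^sup>2)) = ennreal K" "0 \<le> K"
      by (cases "\<Sum>k. ennreal (4 ^ k) * ennreal ((cmod (d k x))\<^sup>2)") auto
    have "cmod (d k x) \<le> sqrt K * (1 / 2) ^ k" for k
    proof -
      have "ennreal (4 ^ k) * ennreal ((cmod (d k x))\<^sup>2) \<le> ennreal K"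
        unfolding K(1)[symmetric] using sum_le_suminf[of "\<lambda>k. ennreal (4 ^ k) * ennreal ((cmod (d k x))\<^sup>2)" "{k}"]
        by simp
      hence "4 ^ k * (cmod (d k x))\<^sup>2 \<le> K"
        using K(2) by (simp flip: ennreal_mult')
      moreover have "(2 ^ k * cmod (d k x))\<^sup>2 = 4 ^ k * (cmod (d k x))\<^sup>2"
        by (simp add: power_mult_distrib flip: power_mult) (simp add: power_mult power2_eq_square mult.commute flip: power_mult_distrib)
      ultimately have "2 ^ k * cmod (d k x) \<le> sqrt K"
        by (intro real_le_rsqrt) simp
      thus ?thesis by (simp add: field_simps)
    qed
    hence "summable (\<lambda>k. d k x)"
      by (intro summable_comparison_test'[where N = 0, OF summable_mult[OF summable_geometric[of "1 / 2"]]]) auto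
    hence "convergent (\<lambda>n. \<Sum>k<n. d k x)" by (simp add: summable_iff_convergent)
    moreover have "(\<Sum>k<n. d k x) = f (r n) x - f (r 0) x" for n
      unfolding d_def by (rule sum_lessThan_telescope)
    ultimately have "convergent (\<lambda>n. (f (r n) x - f (r 0) x) + f (r 0) x)"
      by (intro convergent_add convergent_const) simp
    thus ?case by simp
  qed
  define v where "v x = lim (\<lambda>k. f (r k) x)" for x
  have [measurable]: "v \<in> borel_measurable borel" unfolding v_def by measurable
  \<comment> \<open>The index \<open>n\<close> stays fixed while the second index runs along the
    subsequence, so Fatou bounds the distance to \<open>v\<close> by the Cauchy bound.\<close>
  have bound: "L2sq (\<lambda>x. f n x - v x) \<le> ennreal e"
    if e: "\<And>m. m \<ge> N \<Longrightarrow> L2sq (\<lambda>x. f n x - f m x) < ennreal e" for n N e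
  proof -
    have "L2sq (\<lambda>x. f n x - v x) = (\<integral>\<^sup>+ x. liminf (\<lambda>k. ennreal ((cmod (f n x - f (r k) x))\<^sup>2)) \<partial>lborel)"
      unfolding L2sq_def
    proof (rule nn_integral_cong_AE)
      show "AE x in lborel. ennreal ((cmod (f n x - v x))\<^sup>2) = liminf (\<lambda>k. ennreal ((cmod (f n x - f (r k) x))\<^sup>2))"
        using conv
      proof eventually_elim
        case (elim x)
        hence "(\<lambda>k. f (r k) x) \<longlonglongrightarrow> v x" by (simp add: v_def convergent_LIMSEQ_iff)
        hence "(\<lambda>k. ennreal ((cmod (f n x - f (r k) x))\<^sup>2)) \<longlonglongrightarrow> ennreal ((cmod (f n x - v x))\<^sup>2)"
          by (intro tendsto_intros)
        thus ?case by (intro lim_imp_Liminf[symmetric]) simp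
      qed
    qed
    also have "\<dots> \<le> liminf (\<lambda>k. L2sq (\<lambda>x. f n x - f (r k) x))"
      unfolding L2sq_def by (rule nn_integral_liminf) auto
    also have "\<dots> \<le> ennreal e"
    proof (rule Liminf_le)
      have "eventually (\<lambda>k. r k \<ge> N) sequentially"
        using filterlim_subseq[OF r(1)] by (auto simp: filterlim_at_top)
      thus "eventually (\<lambda>k. L2sq (\<lambda>x. f n x - f (r k) x) \<le> ennreal e) sequentially"
        by eventually_elim (auto intro: less_imp_le e)
    qed simp
    finally show ?thesis .
  qed
  have "(\<lambda>n. L2sq (\<lambda>x. f n x - v x)) \<longlonglongrightarrow> 0"
  proof (rule ennreal_tendsto_0I)
    fix e :: real assume e: "0 < e"
    then obtain N where N: "\<And>m n. m \<ge> N \<Longrightarrow> n \<ge> N \<Longrightarrow> L2sq (\<lambda>x. f m x - f n x) < ennreal (e / 2)"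
      using Cauchy[of "e / 2"] by auto
    have "L2sq (\<lambda>x. f n x - v x) < ennreal e" if "n \<ge> N" for n
      using bound[of N n "e / 2"] N[OF that] e
      by (auto intro: order_le_less_trans simp: ennreal_less_iff)
    thus "eventually (\<lambda>n. L2sq (\<lambda>x. f n x - v x) < ennreal e) sequentially"
      by (auto simp: eventually_sequentially)
  qed
  thus thesis using that[of v] by simp
qed

text \<open>On a ball, which has finite measure, \<open>|u| \<le> 1 + |u|^2\<close> supplies an
  integrable majorant; this puts truncations within reach of the Fourier integral.\<close>

lemma integrable_bounded_support:
  fixes u :: "'a::euclidean_space \<Rightarrow> complex"
  assumes [measurable]: "u \<in> borel_measurable borel" and fin: "L2sq u < \<infinity>"
    and supp: "AE x in lborel. x \<notin> cball 0 R \<longrightarrow> u x = 0"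
  shows "integrable lborel u"
proof (rule Bochner_Integration.integrable_bound)
  have "integrable lborel (\<lambda>x::'a. indicator (cball 0 R) x :: real)"
    using emeasure_bounded_finite[OF bounded_cball[of "0::'a" R]]
    by (auto simp: integrable_indicator_iff intro: borel_closed)
  thus "integrable lborel (\<lambda>x::'a. indicator (cball 0 R) x + (cmod (u x))\<^sup>2)"
    using L2sq_eq_integral(1)[OF assms(1) fin] by (rule Bochner_Integration.integrable_add)
  show "AE x in lborel. norm (u x) \<le> norm (indicator (cball 0 R) x + (cmod (u x))\<^sup>2)"
    using supp
  proof eventually_elim
    case (elim x)
    have "cmod (u x) \<le> 1 + (cmod (u x))\<^sup>2"
      using sum_squares_bound[of 1 "cmod (u x)"] norm_ge_zero[of "u x"]
      unfolding power_one mult_1_right by linarith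
    thus ?case using elim by (cases "x \<in> cball 0 R") auto
  qed
qed simp

section \<open>The L2 transform as a limit of truncations\<close>

definition truncation :: "real \<Rightarrow> ('a::euclidean_space \<Rightarrow> complex) \<Rightarrow> 'a \<Rightarrow> complex" where
  "truncation R u x = indicator (cball 0 R) x * u x"

lemma borel_measurable_truncation [measurable (raw)]:
  assumes [measurable]: "u \<in> borel_measurable borel"
  shows "truncation R u \<in> borel_measurable borel"
proof -
  have [measurable]: "cball (0::'a) R \<in> sets borel" by (rule borel_closed) auto
  show ?thesis unfolding truncation_def[abs_def] by measurable
qed

lemma L2sq_truncation_le: "L2sq (truncation R u) \<le> L2sq u"
  unfolding L2sq_def truncation_def
  by (intro nn_integral_mono ennreal_leI power_mono) (auto simp: norm_mult indicator_def)

lemma integrable_truncation: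
  assumes "u \<in> borel_measurable borel" "L2sq u < \<infinity>"
  shows "integrable lborel (truncation R u)"
  using assms L2sq_truncation_le[of R u]
  by (intro integrable_bounded_support[where R = R])
    (auto simp: borel_measurable_truncation truncation_def[of R u] intro: order_le_less_trans)

lemma truncation_tail_tendsto:
  fixes u :: "'a::euclidean_space \<Rightarrow> complex"
  assumes [measurable]: "u \<in> borel_measurable borel" and fin: "L2sq u < \<infinity>"
  shows "(\<lambda>n. L2sq (\<lambda>x. truncation (real n) u x - u x)) \<longlonglongrightarrow> 0"
proof -
  have "(\<lambda>n. L2sq (\<lambda>x. truncation (real n) u x - u x)) \<longlonglongrightarrow> (\<integral>\<^sup>+ (x::'a). 0 \<partial>lborel)"
    unfolding L2sq_def
  proof (rule nn_integral_dominated_convergence[where w = "\<lambda>x. ennreal ((cmod (u x))\<^sup>2)"])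
    show "AE x in lborel. ennreal ((cmod (truncation (real n) u x - u x))\<^sup>2) \<le> ennreal ((cmod (u x))\<^sup>2)" for n
      by (auto simp: truncation_def indicator_def)
    show "AE x in lborel. (\<lambda>n. ennreal ((cmod (truncation (real n) u x - u x))\<^sup>2)) \<longlonglongrightarrow> 0"
    proof (rule AE_I2)
      fix x :: 'a
      obtain m :: nat where "norm x \<le> real m" using real_arch_simple by blast
      hence "eventually (\<lambda>n. ennreal ((cmod (truncation (real n) u x - u x))\<^sup>2) = 0) sequentially"
        unfolding eventually_sequentially truncation_def
        by (intro exI[of _ m]) (auto simp: indicator_def)
      thus "(\<lambda>n. ennreal ((cmod (truncation (real n) u x - u x))\<^sup>2)) \<longlonglongrightarrow> 0" by (rule tendsto_eventually)
    qed
    show "(\<integral>\<^sup>+ x. ennreal ((cmod (u x))\<^sup>2) \<partial>lborel) < \<infinity>" using fin by (simp add: L2sq_def)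
  qed auto
  thus ?thesis by simp
qed

lemma L2sq_truncation_tendsto:
  fixes u :: "'a::euclidean_space \<Rightarrow> complex"
  assumes u: "u \<in> borel_measurable borel"
  shows "(\<lambda>n. L2sq (truncation (real n) u)) \<longlonglongrightarrow> L2sq u"
proof -
  have "incseq (\<lambda>n. (\<lambda>x. ennreal ((cmod (truncation (real n) u x))\<^sup>2)))"
    by (auto simp: incseq_def le_fun_def truncation_def indicator_def)
  moreover have "(\<lambda>n. ennreal ((cmod (truncation (real n) u x))\<^sup>2)) \<longlonglongrightarrow> ennreal ((cmod (u x))\<^sup>2)" for x
  proof -
    obtain m :: nat where "norm x \<le> real m" using real_arch_simple by blast
    hence "eventually (\<lambda>n. ennreal ((cmod (truncation (real n) u x))\<^sup>2) = ennreal ((cmod (u x))\<^sup>2)) sequentially"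
      unfolding eventually_sequentially truncation_def
      by (intro exI[of _ m]) (auto simp: indicator_def)
    thus ?thesis by (rule tendsto_eventually)
  qed
  ultimately show ?thesis
    unfolding L2sq_def using u borel_measurable_truncation[OF u]
    by (intro nn_integral_LIMSEQ) auto
qed

text \<open>The difference lives on the shell \<open>S < norm x \<le> R\<close>, where its modulus
  is that of the tail beyond \<open>S\<close>; the bound is uniform in \<open>R\<close>.\<close>

lemma L2sq_diff_truncation_le:
  assumes "S \<le> R"
  shows "L2sq (\<lambda>x. truncation R u x - truncation S u x) \<le> L2sq (\<lambda>x. truncation S u x - u x)"
  unfolding L2sq_def truncation_def using assms
  by (intro nn_integral_mono ennreal_leI power_mono) (auto simp: indicator_def)

lemma L2sq_fourier_integral_diff_truncation:
  assumes u: "u \<in> borel_measurable borel" "L2sq u < \<infinity>"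
  shows "L2sq (\<lambda>X. fourier_integral (truncation R u) X - fourier_integral (truncation S u) X)
    = ennreal ((2 * pi) ^ 3) * L2sq (\<lambda>X. truncation R u X - truncation S u X)"
proof -
  have e: "integrable lborel (\<lambda>Y. exp (- (\<i> * complex_of_real (X \<bullet> Y))) * f Y)"
    if "integrable lborel f" for f and X :: spacetime
    by (rule integrable_mult_bounded[OF that, where K = 1]) (auto simp: norm_exp_eq_Re)
  have "fourier_integral (truncation R u) X - fourier_integral (truncation S u) X
    = fourier_integral (\<lambda>Y. truncation R u Y - truncation S u Y) X" for X
    unfolding fourier_integral_def right_diff_distrib
    by (intro Bochner_Integration.integral_diff[symmetric] e integrable_truncation u)
  moreover have "L2sq (\<lambda>Y. truncation R u Y - truncation S u Y) < \<infinity>"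
  proof -
    have "L2sq (\<lambda>Y. truncation R u Y - truncation S u Y) \<le> L2sq u"
      unfolding L2sq_def truncation_def
      by (intro nn_integral_mono ennreal_leI power_mono) (auto simp: indicator_def)
    thus ?thesis using u(2) by (rule order_le_less_trans)
  qed
  ultimately show ?thesis
    using plancherel_L1_L2[of "\<lambda>Y. truncation R u Y - truncation S u Y"]
      integrable_truncation[OF u] by (simp add: Bochner_Integration.integrable_diff)
qed

lemma ennreal_cmult_tendsto_0:
  fixes f :: "'b \<Rightarrow> ennreal"
  assumes "(f \<longlongrightarrow> 0) F"
  shows "((\<lambda>x. ennreal c * f x) \<longlongrightarrow> 0) F"
  using ennreal_tendsto_cmult[OF _ assms, of "ennreal c"] by simp

text \<open>By Plancherel the transforms of truncations at integer radii are Cauchy because the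
  truncations are; the norm of the limit is the limit of the norms.\<close>

lemma L2_fourier_limit_exists:
  assumes u: "u \<in> borel_measurable borel" "L2sq u < \<infinity>"
  obtains v where "v \<in> borel_measurable borel" "L2sq v = ennreal ((2 * pi) ^ 3) * L2sq u"
    "((\<lambda>R. L2sq (\<lambda>X. fourier_integral (truncation R u) X - v X)) \<longlongrightarrow> 0) at_top"
proof -
  let ?c = "ennreal ((2 * pi) ^ 3)"
  let ?F = "\<lambda>R. fourier_integral (truncation R u)"
  let ?tail = "\<lambda>n. ?c * L2sq (\<lambda>x. truncation (real n) u x - u x)"
  have [measurable]: "?F R \<in> borel_measurable borel" for R
    by (intro fourier_integral_measurable borel_measurable_truncation u)
  have tail: "?tail \<longlonglongrightarrow> 0"
    by (intro ennreal_cmult_tendsto_0 truncation_tail_tendsto u)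
  have diff: "L2sq (\<lambda>X. ?F R X - ?F (real n) X) \<le> ?tail n" if "real n \<le> R" for n R
    unfolding L2sq_fourier_integral_diff_truncation[OF u]
    by (intro mult_left_mono L2sq_diff_truncation_le that) simp
  obtain v where v [measurable]: "v \<in> borel_measurable borel"
    and lim: "(\<lambda>n. L2sq (\<lambda>X. ?F (real n) X - v X)) \<longlonglongrightarrow> 0"
  proof (rule L2_complete[where f = "\<lambda>n. ?F (real n)"])
    fix e :: real assume "0 < e"
    then obtain N where N: "\<And>n. n \<ge> N \<Longrightarrow> ?tail n < ennreal e"
      using order_tendstoD(2)[OF tail, of "ennreal e"] by (auto simp: eventually_sequentially)
    have "L2sq (\<lambda>x. ?F (real m) x - ?F (real n) x) < ennreal e" if "m \<ge> N" "n \<ge> N" for m n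
    proof (cases "n \<le> m")
      case True
      thus ?thesis using diff[of n "real m"] N[OF that(2)] by (simp add: order_le_less_trans)
    next
      case False
      thus ?thesis using diff[of m "real n"] N[OF that(1)]
        by (subst L2sq_minus_commute) (simp add: order_le_less_trans)
    qed
    thus "\<exists>N. \<forall>m\<ge>N. \<forall>n\<ge>N. L2sq (\<lambda>x. ?F (real m) x - ?F (real n) x) < ennreal e" by blast
  qed (auto intro: that)
  \<comment> \<open>The definition of \<open>L2_fourier\<close> takes the limit over real radii. The
    tail bound is uniform in \<open>R \<ge> real n\<close>, so one good integer \<open>n\<close>
    controls all larger \<open>R\<close>.\<close>
  have lim_real: "((\<lambda>R. L2sq (\<lambda>X. ?F R X - v X)) \<longlongrightarrow> 0) at_top"
  proof (rule ennreal_tendsto_0I)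
    fix e :: real assume "0 < e"
    have "(\<lambda>n. 2 * ?tail n + 2 * L2sq (\<lambda>X. ?F (real n) X - v X)) \<longlonglongrightarrow> 2 * 0 + 2 * 0"
      by (intro tendsto_add ennreal_tendsto_cmult tail lim) auto
    hence "eventually (\<lambda>n. 2 * ?tail n + 2 * L2sq (\<lambda>X. ?F (real n) X - v X) < ennreal e) sequentially"
      using \<open>0 < e\<close> by (intro order_tendstoD(2)) auto
    then obtain n where n: "2 * ?tail n + 2 * L2sq (\<lambda>X. ?F (real n) X - v X) < ennreal e"
      by (auto simp: eventually_sequentially)
    have "L2sq (\<lambda>X. ?F R X - v X) < ennreal e" if "R \<ge> real n" for R
    proof -
      have "L2sq (\<lambda>X. ?F R X - v X)
        \<le> 2 * L2sq (\<lambda>X. ?F R X - ?F (real n) X) + 2 * L2sq (\<lambda>X. ?F (real n) X - v X)"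
        by (rule L2sq_triangle) auto
      also have "\<dots> \<le> 2 * ?tail n + 2 * L2sq (\<lambda>X. ?F (real n) X - v X)"
        by (intro add_right_mono mult_left_mono diff that) simp
      finally show ?thesis using n by (rule order_le_less_trans)
    qed
    thus "eventually (\<lambda>R. L2sq (\<lambda>X. ?F R X - v X) < ennreal e) at_top"
      by (auto simp: eventually_at_top_linorder)
  qed
  have "(\<lambda>n. L2sq (truncation (real n) u)) \<longlonglongrightarrow> L2sq u"
    by (rule L2sq_truncation_tendsto[OF u(1)])
  hence "(\<lambda>n. ?c * L2sq (truncation (real n) u)) \<longlonglongrightarrow> ?c * L2sq u"
    by (intro ennreal_tendsto_cmult) auto
  moreover have "?c * L2sq (truncation R u) = L2sq (?F R)" for R
    using L2sq_truncation_le[of R u] u(2)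
    by (intro plancherel_L1_L2[symmetric] integrable_truncation u) (rule order_le_less_trans)
  ultimately have "L2sq v = ?c * L2sq u"
    using L2sq_limit_norm[OF _ v lim] by simp
  thus thesis using that[OF v _ lim_real] by simp
qed

lemma L2_fourier_limit:
  assumes u: "u \<in> L2_space"
  shows "L2_fourier u \<in> L2_space"
    and "((\<lambda>R. L2sq (\<lambda>X. fourier_integral (truncation R u) X - L2_fourier u X)) \<longlongrightarrow> 0) at_top"
proof -
  have *: "u \<in> borel_measurable borel" "L2sq u < \<infinity>" using u by (auto simp: L2_space_iff)
  let ?Q = "\<lambda>v. v \<in> L2_space \<and>
    ((\<lambda>R. L2_norm (\<lambda>X. fourier_integral (\<lambda>Y. indicator (cball 0 R) Y * u Y) X - v X)) \<longlongrightarrow> 0) at_top"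
  obtain v where "v \<in> borel_measurable borel" "L2sq v = ennreal ((2 * pi) ^ 3) * L2sq u"
    "((\<lambda>R. L2sq (\<lambda>X. fourier_integral (truncation R u) X - v X)) \<longlongrightarrow> 0) at_top"
    by (rule L2_fourier_limit_exists[OF *])
  hence "?Q v"
    using *(2) unfolding L2_norm_tendsto_0_iff truncation_def[abs_def]
    by (simp add: L2_space_iff ennreal_mult_less_top)
  hence "?Q (L2_fourier u)" unfolding L2_fourier_def by (rule someI[of ?Q])
  thus "L2_fourier u \<in> L2_space"
    "((\<lambda>R. L2sq (\<lambda>X. fourier_integral (truncation R u) X - L2_fourier u X)) \<longlongrightarrow> 0) at_top"
    unfolding L2_norm_tendsto_0_iff truncation_def[abs_def] by auto
qed

text \<open>L2 limits are unique up to null sets, so any computed limit may replace the chosen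
  representative almost everywhere.\<close>

lemma L2_fourier_unique:
  assumes u: "u \<in> L2_space" and v: "v \<in> borel_measurable borel"
    and lim: "((\<lambda>R. L2sq (\<lambda>X. fourier_integral (truncation R u) X - v X)) \<longlongrightarrow> 0) at_top"
  shows "AE X in lborel. L2_fourier u X = v X"
proof (rule L2sq_limit_unique[OF _ _ v L2_fourier_limit(2)[OF u] lim])
  show "fourier_integral (truncation R u) \<in> borel_measurable borel" for R
    using u by (intro fourier_integral_measurable borel_measurable_truncation borel_measurable_L2_space)
  show "L2_fourier u \<in> borel_measurable borel"
    using L2_fourier_limit(1)[OF u] by (rule borel_measurable_L2_space)
qed simp

lemma L2sq_cong_AE:
  assumes "AE x in lborel. cmod (u x) = cmod (v x)"
  shows "L2sq u = L2sq v"
  unfolding L2sq_def using assms by (intro nn_integral_cong_AE) auto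

theorem plancherel_L2:
  assumes u: "u \<in> L2_space"
  shows "L2sq (L2_fourier u) = ennreal ((2 * pi) ^ 3) * L2sq u"
proof -
  have *: "u \<in> borel_measurable borel" "L2sq u < \<infinity>" using u by (auto simp: L2_space_iff)
  obtain v where v: "v \<in> borel_measurable borel" "L2sq v = ennreal ((2 * pi) ^ 3) * L2sq u"
    "((\<lambda>R. L2sq (\<lambda>X. fourier_integral (truncation R u) X - v X)) \<longlongrightarrow> 0) at_top"
    by (rule L2_fourier_limit_exists[OF *])
  have "L2sq (L2_fourier u) = L2sq v"
    using L2_fourier_unique[OF u v(1,3)] by (intro L2sq_cong_AE) auto
  thus ?thesis using v(2) by simp
qed

section \<open>Inversion for bounded support\<close>

text \<open>The multiplication formula: the kernel is symmetric in its two variables, so Fubini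
  moves the transform from one factor to the other.\<close>

lemma fourier_integral_duality:
  assumes f: "integrable lborel f" and g: "integrable lborel g"
  shows "(LINT X|lborel. fourier_integral f X * g X) = (LINT Y|lborel. f Y * fourier_integral g Y)"
proof -
  let ?e = "\<lambda>X Y :: spacetime. exp (- (\<i> * complex_of_real (X \<bullet> Y)))"
  have "(LINT X|lborel. fourier_integral f X * g X)
    = (LINT X|lborel. (LINT Y|lborel. ?e X Y * (g X * f Y)))"
  proof (rule Bochner_Integration.integral_cong)
    fix X :: spacetime
    have "fourier_integral f X * g X = (LINT Y|lborel. ?e X Y * f Y * g X)"
      unfolding fourier_integral_def by (rule integral_mult_left_zero[symmetric])
    thus "fourier_integral f X * g X = (LINT Y|lborel. ?e X Y * (g X * f Y))"
      by (simp only: ac_simps)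
  qed simp
  also have "\<dots> = (LINT Y|lborel. (LINT X|lborel. ?e X Y * (g X * f Y)))"
    using integrable_pair_bounded[OF g f, of "\<lambda>z. ?e (fst z) (snd z)" 1]
    by (intro lborel_pair.Fubini_integral[symmetric]) (simp add: norm_exp_eq_Re)
  also have "\<dots> = (LINT Y|lborel. f Y * fourier_integral g Y)"
  proof (rule Bochner_Integration.integral_cong)
    fix Y :: spacetime
    have "f Y * fourier_integral g Y = (LINT X|lborel. f Y * (?e Y X * g X))"
      unfolding fourier_integral_def by (rule integral_mult_right_zero[symmetric])
    thus "(LINT X|lborel. ?e X Y * (g X * f Y)) = f Y * fourier_integral g Y"
      by (simp only: ac_simps inner_commute)
  qed simp
  finally show ?thesis .
qed

text \<open>The candidate \<open>w\<close> is the inverse Fourier integral of \<open>f\<close>,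
  checked in norm: \<open>T k\<close> has squared norm \<open>?c * n k\<close> and inner product
  \<open>?c * n k\<close> with \<open>f\<close>, so its squared distance from \<open>f\<close> is
  \<open>Nf - ?c * n k\<close>, which tends to 0.\<close>

lemma L2_fourier_surj_bounded_support:
  assumes f: "f \<in> L2_space" and supp: "AE X in lborel. X \<notin> cball 0 R \<longrightarrow> f X = 0"
  shows "\<exists>w \<in> L2_space. AE X in lborel. L2_fourier w X = f X"
proof -
  let ?c = "(2 * pi) ^ 3"
  have c: "0 < ?c" by simp
  have f_meas [measurable]: "f \<in> borel_measurable borel" and f_fin: "L2sq f < \<infinity>"
    using f by (auto simp: L2_space_iff)
  have f_int: "integrable lborel f" by (rule integrable_bounded_support[OF f_meas f_fin supp])
  define f' where "f' X = cnj (f X)" for X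
  have f'_int: "integrable lborel f'" unfolding f'_def using f_int by simp
  have f'_meas [measurable]: "f' \<in> borel_measurable borel" unfolding f'_def by measurable
  have L2sq_f': "L2sq f' = L2sq f" by (simp add: L2sq_def f'_def)
  define g where "g = fourier_integral f'"
  have g_meas [measurable]: "g \<in> borel_measurable borel" unfolding g_def by measurable
  have g: "L2sq g = ennreal ?c * L2sq f"
    using plancherel_L1_L2[OF f'_int] f_fin by (simp add: L2sq_f' g_def)
  hence g_fin: "L2sq g < \<infinity>" using f_fin by (simp add: ennreal_mult_less_top)
  \<comment> \<open>Conjugation before and after the transform flips the sign in the exponential,
    and \<open>?c\<close> normalises.\<close>
  define w where "w X = cnj (g X) / complex_of_real ?c" for X
  have w_meas [measurable]: "w \<in> borel_measurable borel" unfolding w_def by measurable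
  define Nf where "Nf = (LINT X|lborel. (cmod (f X))\<^sup>2)"
  have Nf: "L2sq f = ennreal Nf" "0 \<le> Nf"
    unfolding Nf_def by (rule L2sq_eq_integral(2)[OF f_meas f_fin]) simp
  have "L2sq w = (\<integral>\<^sup>+ X. ennreal (1 / ?c\<^sup>2) * ennreal ((cmod (g X))\<^sup>2) \<partial>lborel)"
    unfolding L2sq_def w_def
    by (intro nn_integral_cong)
      (simp add: norm_divide power_divide norm_power norm_mult flip: ennreal_mult')
  also have "\<dots> = ennreal (1 / ?c\<^sup>2) * L2sq g"
    unfolding L2sq_def by (rule nn_integral_cmult) auto
  also have "\<dots> = ennreal (1 / ?c\<^sup>2 * (?c * Nf))"
    unfolding g Nf(1) using Nf(2) c
    by (simp only: ennreal_mult zero_le_divide_1_iff zero_le_power2 mult_nonneg_nonneg less_imp_le)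
  also have "1 / ?c\<^sup>2 * (?c * Nf) = Nf / ?c"
  proof -
    have "1 / x\<^sup>2 * (x * Nf) = Nf / x" if "0 < x" for x
      using that by (simp add: power2_eq_square)
    thus ?thesis using c .
  qed
  finally have w_L2sq: "L2sq w = ennreal (Nf / ?c)" .
  have w_fin: "L2sq w < \<infinity>" unfolding w_L2sq by simp
  have w: "w \<in> L2_space" using w_meas w_fin by (simp add: L2_space_iff)
  define n where "n k = (LINT X|lborel. (cmod (truncation (real k) w X))\<^sup>2)" for k
  have tr_meas [measurable]: "truncation (real k) w \<in> borel_measurable borel" for k
    by (rule borel_measurable_truncation[OF w_meas])
  have tr_fin: "L2sq (truncation (real k) w) < \<infinity>" for k
    using L2sq_truncation_le w_fin by (rule order_le_less_trans)
  have n: "L2sq (truncation (real k) w) = ennreal (n k)" "0 \<le> n k" for k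
    unfolding n_def by (rule L2sq_eq_integral(2)[OF tr_meas tr_fin]) simp
  have n_lim: "n \<longlonglongrightarrow> Nf / ?c"
  proof (rule tendsto_ennrealD)
    show "(\<lambda>k. ennreal (n k)) \<longlonglongrightarrow> ennreal (Nf / ?c)"
      using L2sq_truncation_tendsto[OF w_meas] unfolding n(1) w_L2sq .
    show "0 \<le> Nf / ?c" using Nf c by (intro divide_nonneg_pos)
    show "\<forall>\<^sub>F k in sequentially. 0 \<le> n k" using n(2) by simp
  qed
  define T where "T k = fourier_integral (truncation (real k) w)" for k
  have T_meas [measurable]: "T k \<in> borel_measurable borel" for k unfolding T_def by measurable
  have tr_int: "integrable lborel (truncation (real k) w)" for k
    by (rule integrable_truncation[OF w_meas w_fin])
  have T_L2sq: "L2sq (T k) = ennreal (?c * n k)" for k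
    unfolding T_def plancherel_L1_L2[OF tr_int tr_fin] n(1) using n(2) c by (simp add: ennreal_mult)
  have T_fin: "L2sq (T k) < \<infinity>" for k unfolding T_L2sq by simp
  have T_N: "(LINT X|lborel. (cmod (T k X))\<^sup>2) = ?c * n k" for k
  proof -
    have "ennreal (LINT X|lborel. (cmod (T k X))\<^sup>2) = ennreal (?c * n k)"
      using L2sq_eq_integral(2)[OF T_meas T_fin] unfolding T_L2sq by simp
    thus ?thesis using n(2)[of k] by (subst (asm) ennreal_inj) auto
  qed
  have inner_int: "integrable lborel (\<lambda>X. T k X * f' X)" for k
    unfolding T_def by (rule integrable_mult_bounded[OF f'_int _ cmod_fourier_integral_le]) simp
  \<comment> \<open>Duality moves the transform onto \<open>f'\<close>, giving \<open>g\<close>,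
    which is \<open>?c\<close> times the conjugate of \<open>w\<close>; the inner product becomes a
    squared norm.\<close>
  have inner_eq: "(LINT X|lborel. T k X * f' X) = complex_of_real (?c * n k)" for k
  proof -
    have "(LINT X|lborel. T k X * f' X) = (LINT Y|lborel. truncation (real k) w Y * g Y)"
      unfolding T_def g_def by (rule fourier_integral_duality[OF tr_int f'_int])
    also have "\<dots> = (LINT Y|lborel. complex_of_real (?c * (cmod (truncation (real k) w Y))\<^sup>2))"
    proof (rule Bochner_Integration.integral_cong)
      fix Y
      have "w Y * g Y = complex_of_real (?c * (cmod (w Y))\<^sup>2)"
      proof -
        have "g Y = complex_of_real ?c * cnj (w Y)" using c by (simp add: w_def)
        hence "w Y * g Y = complex_of_real ?c * (w Y * cnj (w Y))" by (simp only: ac_simps)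
        thus ?thesis by (simp only: complex_norm_square of_real_mult)
      qed
      thus "truncation (real k) w Y * g Y = complex_of_real (?c * (cmod (truncation (real k) w Y))\<^sup>2)"
        by (simp add: truncation_def indicator_def)
    qed simp
    also have "\<dots> = complex_of_real (LINT Y|lborel. ?c * (cmod (truncation (real k) w Y))\<^sup>2)"
      by (rule integral_complex_of_real)
    also have "(LINT Y|lborel. ?c * (cmod (truncation (real k) w Y))\<^sup>2) = ?c * n k"
      unfolding n_def by (rule integral_mult_right_zero)
    finally show ?thesis .
  qed
  have dist: "L2sq (\<lambda>X. T k X - f X) = ennreal (Nf - ?c * n k)" for k
  proof -
    have exp: "(cmod (T k X - f X))\<^sup>2 = (cmod (T k X))\<^sup>2 + (cmod (f X))\<^sup>2 - 2 * Re (T k X * f' X)" for X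
      unfolding f'_def cmod_power2 by (simp add: power2_diff algebra_simps)
    have ints: "integrable lborel (\<lambda>X. (cmod (T k X))\<^sup>2)" "integrable lborel (\<lambda>X. (cmod (f X))\<^sup>2)"
      "integrable lborel (\<lambda>X. Re (T k X * f' X))"
      by (rule L2sq_eq_integral(1)[OF T_meas T_fin] L2sq_eq_integral(1)[OF f_meas f_fin]
          integrable_Re[OF inner_int])+
    have "L2sq (\<lambda>X. T k X - f X) = ennreal (LINT X|lborel. (cmod (T k X - f X))\<^sup>2)"
    proof -
      have "integrable lborel (\<lambda>X. (cmod (T k X - f X))\<^sup>2)"
        unfolding exp
        by (intro Bochner_Integration.integrable_add Bochner_Integration.integrable_diff
            integrable_mult_right ints)
      thus ?thesis unfolding L2sq_def by (rule nn_integral_eq_integral) simp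
    qed
    also have "(LINT X|lborel. (cmod (T k X - f X))\<^sup>2)
      = (LINT X|lborel. (cmod (T k X))\<^sup>2) + Nf - 2 * (LINT X|lborel. Re (T k X * f' X))"
      unfolding exp Nf_def using ints by (simp del: times_complex.sel)
    also have "(LINT X|lborel. Re (T k X * f' X)) = ?c * n k"
      using integral_Re[OF inner_int[of k]] unfolding inner_eq by simp
    finally show ?thesis unfolding T_N by (simp add: algebra_simps)
  qed
  \<comment> \<open>Plancherel for \<open>g\<close> gave \<open>L2sq w\<close> the value
    \<open>Nf / ?c\<close>, exactly what makes the distance vanish in the limit.\<close>
  have "(\<lambda>k. ennreal (Nf - ?c * n k)) \<longlonglongrightarrow> ennreal (Nf - ?c * (Nf / ?c))"
    by (intro tendsto_intros n_lim)
  hence lim: "(\<lambda>k. L2sq (\<lambda>X. T k X - f X)) \<longlonglongrightarrow> 0"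
    unfolding dist using c by simp
  have "(\<lambda>k. L2sq (\<lambda>X. T k X - L2_fourier w X)) \<longlonglongrightarrow> 0"
    unfolding T_def
    by (rule filterlim_compose[OF L2_fourier_limit(2)[OF w] filterlim_real_sequentially])
  hence "AE X in lborel. L2_fourier w X = f X"
    using L2_fourier_limit(1)[OF w]
    by (intro L2sq_limit_unique[OF T_meas _ f_meas _ lim] borel_measurable_L2_space) auto
  thus ?thesis using w by blast
qed

text \<open>Resolves the choice in \<open>L2_inv_fourier\<close>. All functions inverted in the main
  estimate vanish outside a ball, so this covers the projections as well as the null form.\<close>

lemma L2_inv_fourier_bounded_support:
  assumes f: "f \<in> L2_space" and supp: "AE X in lborel. X \<notin> cball 0 R \<longrightarrow> f X = 0"
  shows "L2_inv_fourier f \<in> L2_space"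
    and "AE X in lborel. L2_fourier (L2_inv_fourier f) X = f X"
    and "ennreal ((2 * pi) ^ 3) * L2sq (L2_inv_fourier f) = L2sq f"
proof -
  let ?Q = "\<lambda>w. w \<in> L2_space \<and> (AE X in lborel. L2_fourier w X = f X)"
  obtain w where "?Q w" using L2_fourier_surj_bounded_support[OF f supp] by blast
  hence "?Q (L2_inv_fourier f)" unfolding L2_inv_fourier_def by (rule someI[of ?Q])
  thus inv: "L2_inv_fourier f \<in> L2_space" "AE X in lborel. L2_fourier (L2_inv_fourier f) X = f X"
    by auto
  have "L2sq (L2_fourier (L2_inv_fourier f)) = L2sq f"
    using inv(2) by (intro L2sq_cong_AE) auto
  thus "ennreal ((2 * pi) ^ 3) * L2sq (L2_inv_fourier f) = L2sq f"
    by (simp add: plancherel_L2[OF inv(1)])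
qed

text \<open>The complement of the support is a possibly uncountable union of open sets; Lindelof
  reduces it to a countable one, for which exceptional null sets may be united.\<close>

lemma ess_support_AE:
  assumes "ess_support f \<subseteq> K"
  shows "AE X in lborel. X \<notin> K \<longrightarrow> f X = 0"
proof -
  let ?F = "{U. open U \<and> (AE X in lborel. X \<in> U \<longrightarrow> f X = 0)}"
  obtain G where G: "G \<subseteq> ?F" "countable G" "\<Union>G = \<Union>?F"
    using Lindelof[of ?F] by auto
  have "AE X in lborel. \<forall>U\<in>G. X \<in> U \<longrightarrow> f X = 0"
    using G(1,2) by (subst AE_ball_countable) auto
  thus ?thesis
  proof eventually_elim
    case (elim X)
    show ?case
    proof
      assume "X \<notin> K"
      hence "X \<in> \<Union>?F" using assms by (auto simp: ess_support_def)
      thus "f X = 0" using elim unfolding G(3)[symmetric] by blast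
    qed
  qed
qed

section \<open>Level sets of the phase\<close>

text \<open>The level set is enlarged to the interval from its infimum \<open>a\<close> to its
  supremum \<open>b\<close>. There \<open>f\<close> is still monotone and its endpoint values lie
  within \<open>L\<close> of \<open>c\<close>, so the fundamental theorem of calculus gives
  \<open>f b - f a \<le> 2 * L\<close>.\<close>

lemma nn_integral_deriv_level_set:
  fixes f f' :: "real \<Rightarrow> real"
  assumes der: "\<And>t. (f has_real_derivative f' t) (at t)" and cont: "continuous_on UNIV f'"
    and S: "convex S" "bounded S" and nonneg: "\<And>t. t \<in> S \<Longrightarrow> 0 \<le> f' t" and L: "0 \<le> L"
  shows "(\<integral>\<^sup>+ t. ennreal (f' t) * indicator (S \<inter> {t. \<bar>f t - c\<bar> \<le> L}) t \<partial>lborel) \<le> ennreal (2 * L)"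
proof (cases "S \<inter> {t. \<bar>f t - c\<bar> \<le> L} = {}")
  case False
  define V where "V = S \<inter> {t. \<bar>f t - c\<bar> \<le> L}"
  define a b where "a = Inf V" and "b = Sup V"
  have V: "V \<noteq> {}" "bounded V" using False S(2) by (auto simp: V_def intro: bounded_subset)
  have bdd: "bdd_above V" "bdd_below V"
    using V(2) by (auto intro: bounded_imp_bdd_above bounded_imp_bdd_below)
  have f_cont: "continuous_on UNIV f"
    using der by (meson DERIV_continuous continuous_at_imp_continuous_on)
  have "closed {t. \<bar>f t - c\<bar> \<le> L}"
    by (intro closed_Collect_le continuous_intros f_cont)
  hence V_cl: "closure V \<subseteq> {t. \<bar>f t - c\<bar> \<le> L}"
    unfolding V_def by (intro closure_minimal) auto
  have ab_cl: "a \<in> closure V" "b \<in> closure V"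
    unfolding a_def b_def by (intro closure_contains_Inf closure_contains_Sup V bdd)+
  have ab: "a \<le> b"
    unfolding a_def b_def using V(1) bdd by (intro cInf_le_cSup)
  \<comment> \<open>The endpoints may lie outside \<open>S\<close>, so the sign of \<open>f'\<close>
    is carried to the closure by continuity.\<close>
  have "closed {t. 0 \<le> f' t}"
    by (intro closed_Collect_le continuous_intros cont)
  hence S_cl: "closure S \<subseteq> {t. 0 \<le> f' t}"
    using nonneg by (intro closure_minimal) auto
  have "closure V \<subseteq> closure S" unfolding V_def by (intro closure_mono) auto
  hence "a \<in> closure S" "b \<in> closure S" using ab_cl by auto
  hence "{a..b} \<subseteq> closure S"
    using convex_closure[OF S(1)] ab
    by (metis closed_segment_eq_real_ivl closed_segment_subset)
  hence f'_nonneg: "0 \<le> f' t" if "a \<le> t" "t \<le> b" for t using that S_cl by auto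
  have "(\<integral>\<^sup>+ t. ennreal (f' t) * indicator V t \<partial>lborel) \<le> (\<integral>\<^sup>+ t. ennreal (f' t) * indicator {a..b} t \<partial>lborel)"
    by (intro nn_integral_mono mult_left_mono)
      (auto simp: indicator_def a_def b_def intro: cInf_lower cSup_upper bdd)
  also have "\<dots> = ennreal (f b - f a)"
    using f'_nonneg ab cont
    by (intro nn_integral_FTC_Icc der[THEN DERIV_subset] borel_measurable_continuous_onI) auto
  also have "\<dots> \<le> ennreal (2 * L)"
  proof (rule ennreal_leI)
    have "\<bar>f a - c\<bar> \<le> L" "\<bar>f b - c\<bar> \<le> L" using ab_cl V_cl by auto
    thus "f b - f a \<le> 2 * L" by linarith
  qed
  finally show ?thesis by (simp add: V_def)
qed simp

text \<open>The sign condition makes \<open>f\<close> monotone on each of two half-lines.\<close>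

lemma nn_integral_abs_deriv_level_set:
  fixes f f' :: "real \<Rightarrow> real"
  assumes der: "\<And>t. (f has_real_derivative f' t) (at t)" and cont: "continuous_on UNIV f'"
    and sgn: "\<And>t. sgn (f' t) = sgn (\<alpha> * t + \<beta>)" and L: "0 \<le> L"
  shows "(\<integral>\<^sup>+ t. ennreal \<bar>f' t\<bar> * indicator {t. \<bar>t\<bar> \<le> R \<and> \<bar>f t - c\<bar> \<le> L} t \<partial>lborel) \<le> ennreal (4 * L)"
proof -
  \<comment> \<open>\<open>P\<close> and \<open>Q\<close> are convex and bounded, being a window cut
    by half-spaces, and together they cover the window; on \<open>Q\<close> the argument is applied
    to \<open>- f\<close>.\<close>
  define P where "P = {t. \<bar>t\<bar> \<le> R \<and> 0 \<le> \<alpha> * t + \<beta>}"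
  define Q where "Q = {t. \<bar>t\<bar> \<le> R \<and> \<alpha> * t + \<beta> \<le> 0}"
  have PQ: "P = {-R..R} \<inter> {t. 0 \<le> \<alpha> * t + \<beta>}" "Q = {-R..R} \<inter> {t. \<alpha> * t + \<beta> \<le> 0}"
    by (auto simp: P_def Q_def)
  have half: "convex {t::real. k \<le> m * t}" "convex {t::real. m * t \<le> k}" for k m
    using convex_halfspace_ge[of k m] convex_halfspace_le[of m k] by (auto simp: mult.commute)
  have conv: "convex P" "convex Q"
  proof -
    have "{t. 0 \<le> \<alpha> * t + \<beta>} = {t. - \<beta> \<le> \<alpha> * t}" "{t. \<alpha> * t + \<beta> \<le> 0} = {t. \<alpha> * t \<le> - \<beta>}"
      by (auto simp: algebra_simps)
    thus "convex P" "convex Q"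
      unfolding PQ by (simp_all only: convex_Int convex_real_interval half)
  qed
  have bdd: "bounded P" "bounded Q"
    unfolding PQ by (auto intro: bounded_subset[OF bounded_closed_interval])
  have f_cont: "continuous_on UNIV f"
    using der by (meson DERIV_continuous continuous_at_imp_continuous_on)
  have [measurable]: "f \<in> borel_measurable borel" "f' \<in> borel_measurable borel"
    using f_cont cont by (auto intro: borel_measurable_continuous_onI)
  have [measurable]: "P \<in> sets borel" "Q \<in> sets borel"
    unfolding P_def Q_def by measurable
  have P_nonneg: "0 \<le> f' t" if "t \<in> P" for t
    using sgn[of t] that by (auto simp: P_def sgn_if split: if_splits)
  have Q_nonneg: "0 \<le> - f' t" if "t \<in> Q" for t
    using sgn[of t] that by (auto simp: Q_def sgn_if split: if_splits)
  have "(\<integral>\<^sup>+ t. ennreal \<bar>f' t\<bar> * indicator {t. \<bar>t\<bar> \<le> R \<and> \<bar>f t - c\<bar> \<le> L} t \<partial>lborel)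
    \<le> (\<integral>\<^sup>+ t. ennreal (f' t) * indicator (P \<inter> {t. \<bar>f t - c\<bar> \<le> L}) t
        + ennreal (- f' t) * indicator (Q \<inter> {t. \<bar>- f t - (- c)\<bar> \<le> L}) t \<partial>lborel)"
  proof (rule nn_integral_mono)
    fix t
    show "ennreal \<bar>f' t\<bar> * indicator {t. \<bar>t\<bar> \<le> R \<and> \<bar>f t - c\<bar> \<le> L} t
      \<le> ennreal (f' t) * indicator (P \<inter> {t. \<bar>f t - c\<bar> \<le> L}) t
        + ennreal (- f' t) * indicator (Q \<inter> {t. \<bar>- f t - (- c)\<bar> \<le> L}) t"
    proof (cases "\<bar>t\<bar> \<le> R \<and> \<bar>f t - c\<bar> \<le> L")
      case True
      hence "\<bar>- f t - (- c)\<bar> \<le> L" by (simp add: abs_minus_commute)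
      moreover have "t \<in> P \<and> 0 \<le> f' t \<or> t \<in> Q \<and> f' t \<le> 0"
        using True sgn[of t] by (auto simp: P_def Q_def sgn_if split: if_splits)
      ultimately show ?thesis using True by (auto simp: indicator_def)
    qed simp
  qed
  also have "\<dots> = (\<integral>\<^sup>+ t. ennreal (f' t) * indicator (P \<inter> {t. \<bar>f t - c\<bar> \<le> L}) t \<partial>lborel)
        + (\<integral>\<^sup>+ t. ennreal (- f' t) * indicator (Q \<inter> {t. \<bar>- f t - (- c)\<bar> \<le> L}) t \<partial>lborel)"
    by (rule nn_integral_add) measurable
  also have "\<dots> \<le> ennreal (2 * L) + ennreal (2 * L)"
    using P_nonneg Q_nonneg L cont
    by (intro add_mono nn_integral_deriv_level_set conv bdd der DERIV_minus continuous_intros) auto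
  also have "\<dots> = ennreal (4 * L)" using L by (simp flip: ennreal_plus)
  finally show ?thesis .
qed

section \<open>The phase along a coordinate line\<close>

text \<open>The quotient is the sine of \<open>arctan (x / |p|)\<close>, hence increasing in
  \<open>x / |p|\<close>. Comparing components of two unit vectors thereby becomes comparing linear
  expressions.\<close>

lemma unit_component_less_iff:
  fixes x y p q :: real
  assumes "p \<noteq> 0" "q \<noteq> 0"
  shows "x / sqrt (x\<^sup>2 + p\<^sup>2) < y / sqrt (y\<^sup>2 + q\<^sup>2) \<longleftrightarrow> x * \<bar>q\<bar> < y * \<bar>p\<bar>"
proof -
  have eq: "x / sqrt (x\<^sup>2 + p\<^sup>2) = sin (arctan (x / \<bar>p\<bar>))" if "p \<noteq> 0" for x p :: real
  proof -
    have "sqrt (x\<^sup>2 + p\<^sup>2) = \<bar>p\<bar> * sqrt (1 + (x / \<bar>p\<bar>)\<^sup>2)"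
      using that by (simp add: real_sqrt_mult[symmetric] field_simps flip: real_sqrt_abs)
    thus ?thesis using that by (simp add: sin_arctan)
  qed
  have "sin (arctan u) < sin (arctan v) \<longleftrightarrow> u < v" for u v
    using arctan_bounded[of u] arctan_bounded[of v] sin_mono_less_eq[of "arctan u" "arctan v"]
    by (auto simp: arctan_less_iff)
  moreover have "x / \<bar>p\<bar> < y / \<bar>q\<bar> \<longleftrightarrow> x * \<bar>q\<bar> < y * \<bar>p\<bar>"
    using assms by (simp add: field_simps)
  ultimately show ?thesis
    unfolding eq[OF assms(1)] eq[OF assms(2)] by simp
qed

text \<open>The integrand is the modulus of the derivative of the phase along a line. Its sign is
  that of \<open>s1 * t * |q| - s2 * (t0 - t) * |p|\<close>, linear in \<open>t\<close>, whatever
  the signs \<open>s1\<close> and \<open>s2\<close>. Nonzero \<open>p\<close> and \<open>q\<close>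
  keep the line away from the zeros of the square roots.\<close>

lemma nn_integral_cone_phase_level_set:
  fixes p q s1 s2 t0 :: real
  assumes pq: "p \<noteq> 0" "q \<noteq> 0" and s: "\<bar>s1\<bar> = 1" "\<bar>s2\<bar> = 1" and L: "0 \<le> L"
  shows "(\<integral>\<^sup>+ t. ennreal \<bar>s1 * t / sqrt (t\<^sup>2 + p\<^sup>2) - s2 * (t0 - t) / sqrt ((t0 - t)\<^sup>2 + q\<^sup>2)\<bar>
      * indicator {t. \<bar>t\<bar> \<le> R \<and> \<bar>s1 * sqrt (t\<^sup>2 + p\<^sup>2) + s2 * sqrt ((t0 - t)\<^sup>2 + q\<^sup>2) - c\<bar> \<le> L} t \<partial>lborel)
    \<le> ennreal (4 * L)"
proof (rule nn_integral_abs_deriv_level_set[where \<alpha> = "s1 * \<bar>q\<bar> + s2 * \<bar>p\<bar>" and \<beta> = "- (s2 * t0 * \<bar>p\<bar>)"])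
  have pos: "0 < t\<^sup>2 + p\<^sup>2" "0 < t\<^sup>2 + q\<^sup>2" for t
    using pq by (auto intro: add_nonneg_pos)
  show "((\<lambda>t. s1 * sqrt (t\<^sup>2 + p\<^sup>2) + s2 * sqrt ((t0 - t)\<^sup>2 + q\<^sup>2)) has_real_derivative
      s1 * t / sqrt (t\<^sup>2 + p\<^sup>2) - s2 * (t0 - t) / sqrt ((t0 - t)\<^sup>2 + q\<^sup>2)) (at t)" for t
  proof -
    have "((\<lambda>t. sqrt (t\<^sup>2 + p\<^sup>2)) has_real_derivative t / sqrt (t\<^sup>2 + p\<^sup>2)) (at t)"
      using pos[of t] by (auto intro!: derivative_eq_intros simp: field_simps)
    moreover have "((\<lambda>t. sqrt ((t0 - t)\<^sup>2 + q\<^sup>2)) has_real_derivative - ((t0 - t) / sqrt ((t0 - t)\<^sup>2 + q\<^sup>2))) (at t)"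
    proof (rule DERIV_cong)
      show "((\<lambda>t. sqrt ((t0 - t)\<^sup>2 + q\<^sup>2)) has_real_derivative
          (inverse (sqrt ((t0 - t)\<^sup>2 + q\<^sup>2)) / 2) * (2 * (t0 - t) * - 1)) (at t)"
        by (rule DERIV_chain2[where f = sqrt], rule DERIV_real_sqrt[OF pos(2)])
          (auto intro!: derivative_eq_intros)
      have "inverse S / 2 * (2 * d * - 1) = - (d / S)" for S d :: real
        by (simp add: inverse_eq_divide)
      thus "inverse (sqrt ((t0 - t)\<^sup>2 + q\<^sup>2)) / 2 * (2 * (t0 - t) * - 1)
          = - ((t0 - t) / sqrt ((t0 - t)\<^sup>2 + q\<^sup>2))" .
    qed
    ultimately have "((\<lambda>t. s1 * sqrt (t\<^sup>2 + p\<^sup>2) + s2 * sqrt ((t0 - t)\<^sup>2 + q\<^sup>2)) has_real_derivative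
      s1 * (t / sqrt (t\<^sup>2 + p\<^sup>2)) + s2 * - ((t0 - t) / sqrt ((t0 - t)\<^sup>2 + q\<^sup>2))) (at t)"
      by (intro DERIV_add DERIV_cmult)
    thus ?thesis by simp
  qed
  show "continuous_on UNIV (\<lambda>t. s1 * t / sqrt (t\<^sup>2 + p\<^sup>2) - s2 * (t0 - t) / sqrt ((t0 - t)\<^sup>2 + q\<^sup>2))"
    by (intro continuous_intros) (use pos in \<open>auto simp: less_imp_neq[symmetric]\<close>)
  fix t
  \<comment> \<open>The squares under the roots do not see the signs, so the comparison lemma
    applies to \<open>s1 * t\<close> and \<open>s2 * (t0 - t)\<close>.\<close>
  have sq: "(s1 * t)\<^sup>2 = t\<^sup>2" "(s2 * (t0 - t))\<^sup>2 = (t0 - t)\<^sup>2"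
    using s by (simp_all add: power_mult_distrib power2_eq_1_iff abs_if split: if_splits)
  note i = unit_component_less_iff[of _ _ "s1 * t" "s2 * (t0 - t)"]
    unit_component_less_iff[of _ _ "s2 * (t0 - t)" "s1 * t"]
  have "s1 * t / sqrt (t\<^sup>2 + p\<^sup>2) < s2 * (t0 - t) / sqrt ((t0 - t)\<^sup>2 + q\<^sup>2)
      \<longleftrightarrow> s1 * t * \<bar>q\<bar> < s2 * (t0 - t) * \<bar>p\<bar>"
    "s2 * (t0 - t) / sqrt ((t0 - t)\<^sup>2 + q\<^sup>2) < s1 * t / sqrt (t\<^sup>2 + p\<^sup>2)
      \<longleftrightarrow> s2 * (t0 - t) * \<bar>p\<bar> < s1 * t * \<bar>q\<bar>"
    using i(1)[OF pq] i(2)[OF pq(2,1)] unfolding sq .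
  moreover have "(s1 * \<bar>q\<bar> + s2 * \<bar>p\<bar>) * t + - (s2 * t0 * \<bar>p\<bar>) = s1 * t * \<bar>q\<bar> - s2 * (t0 - t) * \<bar>p\<bar>"
    by (simp add: algebra_simps)
  ultimately show "sgn (s1 * t / sqrt (t\<^sup>2 + p\<^sup>2) - s2 * (t0 - t) / sqrt ((t0 - t)\<^sup>2 + q\<^sup>2))
      = sgn ((s1 * \<bar>q\<bar> + s2 * \<bar>p\<bar>) * t + - (s2 * t0 * \<bar>p\<bar>))"
    by (auto simp: sgn_if)
qed (rule L)

section \<open>Geometry of the angle weight\<close>

text \<open>The pairs stand for the components of two unit vectors along and across \<omega>. The
  first vector is nearly parallel to the axis, where the circle is tangent to the transverse
  direction, so a transverse gap \<open>d\<close> forces a longitudinal gap of order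
  \<open>d^2\<close>, up to an error controlled by \<open>\<beta> * d\<close>.\<close>

lemma unit_vector_diff_le:
  fixes a1 b1 a2 b2 \<beta> :: real
  assumes unit: "a1\<^sup>2 + b1\<^sup>2 = 1" "a2\<^sup>2 + b2\<^sup>2 = 1" and b1: "\<bar>b1\<bar> \<le> \<beta>" and \<beta>: "\<beta> \<le> 1 / 20"
    and close: "(a1 - a2)\<^sup>2 + (b1 - b2)\<^sup>2 \<le> (1 / 10)\<^sup>2"
  shows "(a1 - a2)\<^sup>2 + (b1 - b2)\<^sup>2 \<le> 4 * \<bar>a1 - a2\<bar> + 4 * \<beta> * \<bar>b1 - b2\<bar>"
proof -
  define d e where "d = \<bar>b1 - b2\<bar>" and "e = \<bar>a1 - a2\<bar>"
  have "e\<^sup>2 \<le> (1 / 10)\<^sup>2" "d\<^sup>2 \<le> (1 / 10)\<^sup>2"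
    using close by (simp_all add: d_def e_def) (smt (verit) zero_le_power2)+
  hence de: "0 \<le> d" "0 \<le> e" "d \<le> 1 / 10" "e \<le> 1 / 10"
    by (auto simp: d_def e_def power2_le_iff_abs_le)
  have "b1\<^sup>2 \<le> (1 / 20)\<^sup>2" using b1 \<beta> by (subst abs_le_square_iff[symmetric]) simp
  hence "(9 / 10)\<^sup>2 \<le> a1\<^sup>2" using unit(1) by (simp add: power2_eq_square)
  hence a1: "9 / 10 \<le> \<bar>a1\<bar>" by (subst (asm) abs_le_square_iff[symmetric]) simp
  have "a1\<^sup>2 \<le> 1\<^sup>2" "a2\<^sup>2 \<le> 1\<^sup>2" using unit by (simp_all) (smt (verit) zero_le_power2)+
  hence "\<bar>a1\<bar> \<le> 1" "\<bar>a2\<bar> \<le> 1" by (simp_all add: abs_square_le_1)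
  \<comment> \<open>As \<open>|a1| \<ge> 9 / 10\<close> and \<open>a2\<close> differs from
    \<open>a1\<close> by at most \<open>1 / 10\<close>, the two have the same sign and no
    cancellation occurs in the sum.\<close>
  hence sum: "1 \<le> \<bar>a1 + a2\<bar>" "\<bar>a1 + a2\<bar> \<le> 2" using a1 de unfolding e_def by arith+
  \<comment> \<open>Since \<open>\<bar>a1 + a2\<bar>\<close> is of order one and \<open>\<bar>b1 + b2\<bar> \<ge> \<bar>b1 - b2\<bar> - 2 * \<beta>\<close>, this identity bounds
    \<open>(b1 - b2)\<^sup>2\<close> by a multiple of \<open>\<bar>a1 - a2\<bar>\<close> up to the error \<open>2 * \<beta> * \<bar>b1 - b2\<bar>\<close>.\<close>
  have "(a1 - a2) * (a1 + a2) = - ((b1 - b2) * (b1 + b2))"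
    using unit by (simp add: power2_eq_square algebra_simps)
  hence prod: "e * \<bar>a1 + a2\<bar> = d * \<bar>b1 + b2\<bar>"
    unfolding d_def e_def by (metis abs_minus abs_mult)
  \<comment> \<open>With \<open>|b1 + b2| \<le> 1 \<le> |a1 + a2|\<close> the same identity yields
    \<open>e \<le> d\<close>, so \<open>e^2 + d^2 \<le> 2 * d^2\<close>; this doubling produces the
    fours.\<close>
  have "\<bar>b1 + b2\<bar> \<le> 2 / 10" using b1 \<beta> de unfolding d_def by arith
  hence "d * \<bar>b1 + b2\<bar> \<le> d * 1" using de by (intro mult_left_mono) auto
  moreover have "e * 1 \<le> e * \<bar>a1 + a2\<bar>" using de sum by (intro mult_left_mono) auto
  ultimately have "e \<le> d" using prod by simp
  hence "e\<^sup>2 \<le> d\<^sup>2" using de by (intro power_mono)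
  moreover have "d * (d - 2 * \<beta>) \<le> d * \<bar>b1 + b2\<bar>"
    using b1 de unfolding d_def by (intro mult_left_mono) arith+
  hence "d\<^sup>2 \<le> e * \<bar>a1 + a2\<bar> + 2 * \<beta> * d" unfolding prod by (simp add: power2_eq_square algebra_simps)
  moreover have "e * \<bar>a1 + a2\<bar> \<le> e * 2" using de sum by (intro mult_left_mono) auto
  ultimately have "e\<^sup>2 + d\<^sup>2 \<le> 4 * e + 4 * \<beta> * d" by linarith
  thus ?thesis by (simp add: d_def e_def)
qed

text \<open>The chord for the angle \<open>t\<close> has length \<open>2 * sin (t / 2)\<close>, and
  for small angles \<open>t / 4 \<le> sin (t / 2) \<le> t / 2\<close>.\<close>

lemma angle_le_chord:
  assumes "angle u v \<le> 1 / 10" "norm u \<noteq> 0" "norm v \<noteq> 0"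
  shows "(angle u v)\<^sup>2 \<le> 4 * (norm (u /\<^sub>R norm u - v /\<^sub>R norm v))\<^sup>2"
    and "(norm (u /\<^sub>R norm u - v /\<^sub>R norm v))\<^sup>2 \<le> (angle u v)\<^sup>2"
proof -
  define k where "k = u \<bullet> v / (norm u * norm v)"
  define t where "t = angle u v"
  have k: "\<bar>k\<bar> \<le> 1"
    unfolding k_def using Cauchy_Schwarz_ineq2[of u v] assms by (simp add: divide_le_eq)
  have t: "0 \<le> t" "t \<le> 1 / 10" "cos t = k"
    using assms(1) k by (auto simp: t_def angle_def k_def[symmetric] arccos_lbound cos_arccos_abs abs_le_iff)
  have chord: "(norm (u /\<^sub>R norm u - v /\<^sub>R norm v))\<^sup>2 = 4 * (sin (t / 2))\<^sup>2"
  proof -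
    have "(norm (u /\<^sub>R norm u - v /\<^sub>R norm v))\<^sup>2 = 2 - 2 * k"
    proof -
      have "(u /\<^sub>R norm u) \<bullet> (v /\<^sub>R norm v) = k"
        by (simp add: k_def divide_inverse)
      thus ?thesis
        using dot_norm_neg[of "u /\<^sub>R norm u" "v /\<^sub>R norm v"] assms(2,3) by simp
    qed
    also have "\<dots> = 4 * (sin (t / 2))\<^sup>2"
      using cos_double_sin[of "t / 2"] t(3) by simp
    finally show ?thesis .
  qed
  have "\<bar>sin (t / 2)\<bar> \<le> \<bar>t / 2\<bar>" by (rule abs_sin_x_le_abs_x)
  hence "(sin (t / 2))\<^sup>2 \<le> (t / 2)\<^sup>2" by (simp only: abs_le_square_iff)
  thus "(norm (u /\<^sub>R norm u - v /\<^sub>R norm v))\<^sup>2 \<le> (angle u v)\<^sup>2"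
    unfolding chord t_def by (simp add: power_divide)
  \<comment> \<open>Up to \<open>pi / 3\<close> the cosine is at least \<open>1 / 2\<close>, so
    \<open>sin x - x / 2\<close> is nondecreasing there.\<close>
  have "sin 0 - 0 / 2 \<le> sin (t / 2) - (t / 2) / 2"
  proof (rule DERIV_nonneg_imp_nondecreasing[of 0 "t / 2" "\<lambda>x. sin x - x / 2"])
    fix x assume x: "0 \<le> x" "x \<le> t / 2"
    have "cos (pi / 3) \<le> cos x" using x t pi_gt3 by (intro cos_monotone_0_pi_le) auto
    hence "0 \<le> cos x - 1 / 2" by (simp add: cos_60)
    thus "\<exists>y. ((\<lambda>x. sin x - x / 2) has_real_derivative y) (at x) \<and> 0 \<le> y"
      by (intro exI[of _ "cos x - 1 / 2"]) (auto intro!: derivative_eq_intros)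
  qed (use t in simp)
  hence "(t / 4)\<^sup>2 \<le> (sin (t / 2))\<^sup>2" using t by (intro power_mono) auto
  thus "(angle u v)\<^sup>2 \<le> 4 * (norm (u /\<^sub>R norm u - v /\<^sub>R norm v))\<^sup>2"
    unfolding chord t_def[symmetric] by (simp add: power_divide)
qed

text \<open>\<open>A\<close> and \<open>B\<close> are the partial derivatives of \<phi>. Each is
  integrated first along its own variable, at cost \<open>4 * L\<close>, and then over the range of
  the other, of length \<open>r\<close> or \<open>2 * R\<close>.\<close>

lemma nn_integral_planar_level_set:
  fixes s1 s2 x0 y0 r R L \<beta> c :: real
  assumes s: "\<bar>s1\<bar> = 1" "\<bar>s2\<bar> = 1" and L: "0 \<le> L" and r: "0 \<le> r" and R: "0 \<le> R"
    and \<beta>: "0 \<le> \<beta>"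
  defines "\<phi> x y \<equiv> s1 * sqrt (x\<^sup>2 + y\<^sup>2) + s2 * sqrt ((x0 - x)\<^sup>2 + (y0 - y)\<^sup>2)"
    and "A x y \<equiv> s1 * x / sqrt (x\<^sup>2 + y\<^sup>2) - s2 * (x0 - x) / sqrt ((x0 - x)\<^sup>2 + (y0 - y)\<^sup>2)"
    and "B x y \<equiv> s1 * y / sqrt (x\<^sup>2 + y\<^sup>2) - s2 * (y0 - y) / sqrt ((x0 - x)\<^sup>2 + (y0 - y)\<^sup>2)"
  shows "(\<integral>\<^sup>+ (x, y). ennreal (4 * \<bar>A x y\<bar> + 4 * \<beta> * \<bar>B x y\<bar>)
      * indicator {(x, y). \<bar>x\<bar> \<le> R \<and> \<bar>y\<bar> \<le> R \<and> \<bar>y\<bar> \<le> r / 2 \<and> \<bar>\<phi> x y - c\<bar> \<le> L} (x, y)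
      \<partial>(lborel \<Otimes>\<^sub>M lborel)) \<le> ennreal (16 * L * (r + 2 * R * \<beta>))"
proof -
  let ?X = "\<lambda>x y. ennreal \<bar>A x y\<bar> * indicator {x. \<bar>x\<bar> \<le> R \<and> \<bar>\<phi> x y - c\<bar> \<le> L} x"
  let ?Y = "\<lambda>x y. ennreal \<bar>B x y\<bar> * indicator {y. \<bar>y\<bar> \<le> R \<and> \<bar>\<phi> x y - c\<bar> \<le> L} y"
  \<comment> \<open>The values 0 and \<open>y0\<close> of \<open>y\<close>, whose horizontal lines
    meet a zero of a square root, form a null set.\<close>
  have X: "AE y in lborel. (\<integral>\<^sup>+ x. ?X x y \<partial>lborel) \<le> ennreal (4 * L)"
  proof -
    have "AE y in lborel. y \<noteq> 0 \<and> y \<noteq> y0"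
      using AE_lborel_singleton[of 0] AE_lborel_singleton[of y0] by eventually_elim auto
    thus ?thesis
    proof eventually_elim
      case (elim y)
      thus ?case
        using nn_integral_cone_phase_level_set[of y "y0 - y" s1 s2 L x0 R c] s L
        by (simp add: A_def \<phi>_def)
    qed
  qed
  have Y: "AE x in lborel. (\<integral>\<^sup>+ y. ?Y x y \<partial>lborel) \<le> ennreal (4 * L)"
  proof -
    have "AE x in lborel. x \<noteq> 0 \<and> x \<noteq> x0"
      using AE_lborel_singleton[of 0] AE_lborel_singleton[of x0] by eventually_elim auto
    thus ?thesis
    proof eventually_elim
      case (elim x)
      thus ?case
        using nn_integral_cone_phase_level_set[of x "x0 - x" s1 s2 L y0 R c] s L
        by (simp add: B_def \<phi>_def add.commute)
    qed
  qed
  have [measurable]: "(\<lambda>(x, y). A x y) \<in> borel_measurable (borel \<Otimes>\<^sub>M borel)"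
    "(\<lambda>(x, y). B x y) \<in> borel_measurable (borel \<Otimes>\<^sub>M borel)"
    "(\<lambda>(x, y). \<phi> x y) \<in> borel_measurable (borel \<Otimes>\<^sub>M borel)"
    unfolding A_def B_def \<phi>_def by measurable
  have meas [measurable]: "(\<lambda>(x, y). ?X x y) \<in> borel_measurable (lborel \<Otimes>\<^sub>M lborel)"
    "(\<lambda>(x, y). ?Y x y) \<in> borel_measurable (lborel \<Otimes>\<^sub>M lborel)"
    by measurable
  \<comment> \<open>The level set is relaxed differently for the two terms: the first keeps the
    strip \<open>|y| \<le> r / 2\<close>, the second the range \<open>|x| \<le> R\<close>.\<close>
  let ?I = "\<lambda>b t::real. indicator {- b..b} t :: ennreal"
  have "(\<integral>\<^sup>+ (x, y). ennreal (4 * \<bar>A x y\<bar> + 4 * \<beta> * \<bar>B x y\<bar>)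
      * indicator {(x, y). \<bar>x\<bar> \<le> R \<and> \<bar>y\<bar> \<le> R \<and> \<bar>y\<bar> \<le> r / 2 \<and> \<bar>\<phi> x y - c\<bar> \<le> L} (x, y)
      \<partial>(lborel \<Otimes>\<^sub>M lborel))
    \<le> (\<integral>\<^sup>+ (x, y). 4 * (?I (r / 2) y * ?X x y) + ennreal (4 * \<beta>) * (?I R x * ?Y x y) \<partial>(lborel \<Otimes>\<^sub>M lborel))"
    using \<beta> by (intro nn_integral_mono)
      (auto simp: indicator_def abs_le_iff ennreal_mult ennreal_plus)
  also have "\<dots> = 4 * (\<integral>\<^sup>+ (x, y). ?I (r / 2) y * ?X x y \<partial>(lborel \<Otimes>\<^sub>M lborel))
      + ennreal (4 * \<beta>) * (\<integral>\<^sup>+ (x, y). ?I R x * ?Y x y \<partial>(lborel \<Otimes>\<^sub>M lborel))"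
    by (simp add: nn_integral_add nn_integral_cmult case_prod_beta')
  also have "(\<integral>\<^sup>+ (x, y). ?I (r / 2) y * ?X x y \<partial>(lborel \<Otimes>\<^sub>M lborel))
      = (\<integral>\<^sup>+ y. ?I (r / 2) y * (\<integral>\<^sup>+ x. ?X x y \<partial>lborel) \<partial>lborel)"
    by (subst lborel_pair.nn_integral_snd[symmetric]) (simp_all add: nn_integral_cmult)
  also have "\<dots> \<le> (\<integral>\<^sup>+ y. ennreal (4 * L) * ?I (r / 2) y \<partial>lborel)"
    by (intro nn_integral_mono_AE eventually_mono[OF X], subst mult.commute) (rule mult_right_mono, simp_all)
  also have "\<dots> = ennreal (4 * L * r)"
    using r L by (simp add: nn_integral_cmult_indicator flip: ennreal_mult')
  also have "(\<integral>\<^sup>+ (x, y). ?I R x * ?Y x y \<partial>(lborel \<Otimes>\<^sub>M lborel))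
      = (\<integral>\<^sup>+ x. ?I R x * (\<integral>\<^sup>+ y. ?Y x y \<partial>lborel) \<partial>lborel)"
    by (subst lborel.nn_integral_fst[symmetric]) (simp_all add: nn_integral_cmult)
  also have "\<dots> \<le> (\<integral>\<^sup>+ x. ennreal (4 * L) * ?I R x \<partial>lborel)"
    by (intro nn_integral_mono_AE eventually_mono[OF Y], subst mult.commute) (rule mult_right_mono, simp_all)
  also have "\<dots> = ennreal (4 * L * (2 * R))"
    using R L by (simp add: nn_integral_cmult_indicator flip: ennreal_mult')
  also have "4 * ennreal (4 * L * r) + ennreal (4 * \<beta>) * ennreal (4 * L * (2 * R))
      = ennreal (16 * L * (r + 2 * R * \<beta>))"
  proof -
    have "4 * ennreal (4 * L * r) + ennreal (4 * \<beta>) * ennreal (4 * L * (2 * R))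
      = ennreal (4 * (4 * L * r) + 4 * \<beta> * (4 * L * (2 * R)))"
      using r R L \<beta> by (simp flip: ennreal_mult' ennreal_plus ennreal_numeral)
    thus ?thesis by (simp add: algebra_simps)
  qed
  finally show ?thesis by (simp add: add_mono mult_left_mono)
qed

section \<open>Orthonormal coordinates adapted to the strip\<close>

text \<open>Lebesgue measure is determined by its values on boxes; the preimage of a box is its
  image under the inverse isometry, which preserves measure.\<close>

lemma lborel_orthogonal_transformation:
  fixes W :: "real ^ 'n::{finite, wellorder} \<Rightarrow> real ^ 'n::{finite, wellorder}"
  assumes W: "orthogonal_transformation W"
  shows "distr lborel borel W = lborel"
proof (rule lborel_eqI[symmetric])
  have cont: "continuous_on UNIV W"
    using W by (intro linear_continuous_on linear_conv_bounded_linear[THEN iffD1] orthogonal_transformation_linear)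
  have [measurable]: "W \<in> borel_measurable borel" using cont by (rule borel_measurable_continuous_onI)
  fix l u :: "real ^ 'n::{finite, wellorder}"
  assume le: "\<And>b. b \<in> Basis \<Longrightarrow> l \<bullet> b \<le> u \<bullet> b"
  have bij: "bij W" using W by (rule orthogonal_transformation_bij)
  have W': "orthogonal_transformation (inv W)" using W by (rule orthogonal_transformation_inv)
  have eq: "W -` box l u = inv W ` box l u" using bij by (simp add: bij_vimage_eq_inv_image)
  have box: "box l u \<in> lmeasurable" by (rule lmeasurable_box)
  have meas: "inv W ` box l u \<in> sets borel"
    unfolding eq[symmetric] by (intro borel_open open_vimage cont) (rule open_box)
  have "emeasure (distr lborel borel W) (box l u) = emeasure lborel (inv W ` box l u)"
    by (subst emeasure_distr) (simp_all add: eq)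
  also have "\<dots> = emeasure lebesgue (inv W ` box l u)" using meas by simp
  also have "\<dots> = ennreal (measure lebesgue (inv W ` box l u))"
    using measurable_orthogonal_image[OF W' box] by (rule emeasure_eq_measure2)
  also have "measure lebesgue (inv W ` box l u) = measure lebesgue (box l u)"
    by (rule measure_orthogonal_image[OF W' box])
  also have "ennreal (measure lebesgue (box l u)) = emeasure lborel (box l u)"
    using emeasure_eq_measure2[OF box] by simp
  also have "\<dots> = (\<Prod>b\<in>Basis. (u - l) \<bullet> b)"
    using le by (simp add: emeasure_lborel_box)
  finally show "emeasure (distr lborel borel W) (box l u) = (\<Prod>b\<in>Basis. (u - l) \<bullet> b)" .
qed simp

text \<open>Bridges \<open>real ^ 2\<close> and pairs of reals, so that Tonelli becomes available in
  the plane.\<close>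

lemma lborel_real2:
  "distr (lborel \<Otimes>\<^sub>M lborel) borel (\<lambda>z::real \<times> real. fst z *\<^sub>R axis 1 1 + snd z *\<^sub>R axis 2 1 :: real ^ 2) = lborel"
proof (rule lborel_eqI[symmetric])
  have [measurable]: "(\<lambda>z::real \<times> real. fst z *\<^sub>R axis 1 1 + snd z *\<^sub>R axis 2 1 :: real ^ 2)
      \<in> borel_measurable (lborel \<Otimes>\<^sub>M lborel)"
    by measurable
  fix l u :: "real ^ 2"
  assume le: "\<And>b. b \<in> Basis \<Longrightarrow> l \<bullet> b \<le> u \<bullet> b"
  have le': "l $ 1 \<le> u $ 1" "l $ 2 \<le> u $ 2"
    using le[of "axis 1 1"] le[of "axis 2 1"] by (auto simp: inner_axis axis_in_Basis_iff)
  have "(\<lambda>z::real \<times> real. fst z *\<^sub>R axis 1 1 + snd z *\<^sub>R axis 2 1 :: real ^ 2) -` box l u = box (l $ 1) (u $ 1) \<times> box (l $ 2) (u $ 2)"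
    by (auto simp: mem_box_cart forall_2 axis_def)
  hence "emeasure (distr (lborel \<Otimes>\<^sub>M lborel) borel (\<lambda>z::real \<times> real. fst z *\<^sub>R axis 1 1 + snd z *\<^sub>R axis 2 1 :: real ^ 2)) (box l u)
    = emeasure (lborel \<Otimes>\<^sub>M lborel) (box (l $ 1) (u $ 1) \<times> box (l $ 2) (u $ 2))"
    by (subst emeasure_distr) (simp_all add: space_pair_measure)
  also have "\<dots> = ennreal ((u $ 1 - l $ 1) * (u $ 2 - l $ 2))"
    using le' by (subst lborel.emeasure_pair_measure_Times) (simp_all add: ennreal_mult)
  also have "(u $ 1 - l $ 1) * (u $ 2 - l $ 2) = (\<Prod>b\<in>Basis. (u - l) \<bullet> b)"
  proof -
    have B: "(Basis :: (real ^ 2) set) = {axis 1 1, axis 2 1}"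
      by (auto simp: Basis_vec_def UNIV_2)
    have "axis 1 1 \<noteq> (axis 2 1 :: real ^ 2)" by (simp add: axis_eq_axis)
    thus ?thesis unfolding B by (simp add: inner_axis)
  qed
  finally show "emeasure (distr (lborel \<Otimes>\<^sub>M lborel) borel (\<lambda>z::real \<times> real. fst z *\<^sub>R axis 1 1 + snd z *\<^sub>R axis 2 1 :: real ^ 2)) (box l u)
      = (\<Prod>b\<in>Basis. (u - l) \<bullet> b)" .
qed simp

text \<open>Rotation by a quarter turn, completing a unit vector to an orthonormal basis.\<close>

definition perp :: "real ^ 2 \<Rightarrow> real ^ 2" where
  "perp v = vector [- v $ 2, v $ 1]"

lemma inner_perp [simp]: "v \<bullet> perp v = 0" "perp v \<bullet> v = 0" "norm (perp v) = norm v"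
  by (simp_all add: perp_def inner_vec_def sum_2 norm_vec_def L2_set_def add.commute)

text \<open>The linear map taking the standard basis to \<omega> and \<open>perp \<omega>\<close> is
  an isometry, so the coordinates along and across the strip carry the product measure.\<close>

lemma nn_integral_rotated:
  fixes f :: "real ^ 2 \<Rightarrow> ennreal"
  assumes [measurable]: "f \<in> borel_measurable borel" and \<omega>: "norm \<omega> = 1"
  shows "(\<integral>\<^sup>+ \<xi>. f \<xi> \<partial>lborel)
    = (\<integral>\<^sup>+ (x, y). f (x *\<^sub>R \<omega> + y *\<^sub>R perp \<omega>) \<partial>(lborel \<Otimes>\<^sub>M lborel))"
proof -
  define W where "W v = v $ 1 *\<^sub>R \<omega> + v $ 2 *\<^sub>R perp \<omega>" for v :: "real ^ 2"
  have W: "orthogonal_transformation W"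
    unfolding orthogonal_transformation
  proof
    show "linear W" unfolding W_def by (intro linearI) (simp_all add: algebra_simps)
    have "(norm (W v))\<^sup>2 = (norm v)\<^sup>2" for v
    proof -
      have "\<omega> \<bullet> \<omega> = 1" "perp \<omega> \<bullet> perp \<omega> = 1"
        using \<omega> by (simp_all add: dot_square_norm)
      thus ?thesis
        unfolding W_def power2_norm_eq_inner
        by (simp add: inner_add_left inner_add_right inner_vec_def sum_2 del: inner_vec_def)
          (simp add: inner_vec_def sum_2)
    qed
    thus "\<forall>v. norm (W v) = norm v" by simp
  qed
  have [measurable]: "W \<in> borel_measurable borel"
    by (intro borel_measurable_continuous_onI linear_continuous_on linear_conv_bounded_linear[THEN iffD1]
        orthogonal_transformation_linear W)
  have [measurable]: "(\<lambda>z::real \<times> real. fst z *\<^sub>R axis 1 1 + snd z *\<^sub>R axis 2 1 :: real ^ 2)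
      \<in> borel_measurable (lborel \<Otimes>\<^sub>M lborel)"
    by measurable
  have "(\<integral>\<^sup>+ \<xi>. f \<xi> \<partial>lborel) = (\<integral>\<^sup>+ \<xi>. f \<xi> \<partial>distr lborel borel W)"
    by (simp add: lborel_orthogonal_transformation[OF W])
  also have "\<dots> = (\<integral>\<^sup>+ v. f (W v) \<partial>lborel)" by (rule nn_integral_distr) auto
  also have "\<dots> = (\<integral>\<^sup>+ v. f (W v) \<partial>distr (lborel \<Otimes>\<^sub>M lborel) borel (\<lambda>z. fst z *\<^sub>R axis 1 1 + snd z *\<^sub>R axis 2 1))"
    by (simp add: lborel_real2)
  also have "\<dots> = (\<integral>\<^sup>+ z. f (W (fst z *\<^sub>R axis 1 1 + snd z *\<^sub>R axis 2 1)) \<partial>(lborel \<Otimes>\<^sub>M lborel))"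
    by (rule nn_integral_distr) auto
  finally show ?thesis by (simp add: W_def case_prod_beta' axis_def)
qed

section \<open>The null form weight\<close>

text \<open>The argument of \<open>arccos\<close> always lies in \<open>[-1, 1]\<close>, so clamping
  it changes nothing and leaves a function continuous on the whole line.\<close>

lemma borel_measurable_angle [measurable (raw)]:
  assumes [measurable]: "f \<in> borel_measurable M" "g \<in> borel_measurable M"
  shows "(\<lambda>x. angle (f x) (g x)) \<in> borel_measurable M"
proof -
  have clamp: "angle u v = arccos (max (- 1) (min 1 (u \<bullet> v / (norm u * norm v))))" for u v
  proof -
    \<comment> \<open>Division by zero gives 0, so the bound also holds when a vector
      vanishes.\<close>
    have "\<bar>u \<bullet> v / (norm u * norm v)\<bar> \<le> 1"
      using Cauchy_Schwarz_ineq2[of u v]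
      by (cases "norm u * norm v = 0") (auto simp: divide_le_eq)
    moreover have "max (- 1) (min 1 k) = k" if "\<bar>k\<bar> \<le> 1" for k :: real
      using that by linarith
    ultimately show ?thesis by (simp only: angle_def)
  qed
  have [measurable]: "(\<lambda>x. arccos (max (- 1) (min 1 x))) \<in> borel_measurable borel"
    by (intro borel_measurable_continuous_onI continuous_on_arccos continuous_intros) auto
  show ?thesis unfolding clamp by measurable
qed

definition null_weight :: "real \<Rightarrow> real \<Rightarrow> real \<Rightarrow> real ^ 2 \<Rightarrow> real ^ 2 \<Rightarrow> real" where
  "null_weight c s1 s2 \<xi>1 \<xi>2 =
    (let \<theta> = angle (s1 *\<^sub>R \<xi>1) (s2 *\<^sub>R \<xi>2) in if \<theta> \<le> c then \<theta> else 0)"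

lemma borel_measurable_null_weight [measurable (raw)]:
  assumes [measurable]: "f \<in> borel_measurable M" "g \<in> borel_measurable M"
  shows "(\<lambda>x. null_weight c s1 s2 (f x) (g x)) \<in> borel_measurable M"
  unfolding null_weight_def Let_def by measurable

text \<open>The inner product with \<open>perp \<omega>\<close> vanishes on the line and is
  1-Lipschitz, so it is bounded by the distance to the line.\<close>

lemma abs_inner_perp_le_strip:
  assumes \<omega>: "norm \<omega> = 1" and \<xi>: "\<xi> \<in> strip r \<omega>"
  shows "\<bar>\<xi> \<bullet> perp \<omega>\<bar> \<le> r / 2"
proof -
  have ne: "span {\<omega>} \<noteq> {}" using span_zero by blast
  have "\<bar>\<xi> \<bullet> perp \<omega>\<bar> \<le> infdist \<xi> (span {\<omega>})"
    unfolding infdist_notempty[OF ne]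
  proof (rule cINF_greatest)
    fix v assume "v \<in> span {\<omega>}"
    then obtain t where "v = t *\<^sub>R \<omega>" by (auto simp: span_singleton)
    hence "\<bar>\<xi> \<bullet> perp \<omega>\<bar> = \<bar>(\<xi> - v) \<bullet> perp \<omega>\<bar>" by (simp add: inner_diff_left)
    also have "\<dots> \<le> norm (\<xi> - v) * norm (perp \<omega>)" by (rule Cauchy_Schwarz_ineq2)
    finally show "\<bar>\<xi> \<bullet> perp \<omega>\<bar> \<le> dist \<xi> v" using \<omega> by (simp add: dist_norm)
  qed (rule ne)
  thus ?thesis using \<xi> by (simp add: strip_def)
qed

lemma rotated_representation:
  assumes "norm \<omega> = 1"
  shows "v = (v \<bullet> \<omega>) *\<^sub>R \<omega> + (v \<bullet> perp \<omega>) *\<^sub>R perp \<omega>"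
proof -
  have sq: "\<omega> $ 1 * \<omega> $ 1 + \<omega> $ 2 * \<omega> $ 2 = 1"
    using assms by (simp add: norm_eq_1 inner_vec_def sum_2)
  have "p = (p * a + q * b) * a - (- (p * b) + q * a) * b" "q = (p * a + q * b) * b + (- (p * b) + q * a) * a"
    if "a * a + b * b = 1" for a b p q :: real
    using that by algebra+
  from this[OF sq] show ?thesis
    by (simp add: vec_eq_iff forall_2 inner_vec_def sum_2 perp_def)
qed

lemma norm_rotated:
  assumes "norm \<omega> = 1"
  shows "norm (x *\<^sub>R \<omega> + y *\<^sub>R perp \<omega>) = sqrt (x\<^sup>2 + y\<^sup>2)"
proof -
  have "\<omega> \<bullet> \<omega> = 1" "perp \<omega> \<bullet> perp \<omega> = 1"
    using assms by (simp_all add: dot_square_norm)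
  thus ?thesis
    by (simp add: norm_eq_sqrt_inner inner_add_left inner_add_right power2_eq_square)
qed

lemma sets_thick_cone [measurable]: "thick_cone M s N L \<in> sets borel"
proof -
  have "thick_cone M s N L = {X. N / M \<le> norm (snd X)} \<inter> {X. norm (snd X) \<le> M * N}
      \<inter> {X. \<bar>fst X - s * norm (snd X)\<bar> \<le> M * L}"
    by (auto simp: thick_cone_def)
  also have "\<dots> \<in> sets borel"
    by (intro sets.Int borel_closed closed_Collect_le continuous_intros)
  finally show ?thesis .
qed

lemma sets_strip [measurable]: "UNIV \<times> strip r \<omega> \<in> sets (borel :: spacetime measure)"
proof -
  have "UNIV \<times> strip r \<omega> = {X :: spacetime. infdist (snd X) (span {\<omega>}) \<le> r / 2}"
    by (auto simp: strip_def)
  also have "\<dots> \<in> sets borel"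
    by (intro borel_closed closed_Collect_le continuous_intros)
  finally show ?thesis .
qed

lemma sets_slab [measurable]: "slab \<omega> {a..b} \<in> sets borel"
proof -
  have "slab \<omega> {a..b} = {X. a \<le> snd X \<bullet> \<omega>} \<inter> {X. snd X \<bullet> \<omega> \<le> b}"
    by (auto simp: slab_def)
  also have "\<dots> \<in> sets borel"
    by (intro sets.Int borel_closed closed_Collect_le continuous_intros)
  finally show ?thesis .
qed

text \<open>Supplies the bounded support that inversion asks for: \<open>M * N\<close> bounds the
  spatial part and \<open>M * N + M * L\<close> the temporal one.\<close>

lemma thick_cone_bounded:
  assumes s: "\<bar>s\<bar> = 1"
  shows "thick_cone M s N L \<subseteq> cball 0 (2 * (M * N) + M * L)"
proof
  fix X assume "X \<in> thick_cone M s N L"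
  then obtain t x where X: "X = (t, x)" "norm x \<le> M * N" "\<bar>t - s * norm x\<bar> \<le> M * L"
    by (auto simp: thick_cone_def)
  have "\<bar>s * norm x\<bar> \<le> M * N" using s X(2) by (simp add: abs_mult)
  hence "\<bar>t\<bar> \<le> M * N + M * L" using X(3) by linarith
  hence "norm X \<le> (M * N + M * L) + M * N"
    using X(2) norm_Pair_le[of t x] unfolding X(1) by simp
  thus "X \<in> cball 0 (2 * (M * N) + M * L)" by simp
qed

section \<open>The squared weight over the admissible frequencies\<close>

text \<open>The angle is replaced by the chord between the signed unit vectors, at the price of a
  factor 4, and the chord is bounded through its components along and across \<omega>; beyond the
  angular cutoff the weight is 0.\<close>

lemma null_weight_le_components:
  fixes s1 s2 x y x0 y0 \<beta> :: real
  assumes \<omega>: "norm \<omega> = 1" and s: "\<bar>s1\<bar> = 1" "\<bar>s2\<bar> = 1" and c: "c \<le> 1 / 10" and \<beta>: "\<beta> \<le> 1 / 20"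
    and pos: "0 < sqrt (x\<^sup>2 + y\<^sup>2)" "0 < sqrt ((x0 - x)\<^sup>2 + (y0 - y)\<^sup>2)"
    and y: "\<bar>y\<bar> \<le> \<beta> * sqrt (x\<^sup>2 + y\<^sup>2)"
  shows "(null_weight c s1 s2 (x *\<^sub>R \<omega> + y *\<^sub>R perp \<omega>) ((x0 - x) *\<^sub>R \<omega> + (y0 - y) *\<^sub>R perp \<omega>))\<^sup>2
    \<le> 4 * (4 * \<bar>s1 * x / sqrt (x\<^sup>2 + y\<^sup>2) - s2 * (x0 - x) / sqrt ((x0 - x)\<^sup>2 + (y0 - y)\<^sup>2)\<bar>
      + 4 * \<beta> * \<bar>s1 * y / sqrt (x\<^sup>2 + y\<^sup>2) - s2 * (y0 - y) / sqrt ((x0 - x)\<^sup>2 + (y0 - y)\<^sup>2)\<bar>)"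
proof -
  define \<rho>1 \<rho>2 where "\<rho>1 = sqrt (x\<^sup>2 + y\<^sup>2)" and "\<rho>2 = sqrt ((x0 - x)\<^sup>2 + (y0 - y)\<^sup>2)"
  \<comment> \<open>These and \<open>a2\<close>, \<open>b2\<close> are the coordinates, in the basis
    \<omega>, \<open>perp \<omega>\<close>, of the unit vectors in the directions of
    \<open>u\<close> and \<open>v\<close>.\<close>
  define a1 b1 where "a1 = s1 * x / \<rho>1" and "b1 = s1 * y / \<rho>1"
  define a2 b2 where "a2 = s2 * (x0 - x) / \<rho>2" and "b2 = s2 * (y0 - y) / \<rho>2"
  define u v where "u = s1 *\<^sub>R (x *\<^sub>R \<omega> + y *\<^sub>R perp \<omega>)"
    and "v = s2 *\<^sub>R ((x0 - x) *\<^sub>R \<omega> + (y0 - y) *\<^sub>R perp \<omega>)"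
  have \<rho>: "0 < \<rho>1" "0 < \<rho>2" using pos by (simp_all add: \<rho>1_def \<rho>2_def)
  have norm_uv: "norm u = \<rho>1" "norm v = \<rho>2"
    unfolding u_def v_def norm_scaleR norm_rotated[OF \<omega>] s by (simp_all add: \<rho>1_def \<rho>2_def)
  have s2: "s1\<^sup>2 = 1" "s2\<^sup>2 = 1" using s by (simp_all add: power2_eq_1_iff abs_if split: if_splits)
  have \<rho>_sq: "\<rho>1\<^sup>2 = x\<^sup>2 + y\<^sup>2" "\<rho>2\<^sup>2 = (x0 - x)\<^sup>2 + (y0 - y)\<^sup>2"
    unfolding \<rho>1_def \<rho>2_def by (simp_all add: add_nonneg_nonneg)
  have unit: "a1\<^sup>2 + b1\<^sup>2 = 1" "a2\<^sup>2 + b2\<^sup>2 = 1"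
    unfolding a1_def b1_def a2_def b2_def power_divide power_mult_distrib s2
      add_divide_distrib[symmetric] mult_1_left \<rho>_sq[symmetric]
    using \<rho> by simp_all
  have b1: "\<bar>b1\<bar> \<le> \<beta>"
    using y \<rho> s unfolding b1_def \<rho>1_def[symmetric] by (simp add: abs_mult divide_le_eq)
  have chord: "(norm (u /\<^sub>R norm u - v /\<^sub>R norm v))\<^sup>2 = (a1 - a2)\<^sup>2 + (b1 - b2)\<^sup>2"
  proof -
    have "u /\<^sub>R norm u - v /\<^sub>R norm v = (a1 - a2) *\<^sub>R \<omega> + (b1 - b2) *\<^sub>R perp \<omega>"
      unfolding norm_uv unfolding u_def v_def a1_def a2_def b1_def b2_def
      by (simp add: algebra_simps divide_inverse)
    thus ?thesis by (simp add: norm_rotated[OF \<omega>])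
  qed
  show ?thesis
  proof (cases "angle u v \<le> c")
    case True
    hence ang: "angle u v \<le> 1 / 10" using c by simp
    have uv: "norm u \<noteq> 0" "norm v \<noteq> 0" unfolding norm_uv using \<rho> by auto
    have "0 \<le> angle u v"
    proof -
      have "\<bar>u \<bullet> v / (norm u * norm v)\<bar> \<le> 1"
        using Cauchy_Schwarz_ineq2[of u v] uv by (simp add: divide_le_eq)
      hence "- 1 \<le> u \<bullet> v / (norm u * norm v)" "u \<bullet> v / (norm u * norm v) \<le> 1" by linarith+
      thus ?thesis unfolding angle_def by (rule arccos_lbound)
    qed
    hence "(angle u v)\<^sup>2 \<le> (1 / 10)\<^sup>2" using ang by (intro power_mono)
    hence close: "(a1 - a2)\<^sup>2 + (b1 - b2)\<^sup>2 \<le> (1 / 10)\<^sup>2"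
      using angle_le_chord(2)[OF ang uv] unfolding chord by (rule order_trans[rotated])
    have "(angle u v)\<^sup>2 \<le> 4 * ((a1 - a2)\<^sup>2 + (b1 - b2)\<^sup>2)"
      using angle_le_chord(1)[OF ang uv] unfolding chord .
    also have "\<dots> \<le> 4 * (4 * \<bar>a1 - a2\<bar> + 4 * \<beta> * \<bar>b1 - b2\<bar>)"
      using unit_vector_diff_le[OF unit b1 \<beta> close] by simp
    finally show ?thesis
      using True by (simp add: null_weight_def u_def v_def a1_def a2_def b1_def b2_def \<rho>1_def \<rho>2_def)
  next
    case False
    have "0 \<le> \<beta>" using b1 by linarith
    thus ?thesis using False by (simp add: null_weight_def u_def v_def)
  qed
qed

lemma nn_integral_null_weight_planar:
  fixes M N1 N2 r L c c0 s1 s2 :: real and \<xi>0 \<omega> :: "real ^ 2"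
  assumes M: "1 \<le> M" and N: "0 < N1" "0 < N2" and s: "\<bar>s1\<bar> = 1" "\<bar>s2\<bar> = 1" and r: "0 < r" and \<omega>: "norm \<omega> = 1"
    and L: "0 \<le> L" and c0: "c0 = 1 / (10 * M)" and rN: "r \<le> c0 * N1"
  defines "D \<equiv> {\<xi>. \<xi> \<in> strip r \<omega> \<and> N1 / M \<le> norm \<xi> \<and> norm \<xi> \<le> M * N1 \<and> N2 / M \<le> norm (\<xi>0 - \<xi>)
      \<and> \<bar>s1 * norm \<xi> + s2 * norm (\<xi>0 - \<xi>) - c\<bar> \<le> L}"
  shows "(\<integral>\<^sup>+ \<xi>. ennreal ((null_weight c0 s1 s2 \<xi> (\<xi>0 - \<xi>))\<^sup>2) * indicator D \<xi> \<partial>lborel)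
    \<le> ennreal (64 * (1 + M\<^sup>2) * r * L)"
proof -
  \<comment> \<open>The strip gives \<open>|y| \<le> r / 2\<close> and the annulus
    \<open>norm \<xi> \<ge> N1 / M\<close>, so \<beta> bounds the transverse component of the first
    unit vector. The choice of \<open>c0\<close> makes it at most \<open>1 / 20\<close> and, since
    \<open>M \<ge> 1\<close>, keeps the angular cutoff at most \<open>1 / 10\<close>.\<close>
  define \<beta> where "\<beta> = M * r / (2 * N1)"
  have \<beta>: "0 \<le> \<beta>" "\<beta> \<le> 1 / 20"
    using M N r rN by (auto simp: \<beta>_def c0 field_simps)
  have c0': "c0 \<le> 1 / 10" using M by (simp add: c0 field_simps)
  define x0 y0 where "x0 = \<xi>0 \<bullet> \<omega>" and "y0 = \<xi>0 \<bullet> perp \<omega>"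
  have \<xi>0: "\<xi>0 = x0 *\<^sub>R \<omega> + y0 *\<^sub>R perp \<omega>"
    unfolding x0_def y0_def by (rule rotated_representation[OF \<omega>])
  have D_meas [measurable]: "D \<in> sets borel"
  proof -
    have "D = {\<xi>. infdist \<xi> (span {\<omega>}) \<le> r / 2} \<inter> {\<xi>. N1 / M \<le> norm \<xi>} \<inter> {\<xi>. norm \<xi> \<le> M * N1}
      \<inter> {\<xi>. N2 / M \<le> norm (\<xi>0 - \<xi>)} \<inter> {\<xi>. \<bar>s1 * norm \<xi> + s2 * norm (\<xi>0 - \<xi>) - c\<bar> \<le> L}"
      by (auto simp: D_def strip_def)
    also have "\<dots> \<in> sets borel"
      by (intro sets.Int borel_closed closed_Collect_le continuous_intros)
    finally show ?thesis .
  qed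
  let ?\<rho>1 = "\<lambda>x y. sqrt (x\<^sup>2 + y\<^sup>2)" and ?\<rho>2 = "\<lambda>x y. sqrt ((x0 - x)\<^sup>2 + (y0 - y)\<^sup>2)"
  let ?A = "\<lambda>x y. s1 * x / ?\<rho>1 x y - s2 * (x0 - x) / ?\<rho>2 x y"
  let ?B = "\<lambda>x y. s1 * y / ?\<rho>1 x y - s2 * (y0 - y) / ?\<rho>2 x y"
  let ?E = "{(x, y). \<bar>x\<bar> \<le> M * N1 \<and> \<bar>y\<bar> \<le> M * N1 \<and> \<bar>y\<bar> \<le> r / 2
      \<and> \<bar>(s1 * ?\<rho>1 x y + s2 * ?\<rho>2 x y) - c\<bar> \<le> L}"
  have "(\<integral>\<^sup>+ \<xi>. ennreal ((null_weight c0 s1 s2 \<xi> (\<xi>0 - \<xi>))\<^sup>2) * indicator D \<xi> \<partial>lborel)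
    = (\<integral>\<^sup>+ (x, y). ennreal ((null_weight c0 s1 s2 (x *\<^sub>R \<omega> + y *\<^sub>R perp \<omega>) (\<xi>0 - (x *\<^sub>R \<omega> + y *\<^sub>R perp \<omega>)))\<^sup>2)
        * indicator D (x *\<^sub>R \<omega> + y *\<^sub>R perp \<omega>) \<partial>(lborel \<Otimes>\<^sub>M lborel))"
    by (rule nn_integral_rotated[OF _ \<omega>]) measurable
  also have "\<dots> \<le> (\<integral>\<^sup>+ z. 4 * (case z of (x, y) \<Rightarrow> ennreal (4 * \<bar>?A x y\<bar> + 4 * \<beta> * \<bar>?B x y\<bar>) * indicator ?E (x, y))
      \<partial>(lborel \<Otimes>\<^sub>M lborel))"
  proof (intro nn_integral_mono, clarify)
    fix x y :: real
    let ?\<xi> = "x *\<^sub>R \<omega> + y *\<^sub>R perp \<omega>"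
    have diff: "\<xi>0 - ?\<xi> = (x0 - x) *\<^sub>R \<omega> + (y0 - y) *\<^sub>R perp \<omega>"
      by (subst \<xi>0) (simp add: algebra_simps)
    have norms: "norm ?\<xi> = ?\<rho>1 x y" "norm (\<xi>0 - ?\<xi>) = ?\<rho>2 x y"
      unfolding diff norm_rotated[OF \<omega>] by auto
    show "ennreal ((null_weight c0 s1 s2 ?\<xi> (\<xi>0 - ?\<xi>))\<^sup>2) * indicator D ?\<xi>
      \<le> 4 * (ennreal (4 * \<bar>?A x y\<bar> + 4 * \<beta> * \<bar>?B x y\<bar>) * indicator ?E (x, y))"
    proof (cases "?\<xi> \<in> D")
      case True
      have D: "?\<xi> \<in> strip r \<omega>" "N1 / M \<le> ?\<rho>1 x y" "?\<rho>1 x y \<le> M * N1" "N2 / M \<le> ?\<rho>2 x y"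
        "\<bar>s1 * ?\<rho>1 x y + s2 * ?\<rho>2 x y - c\<bar> \<le> L"
        using True unfolding D_def norms[symmetric] by auto
      have "?\<xi> \<bullet> perp \<omega> = y"
        using \<omega> by (simp add: inner_add_left dot_square_norm)
      hence y: "\<bar>y\<bar> \<le> r / 2" using abs_inner_perp_le_strip[OF \<omega> D(1)] by (simp only:)
      have pos: "0 < ?\<rho>1 x y" "0 < ?\<rho>2 x y"
      proof -
        have "0 < N1 / M" "0 < N2 / M" using N M by simp_all
        thus "0 < ?\<rho>1 x y" "0 < ?\<rho>2 x y" using D(2,4) by linarith+
      qed
      have "r / 2 = \<beta> * (N1 / M)" using N M by (simp add: \<beta>_def)
      also have "\<dots> \<le> \<beta> * ?\<rho>1 x y" using \<beta>(1) D(2) by (rule mult_left_mono[rotated])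
      finally have "\<bar>y\<bar> \<le> \<beta> * ?\<rho>1 x y" using y by simp
      from null_weight_le_components[OF \<omega> s c0' \<beta>(2) pos this]
      have w: "(null_weight c0 s1 s2 ?\<xi> (\<xi>0 - ?\<xi>))\<^sup>2 \<le> 4 * (4 * \<bar>?A x y\<bar> + 4 * \<beta> * \<bar>?B x y\<bar>)"
        unfolding diff .
      have "\<bar>x\<bar> \<le> ?\<rho>1 x y" "\<bar>y\<bar> \<le> ?\<rho>1 x y" by simp_all
      hence "\<bar>x\<bar> \<le> M * N1" "\<bar>y\<bar> \<le> M * N1" using D(3) by linarith+
      hence E: "(x, y) \<in> ?E" using D(5) y by simp
      have "ennreal ((null_weight c0 s1 s2 ?\<xi> (\<xi>0 - ?\<xi>))\<^sup>2) \<le> ennreal (4 * (4 * \<bar>?A x y\<bar> + 4 * \<beta> * \<bar>?B x y\<bar>))"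
        using w by (rule ennreal_leI)
      also have "\<dots> = 4 * ennreal (4 * \<bar>?A x y\<bar> + 4 * \<beta> * \<bar>?B x y\<bar>)"
        using \<beta>(1) by (subst ennreal_mult) auto
      finally show ?thesis using True E by (simp only: indicator_simps mult_1_right)
    qed simp
  qed
  also have "\<dots> = 4 * (\<integral>\<^sup>+ (x, y). ennreal (4 * \<bar>?A x y\<bar> + 4 * \<beta> * \<bar>?B x y\<bar>) * indicator ?E (x, y) \<partial>(lborel \<Otimes>\<^sub>M lborel))"
    by (rule nn_integral_cmult) (unfold case_prod_beta', measurable)
  also have "\<dots> \<le> 4 * ennreal (16 * L * (r + 2 * (M * N1) * \<beta>))"
    using M N r L \<beta>
    by (intro mult_left_mono nn_integral_planar_level_set s) auto
  also have "\<dots> = ennreal (64 * (1 + M\<^sup>2) * r * L)"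
  proof -
    \<comment> \<open>The window length times \<beta> is again a multiple of \<open>r\<close>, with
      \<open>N1\<close> cancelling, so both terms of the planar bound have the same size.\<close>
    have "2 * (M * N1) * \<beta> = M\<^sup>2 * r" using N by (simp add: \<beta>_def power2_eq_square)
    hence "4 * (16 * L * (r + 2 * (M * N1) * \<beta>)) = 64 * (1 + M\<^sup>2) * r * L"
      by (simp add: algebra_simps)
    thus ?thesis
      using L r \<beta> M N by (metis ennreal_mult' ennreal_numeral zero_le_numeral)
  qed
  finally show ?thesis .
qed

section \<open>The bilinear estimate\<close>

lemma borel_measurable_snd_topological [measurable (raw)]:
  fixes f :: "'a \<Rightarrow> 'b::topological_space \<times> 'c::topological_space"
  assumes "f \<in> borel_measurable M"
  shows "(\<lambda>x. snd (f x)) \<in> borel_measurable M"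
  by (rule borel_measurable_continuous_on[OF _ assms]) (intro continuous_intros)

text \<open>For fixed \<xi> the two cone conditions put \<tau> in intervals of half-lengths
  \<open>M * L1\<close> and \<open>M * L2\<close>. The shorter one bounds the \<tau> integral, and
  the fact that they meet is the phase condition on \<xi> with tolerance
  \<open>M * (L1 + L2)\<close>.\<close>

lemma nn_integral_null_weight_cones:
  fixes M N1 N2 L1 L2 r c0 s1 s2 :: real and X0 :: spacetime and \<omega> :: "real ^ 2"
  assumes M: "1 \<le> M" and N: "0 < N1" "0 < N2" and L: "0 < L1" "0 < L2"
    and s: "\<bar>s1\<bar> = 1" "\<bar>s2\<bar> = 1" and r: "0 < r" and \<omega>: "norm \<omega> = 1"
    and c0: "c0 = 1 / (10 * M)" and rN: "r \<le> c0 * N1"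
  shows "(\<integral>\<^sup>+ X. ennreal ((null_weight c0 s1 s2 (snd X) (snd (X0 - X)))\<^sup>2)
      * (indicator (thick_cone M s1 N1 L1 \<inter> UNIV \<times> strip r \<omega>) X * indicator (thick_cone M s2 N2 L2) (X0 - X)) \<partial>lborel)
    \<le> ennreal (256 * M\<^sup>2 * (1 + M\<^sup>2) * (r * L1 * L2))"
proof -
  obtain \<tau>0 \<xi>0 where X0: "X0 = (\<tau>0, \<xi>0)" by force
  define D where "D = {\<xi>. \<xi> \<in> strip r \<omega> \<and> N1 / M \<le> norm \<xi> \<and> norm \<xi> \<le> M * N1 \<and> N2 / M \<le> norm (\<xi>0 - \<xi>)
      \<and> \<bar>s1 * norm \<xi> + s2 * norm (\<xi>0 - \<xi>) - \<tau>0\<bar> \<le> M * (L1 + L2)}"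
  define m where "m = min L1 L2"
  let ?w = "\<lambda>\<xi>. ennreal ((null_weight c0 s1 s2 \<xi> (\<xi>0 - \<xi>))\<^sup>2)"
  let ?F = "\<lambda>X. ennreal ((null_weight c0 s1 s2 (snd X) (snd (X0 - X)))\<^sup>2)
      * (indicator (thick_cone M s1 N1 L1 \<inter> UNIV \<times> strip r \<omega>) X * indicator (thick_cone M s2 N2 L2) (X0 - X))"
  have [measurable]: "?F \<in> borel_measurable (lborel \<Otimes>\<^sub>M lborel)"
    unfolding lborel_prod by measurable
  have [measurable]: "D \<in> sets borel"
  proof -
    have "D = {\<xi>. infdist \<xi> (span {\<omega>}) \<le> r / 2} \<inter> {\<xi>. N1 / M \<le> norm \<xi>} \<inter> {\<xi>. norm \<xi> \<le> M * N1}
      \<inter> {\<xi>. N2 / M \<le> norm (\<xi>0 - \<xi>)} \<inter> {\<xi>. \<bar>s1 * norm \<xi> + s2 * norm (\<xi>0 - \<xi>) - \<tau>0\<bar> \<le> M * (L1 + L2)}"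
      by (auto simp: D_def strip_def)
    also have "\<dots> \<in> sets borel"
      by (intro sets.Int borel_closed closed_Collect_le continuous_intros)
    finally show ?thesis .
  qed
  have inner: "(\<integral>\<^sup>+ \<tau>. ?F (\<tau>, \<xi>) \<partial>lborel) \<le> ennreal (2 * M * m) * (?w \<xi> * indicator D \<xi>)" for \<xi>
  proof -
    \<comment> \<open>The centre of the shorter interval.\<close>
    define k where "k = (if L1 \<le> L2 then s1 * norm \<xi> else \<tau>0 - s2 * norm (\<xi>0 - \<xi>))"
    have "?F (\<tau>, \<xi>) \<le> ?w \<xi> * indicator D \<xi> * indicator {k - M * m..k + M * m} \<tau>" for \<tau>
    proof (cases "(\<tau>, \<xi>) \<in> thick_cone M s1 N1 L1 \<inter> UNIV \<times> strip r \<omega> \<and> X0 - (\<tau>, \<xi>) \<in> thick_cone M s2 N2 L2")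
      case True
      hence T: "\<xi> \<in> strip r \<omega>" "N1 / M \<le> norm \<xi>" "norm \<xi> \<le> M * N1" "\<bar>\<tau> - s1 * norm \<xi>\<bar> \<le> M * L1"
        "N2 / M \<le> norm (\<xi>0 - \<xi>)" "\<bar>\<tau>0 - \<tau> - s2 * norm (\<xi>0 - \<xi>)\<bar> \<le> M * L2"
        by (auto simp: thick_cone_def X0)
      have "\<bar>s1 * norm \<xi> + s2 * norm (\<xi>0 - \<xi>) - \<tau>0\<bar> \<le> M * (L1 + L2)"
        using T(4,6) unfolding distrib_left by linarith
      hence "\<xi> \<in> D" using T by (simp add: D_def)
      moreover have "\<tau> \<in> {k - M * m..k + M * m}"
        using T(4,6) unfolding k_def m_def atLeastAtMost_iff by (cases "L1 \<le> L2"; simp; linarith)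
      ultimately show ?thesis using True by (simp add: X0)
    next
      case False
      hence "?F (\<tau>, \<xi>) = 0" by (auto simp: indicator_def)
      thus ?thesis by (simp only: zero_le)
    qed
    hence "(\<integral>\<^sup>+ \<tau>. ?F (\<tau>, \<xi>) \<partial>lborel)
        \<le> (\<integral>\<^sup>+ \<tau>. ?w \<xi> * indicator D \<xi> * indicator {k - M * m..k + M * m} \<tau> \<partial>lborel)"
      by (intro nn_integral_mono)
    also have "\<dots> = ?w \<xi> * indicator D \<xi> * ennreal (2 * M * m)"
      using M L by (subst nn_integral_cmult_indicator) (simp_all add: m_def mult.assoc)
    finally show ?thesis by (simp only: mult.commute)
  qed
  have "(\<integral>\<^sup>+ X. ?F X \<partial>lborel) = (\<integral>\<^sup>+ X. ?F X \<partial>(lborel \<Otimes>\<^sub>M lborel))"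
    by (simp only: lborel_prod)
  also have "\<dots> = (\<integral>\<^sup>+ \<xi>. (\<integral>\<^sup>+ \<tau>. ?F (\<tau>, \<xi>) \<partial>lborel) \<partial>lborel)"
    by (rule lborel_pair.nn_integral_snd[symmetric]) measurable
  also have "\<dots> \<le> (\<integral>\<^sup>+ \<xi>. ennreal (2 * M * m) * (?w \<xi> * indicator D \<xi>) \<partial>lborel)"
    by (intro nn_integral_mono inner)
  also have "\<dots> = ennreal (2 * M * m) * (\<integral>\<^sup>+ \<xi>. ?w \<xi> * indicator D \<xi> \<partial>lborel)"
    by (rule nn_integral_cmult) measurable
  also have "\<dots> \<le> ennreal (2 * M * m) * ennreal (64 * (1 + M\<^sup>2) * r * (M * (L1 + L2)))"
    unfolding D_def using M L
    by (intro mult_left_mono nn_integral_null_weight_planar N s r \<omega> c0 rN) auto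
  also have "\<dots> = ennreal (2 * M * m * (64 * (1 + M\<^sup>2) * r * (M * (L1 + L2))))"
    using M L r by (intro ennreal_mult[symmetric] mult_nonneg_nonneg add_nonneg_nonneg) (auto simp: m_def)
  also have "\<dots> \<le> ennreal (256 * M\<^sup>2 * (1 + M\<^sup>2) * (r * L1 * L2))"
  proof (rule ennreal_leI)
    \<comment> \<open>The minimum times the sum is at most twice the product.\<close>
    have "m * (L1 + L2) \<le> 2 * (L1 * L2)"
    proof -
      have "m * L1 \<le> L2 * L1" "m * L2 \<le> L1 * L2"
        using L by (auto intro!: mult_right_mono simp: m_def)
      thus ?thesis by (simp add: distrib_left mult.commute)
    qed
    hence "(128 * M\<^sup>2 * (1 + M\<^sup>2) * r) * (m * (L1 + L2)) \<le> (128 * M\<^sup>2 * (1 + M\<^sup>2) * r) * (2 * (L1 * L2))"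
      using r by (intro mult_left_mono) auto
    moreover have "2 * M * m * (64 * (1 + M\<^sup>2) * r * (M * (L1 + L2))) = (128 * M\<^sup>2 * (1 + M\<^sup>2) * r) * (m * (L1 + L2))"
      by (simp only: power2_eq_square) (simp add: ac_simps)
    moreover have "256 * M\<^sup>2 * (1 + M\<^sup>2) * (r * L1 * L2) = (128 * M\<^sup>2 * (1 + M\<^sup>2) * r) * (2 * (L1 * L2))"
      by (simp add: ac_simps)
    ultimately show "2 * M * m * (64 * (1 + M\<^sup>2) * r * (M * (L1 + L2))) \<le> 256 * M\<^sup>2 * (1 + M\<^sup>2) * (r * L1 * L2)"
      by (simp only:)
  qed
  finally show ?thesis .
qed

section \<open>Cauchy--Schwarz for weighted convolutions\<close>

text \<open>Cauchy--Schwarz in \<open>x\<close> isolates the kernel. After Tonelli and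
  \<open>z = x + y\<close> the restriction of the output to \<open>A\<close> becomes, for each fixed
  \<open>y\<close>, a restriction of \<open>x\<close> to a translate of \<open>A\<close>, which is
  where \<open>S\<close> enters.\<close>

lemma bilinear_convolution_L2_bound:
  fixes F G :: "'a::euclidean_space \<Rightarrow> ennreal" and k :: "'a \<Rightarrow> 'a \<Rightarrow> ennreal"
  assumes [measurable]: "F \<in> borel_measurable borel" "G \<in> borel_measurable borel"
    "(\<lambda>(x, y). k x y) \<in> borel_measurable (borel \<Otimes>\<^sub>M borel)" "A \<in> sets borel"
    and k: "\<And>z. (\<integral>\<^sup>+ x. (k z x)\<^sup>2 \<partial>lborel) \<le> K"
    and S: "\<And>y. (\<integral>\<^sup>+ x. (F x)\<^sup>2 * indicator A (x + y) \<partial>lborel) \<le> S"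
  shows "(\<integral>\<^sup>+ z. (\<integral>\<^sup>+ x. k z x * (F x * G (z - x)) \<partial>lborel)\<^sup>2 * indicator A z \<partial>lborel)
    \<le> K * (S * (\<integral>\<^sup>+ y. (G y)\<^sup>2 \<partial>lborel))"
proof -
  have [measurable]: "k z \<in> borel_measurable borel" for z
  proof -
    have "(\<lambda>x. (\<lambda>(x, y). k x y) (z, x)) \<in> borel_measurable borel" by measurable
    thus ?thesis by simp
  qed
  let ?H = "\<lambda>z x. (F x * G (z - x))\<^sup>2 * indicator A z"
  have "(\<integral>\<^sup>+ x. k z x * (F x * G (z - x)) \<partial>lborel)\<^sup>2 * indicator A z \<le> K * (\<integral>\<^sup>+ x. ?H z x \<partial>lborel)" for z
  proof -
    have "(\<integral>\<^sup>+ x. k z x * (F x * G (z - x)) \<partial>lborel)\<^sup>2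
      \<le> (\<integral>\<^sup>+ x. (k z x)\<^sup>2 \<partial>lborel) * (\<integral>\<^sup>+ x. (F x * G (z - x))\<^sup>2 \<partial>lborel)"
      by (rule Cauchy_Schwarz_nn_integral) measurable
    also have "\<dots> \<le> K * (\<integral>\<^sup>+ x. (F x * G (z - x))\<^sup>2 \<partial>lborel)"
      by (intro mult_right_mono k) simp
    finally show ?thesis by (cases "z \<in> A") (simp_all add: nn_integral_multc)
  qed
  hence "(\<integral>\<^sup>+ z. (\<integral>\<^sup>+ x. k z x * (F x * G (z - x)) \<partial>lborel)\<^sup>2 * indicator A z \<partial>lborel)
    \<le> (\<integral>\<^sup>+ z. K * (\<integral>\<^sup>+ x. ?H z x \<partial>lborel) \<partial>lborel)"
    by (intro nn_integral_mono)
  also have "\<dots> = K * (\<integral>\<^sup>+ z. (\<integral>\<^sup>+ x. ?H z x \<partial>lborel) \<partial>lborel)"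
    by (rule nn_integral_cmult) measurable
  also have "(\<integral>\<^sup>+ z. (\<integral>\<^sup>+ x. ?H z x \<partial>lborel) \<partial>lborel) = (\<integral>\<^sup>+ x. (\<integral>\<^sup>+ z. ?H z x \<partial>lborel) \<partial>lborel)"
    by (rule lborel_pair.Fubini') measurable
  also have "\<dots> = (\<integral>\<^sup>+ x. (\<integral>\<^sup>+ y. ?H (y + x) x \<partial>lborel) \<partial>lborel)"
  proof (rule nn_integral_cong)
    fix x
    show "(\<integral>\<^sup>+ z. ?H z x \<partial>lborel) = (\<integral>\<^sup>+ y. ?H (y + x) x \<partial>lborel)"
      using nn_integral_lborel_translation[of "\<lambda>z. ?H z x" "- x"] by simp
  qed
  also have "\<dots> = (\<integral>\<^sup>+ y. (\<integral>\<^sup>+ x. ?H (y + x) x \<partial>lborel) \<partial>lborel)"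
    by (rule lborel_pair.Fubini'[symmetric]) measurable
  also have "\<dots> = (\<integral>\<^sup>+ y. (G y)\<^sup>2 * (\<integral>\<^sup>+ x. (F x)\<^sup>2 * indicator A (x + y) \<partial>lborel) \<partial>lborel)"
  proof (intro nn_integral_cong)
    fix y
    have "(\<integral>\<^sup>+ x. ?H (y + x) x \<partial>lborel) = (\<integral>\<^sup>+ x. (G y)\<^sup>2 * ((F x)\<^sup>2 * indicator A (x + y)) \<partial>lborel)"
      by (intro nn_integral_cong) (simp add: power_mult_distrib ac_simps)
    also have "\<dots> = (G y)\<^sup>2 * (\<integral>\<^sup>+ x. (F x)\<^sup>2 * indicator A (x + y) \<partial>lborel)"
      by (rule nn_integral_cmult) measurable
    finally show "(\<integral>\<^sup>+ x. ?H (y + x) x \<partial>lborel) = (G y)\<^sup>2 * (\<integral>\<^sup>+ x. (F x)\<^sup>2 * indicator A (x + y) \<partial>lborel)" .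
  qed
  also have "\<dots> \<le> (\<integral>\<^sup>+ y. S * (G y)\<^sup>2 \<partial>lborel)"
    by (intro nn_integral_mono, subst mult.commute) (intro mult_right_mono S, simp)
  also have "\<dots> = S * (\<integral>\<^sup>+ y. (G y)\<^sup>2 \<partial>lborel)"
    by (rule nn_integral_cmult) measurable
  finally show ?thesis by (simp add: mult_left_mono)
qed

text \<open>The support of the transform of \<open>u2\<close> is known only almost everywhere, and
  the transform is evaluated at \<open>X0 - X1\<close>; reflection keeps the exceptional set
  null.\<close>

lemma AE_lborel_reflect:
  fixes z :: "'a::euclidean_space"
  assumes "AE x in lborel. P x"
  shows "AE x in lborel. P (z - x)"
proof -
  have eq: "lborel = distr lborel borel (\<lambda>x. z + (- 1) *\<^sub>R x)"
    using lborel_affine[of "-1" z] by (simp add: density_1)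
  \<comment> \<open>The predicate may fail to be measurable, so the argument passes through a Borel
    null set containing its exceptions.\<close>
  obtain N where N: "{x \<in> space lborel. \<not> P x} \<subseteq> N" "emeasure lborel N = 0" "N \<in> sets lborel"
    using AE_E[OF assms] by metis
  have N': "N \<in> sets borel" using N(3) by simp
  have "AE x in lborel. x \<notin> N" using N by (intro AE_not_in) (auto simp: null_sets_def)
  hence "AE x in distr lborel borel (\<lambda>x. z + (- 1) *\<^sub>R x). x \<notin> N"
    by (subst eq[symmetric])
  hence "AE x in lborel. z + (- 1) *\<^sub>R x \<notin> N"
    using N' by (subst (asm) AE_distr_iff) auto
  thus ?thesis by eventually_elim (use N(1) in auto)
qed

text \<open>A non-integrable function has integral 0 by convention, so the bound is available at
  every output frequency.\<close>

lemma cmod_lebesgue_integral_le: "ennreal (cmod (LINT x|M. f x)) \<le> (\<integral>\<^sup>+ x. ennreal (cmod (f x)) \<partial>M)"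
proof (cases "integrable M f")
  case True
  thus ?thesis by (rule integral_norm_bound_ennreal)
qed (simp add: not_integrable_integral_eq)

text \<open>The cone is bounded, so the cut-off transform has bounded support and its inverse is
  under control.\<close>

lemma fourier_proj_cone:
  assumes u: "u \<in> L2_space" and s: "\<bar>s\<bar> = 1" and supp: "ess_support (L2_fourier u) \<subseteq> thick_cone M s N L"
    and A: "A \<in> sets borel"
  shows "fourier_proj A u \<in> L2_space"
    and "AE X in lborel. L2_fourier (fourier_proj A u) X = indicator A X * L2_fourier u X"
    and "ennreal ((2 * pi) ^ 3) * L2sq (fourier_proj A u) = L2sq (\<lambda>X. indicator A X * L2_fourier u X)"
proof -
  let ?f = "\<lambda>X. indicator A X * L2_fourier u X"
  have u': "L2_fourier u \<in> borel_measurable borel" "L2sq (L2_fourier u) < \<infinity>"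
    using L2_fourier_limit(1)[OF u] by (auto simp: L2_space_iff)
  have "L2sq ?f \<le> L2sq (L2_fourier u)"
    unfolding L2sq_def by (intro nn_integral_mono ennreal_leI power_mono) (auto simp: indicator_def)
  hence "L2sq ?f < \<infinity>" using u'(2) by (rule order_le_less_trans)
  moreover have "?f \<in> borel_measurable borel" using u'(1) A by measurable
  ultimately have f: "?f \<in> L2_space" by (simp add: L2_space_iff)
  have "AE X in lborel. X \<notin> cball 0 (2 * (M * N) + M * L) \<longrightarrow> ?f X = 0"
    using ess_support_AE[OF supp] by eventually_elim (use thick_cone_bounded[OF s, of M N L] in auto)
  note inv = L2_inv_fourier_bounded_support[OF f this]
  show "fourier_proj A u \<in> L2_space"
    "AE X in lborel. L2_fourier (fourier_proj A u) X = indicator A X * L2_fourier u X"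
    "ennreal ((2 * pi) ^ 3) * L2sq (fourier_proj A u) = L2sq ?f"
    unfolding fourier_proj_def by (rule inv)+
qed

theorem theorem2p4:
  fixes M :: real
  assumes "M \<ge> 1"
  shows "\<exists>c0 C :: real. 0 < c0 \<and> c0 < 1 \<and> 0 < C \<and>
    (\<forall>(N1::real) (N2::real) (L1::real) (L2::real) (s1::real) (s2::real) (r::real)
       (\<omega> :: real ^ 2) (a::real) (b::real)
       (u1 :: spacetime \<Rightarrow> complex) (u2 :: spacetime \<Rightarrow> complex).
       0 < N1 \<longrightarrow> 0 < N2 \<longrightarrow> 0 < L1 \<longrightarrow> 0 < L2 \<longrightarrow>
       s1 \<in> {1, -1} \<longrightarrow> s2 \<in> {1, -1} \<longrightarrow>
       0 < r \<longrightarrow> norm \<omega> = 1 \<longrightarrow> a \<le> b \<longrightarrow>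
       r \<le> c0 * min N1 N2 \<longrightarrow>
       u1 \<in> L2_space \<longrightarrow> u2 \<in> L2_space \<longrightarrow>
       ess_support (L2_fourier u1) \<subseteq> thick_cone M s1 N1 L1 \<longrightarrow>
       ess_support (L2_fourier u2) \<subseteq> thick_cone M s2 N2 L2 \<longrightarrow>
       L2_norm (fourier_proj (slab \<omega> {a..b})
           (null_form c0 s1 s2 (fourier_proj (UNIV \<times> strip r \<omega>) u1) u2))
         \<le> ennreal (C * sqrt (r * L1 * L2))
           * (SUP h. L2_norm (fourier_proj (slab \<omega> {a + h..b + h}) u1))
           * L2_norm u2)"
proof -
  define c0 where "c0 = 1 / (10 * M)"
  define C1 where "C1 = 256 * M\<^sup>2 * (1 + M\<^sup>2)"
  \<comment> \<open>The Plancherel constant. It is paid for each of the two inputs and regained for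
    the output, so one power survives in \<open>C^2\<close>.\<close>
  define p3 :: real where "p3 = (2 * pi) ^ 3"
  define C where "C = sqrt (C1 * p3)"
  have c0: "0 < c0" "c0 < 1" using assms by (simp_all add: c0_def divide_less_eq)
  have C1: "0 < C1" using assms by (auto simp: C1_def intro!: mult_pos_pos add_pos_nonneg)
  have p3: "0 < p3" by (simp add: p3_def)
  have C: "0 < C" using C1 p3 by (simp add: C_def)
  have main: "L2_norm (fourier_proj (slab \<omega> {a..b})
           (null_form c0 s1 s2 (fourier_proj (UNIV \<times> strip r \<omega>) u1) u2))
         \<le> ennreal (C * sqrt (r * L1 * L2))
           * (SUP h. L2_norm (fourier_proj (slab \<omega> {a + h..b + h}) u1))
           * L2_norm u2"
    if N: "0 < N1" "0 < N2" and L: "0 < L1" "0 < L2" and s_mem: "s1 \<in> {1, -1}" "s2 \<in> {1, -1}"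
      and r: "0 < r" and \<omega>: "norm \<omega> = 1" and rN: "r \<le> c0 * min N1 N2"
      and u1: "u1 \<in> L2_space" and u2: "u2 \<in> L2_space"
      and supp1: "ess_support (L2_fourier u1) \<subseteq> thick_cone M s1 N1 L1"
      and supp2: "ess_support (L2_fourier u2) \<subseteq> thick_cone M s2 N2 L2"
    for N1 N2 L1 L2 s1 s2 r :: real and \<omega> :: "real ^ 2" and a b :: real and u1 u2
  proof -
    have s: "\<bar>s1\<bar> = 1" "\<bar>s2\<bar> = 1" using s_mem by auto
    have rN1: "r \<le> c0 * N1"
    proof -
      have "c0 * min N1 N2 \<le> c0 * N1" using c0(1) by (intro mult_left_mono) auto
      thus ?thesis using rN by linarith
    qed
    define K where "K = C1 * (r * L1 * L2)"
    have K: "0 \<le> K" using C1 r L by (simp add: K_def)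
    let ?A = "slab \<omega> {a..b}"
    let ?S1 = "thick_cone M s1 N1 L1 \<inter> UNIV \<times> strip r \<omega>"
    let ?S2 = "thick_cone M s2 N2 L2"
    let ?v1 = "L2_fourier u1" and ?v2 = "L2_fourier u2"
    define q where "q = fourier_proj (UNIV \<times> strip r \<omega>) u1"
    note q = fourier_proj_cone[OF u1 s(1) supp1 sets_strip[of r \<omega>], folded q_def]
    let ?f = "L2_fourier q"
    have v1 [measurable]: "?v1 \<in> borel_measurable borel" and v1_fin: "L2sq ?v1 < \<infinity>"
      and v2 [measurable]: "?v2 \<in> borel_measurable borel" and v2_fin: "L2sq ?v2 < \<infinity>"
      and f_meas [measurable]: "?f \<in> borel_measurable borel"
      using L2_fourier_limit(1)[OF u1] L2_fourier_limit(1)[OF u2] L2_fourier_limit(1)[OF q(1)]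
      by (auto simp: L2_space_iff)
    have f_supp: "AE X in lborel. X \<notin> ?S1 \<longrightarrow> ?f X = 0"
      using q(2) ess_support_AE[OF supp1] by eventually_elim (auto simp: indicator_def)
    have v2_supp: "AE X in lborel. X \<notin> ?S2 \<longrightarrow> ?v2 X = 0"
      by (rule ess_support_AE[OF supp2])
    define B where "B X0 = (LINT X1|lborel. complex_of_real (null_weight c0 s1 s2 (snd X1) (snd (X0 - X1)))
        * ?f X1 * ?v2 (X0 - X1))" for X0
    have nf: "null_form c0 s1 s2 q u2 = L2_inv_fourier B"
      unfolding null_form_def B_def null_weight_def Let_def ..
    have B_meas [measurable]: "B \<in> borel_measurable borel"
      unfolding B_def by measurable
    \<comment> \<open>The kernel carries the support indicators, so that its square integral is
      bounded for each \<open>X0\<close>; they are inserted by an almost everywhere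
      comparison.\<close>
    define k where "k X0 X1 = ennreal \<bar>null_weight c0 s1 s2 (snd X1) (snd (X0 - X1))\<bar>
        * (indicator ?S1 X1 * indicator ?S2 (X0 - X1))" for X0 X1
    let ?F = "\<lambda>X. ennreal (cmod (?f X))" and ?G = "\<lambda>X. ennreal (cmod (?v2 X))"
    have k_meas [measurable]: "(\<lambda>(x, y). k x y) \<in> borel_measurable (borel \<Otimes>\<^sub>M borel)"
      unfolding k_def by measurable
    have k_int: "(\<integral>\<^sup>+ X1. (k X0 X1)\<^sup>2 \<partial>lborel) \<le> ennreal K" for X0
    proof -
      have "(\<integral>\<^sup>+ X1. (k X0 X1)\<^sup>2 \<partial>lborel)
        = (\<integral>\<^sup>+ X. ennreal ((null_weight c0 s1 s2 (snd X) (snd (X0 - X)))\<^sup>2)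
          * (indicator ?S1 X * indicator ?S2 (X0 - X)) \<partial>lborel)"
        unfolding k_def
        by (intro nn_integral_cong) (auto simp: power_mult_distrib ennreal_power indicator_def)
      also have "\<dots> \<le> ennreal K"
        unfolding K_def C1_def
        by (rule nn_integral_null_weight_cones[OF assms N L s r \<omega> c0_def rN1])
      finally show ?thesis .
    qed
    have B_le: "ennreal (cmod (B X0)) \<le> (\<integral>\<^sup>+ X1. k X0 X1 * (?F X1 * ?G (X0 - X1)) \<partial>lborel)" for X0
    proof -
      have "ennreal (cmod (B X0)) \<le> (\<integral>\<^sup>+ X1. ennreal (cmod (complex_of_real
          (null_weight c0 s1 s2 (snd X1) (snd (X0 - X1))) * ?f X1 * ?v2 (X0 - X1))) \<partial>lborel)"
        unfolding B_def by (rule cmod_lebesgue_integral_le)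
      also have "\<dots> = (\<integral>\<^sup>+ X1. k X0 X1 * (?F X1 * ?G (X0 - X1)) \<partial>lborel)"
      proof (rule nn_integral_cong_AE)
        show "AE X1 in lborel. ennreal (cmod (complex_of_real
            (null_weight c0 s1 s2 (snd X1) (snd (X0 - X1))) * ?f X1 * ?v2 (X0 - X1)))
          = k X0 X1 * (?F X1 * ?G (X0 - X1))"
          using f_supp AE_lborel_reflect[OF v2_supp, of X0]
        proof eventually_elim
          case (elim X1)
          show ?case
          proof (cases "X1 \<in> ?S1 \<and> X0 - X1 \<in> ?S2")
            case True
            hence "k X0 X1 = ennreal \<bar>null_weight c0 s1 s2 (snd X1) (snd (X0 - X1))\<bar>"
              unfolding k_def by (simp only: indicator_simps mult_1_right)
            thus ?thesis by (simp only: norm_mult norm_of_real real_norm_def ennreal_mult norm_ge_zero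
                  abs_ge_zero mult_nonneg_nonneg mult.assoc)
          next
            case False
            hence "?f X1 = 0 \<or> ?v2 (X0 - X1) = 0" using elim by auto
            thus ?thesis by auto
          qed
        qed
      qed
      finally show ?thesis .
    qed
    \<comment> \<open>With \<open>UNIV\<close> for \<open>E\<close> this shows that \<open>B\<close>
      is square integrable, and with the slab it gives the estimate.\<close>
    have B_int: "(\<integral>\<^sup>+ X. (ennreal (cmod (B X)))\<^sup>2 * indicator E X \<partial>lborel)
        \<le> ennreal K * (T * (\<integral>\<^sup>+ X. (?G X)\<^sup>2 \<partial>lborel))"
      if E: "E \<in> sets borel" and T: "\<And>Y. (\<integral>\<^sup>+ X. (?F X)\<^sup>2 * indicator E (X + Y) \<partial>lborel) \<le> T" for E T
    proof -
      have "(\<integral>\<^sup>+ X. (ennreal (cmod (B X)))\<^sup>2 * indicator E X \<partial>lborel)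
        \<le> (\<integral>\<^sup>+ X0. (\<integral>\<^sup>+ X1. k X0 X1 * (?F X1 * ?G (X0 - X1)) \<partial>lborel)\<^sup>2 * indicator E X0 \<partial>lborel)"
        by (intro nn_integral_mono mult_right_mono power_mono B_le) auto
      also have "\<dots> \<le> ennreal K * (T * (\<integral>\<^sup>+ X. (?G X)\<^sup>2 \<partial>lborel))"
        by (rule bilinear_convolution_L2_bound[OF _ _ k_meas E k_int T]) measurable
      finally show ?thesis .
    qed
    have sq: "(ennreal (cmod z))\<^sup>2 = ennreal ((cmod z)\<^sup>2)" for z by (simp add: ennreal_power)
    have G2: "(\<integral>\<^sup>+ X. (?G X)\<^sup>2 \<partial>lborel) = L2sq ?v2" unfolding L2sq_def sq ..
    \<comment> \<open>The projection to the strip multiplies the transform of \<open>u1\<close> by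
      an indicator, which cannot increase its modulus.\<close>
    have F2_le: "(\<integral>\<^sup>+ X. (?F X)\<^sup>2 * indicator E X \<partial>lborel) \<le> L2sq (\<lambda>X. indicator E X * ?v1 X)" for E
      unfolding L2sq_def sq
      using q(2) by (intro nn_integral_mono_AE, eventually_elim) (auto simp: indicator_def)
    have B_L2: "B \<in> L2_space"
    proof -
      have "L2sq B = (\<integral>\<^sup>+ X. (ennreal (cmod (B X)))\<^sup>2 * indicator UNIV X \<partial>lborel)"
        unfolding L2sq_def sq by simp
      also have "\<dots> \<le> ennreal K * (L2sq ?v1 * L2sq ?v2)"
        unfolding G2[symmetric] using F2_le[of UNIV] by (intro B_int) simp_all
      also have "\<dots> < \<infinity>" using v1_fin v2_fin by (simp add: ennreal_mult_less_top)
      finally show ?thesis using B_meas by (simp add: L2_space_iff)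
    qed
    define \<rho>1 where "\<rho>1 = 2 * (M * N1) + M * L1"
    define \<rho>2 where "\<rho>2 = 2 * (M * N2) + M * L2"
    \<comment> \<open>A nonzero kernel places \<open>X1\<close> and \<open>X0 - X1\<close> in two
      balls, so \<open>B\<close> lives in the ball of the summed radii and can be inverted.\<close>
    have B_supp: "B X0 = 0" if X0: "X0 \<notin> cball 0 (\<rho>1 + \<rho>2)" for X0
    proof -
      have "k X0 X1 = 0" for X1
      proof (rule ccontr)
        assume "k X0 X1 \<noteq> 0"
        hence "X1 \<in> ?S1" "X0 - X1 \<in> ?S2" by (auto simp: k_def indicator_def split: if_splits)
        hence "norm X1 \<le> \<rho>1" "norm (X0 - X1) \<le> \<rho>2"
          using thick_cone_bounded[OF s(1), of M N1 L1] thick_cone_bounded[OF s(2), of M N2 L2]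
          by (auto simp: \<rho>1_def \<rho>2_def subset_eq)
        hence "norm X0 \<le> \<rho>1 + \<rho>2" using norm_triangle_ineq[of X1 "X0 - X1"] by simp
        thus False using X0 by simp
      qed
      thus ?thesis using B_le[of X0] by simp
    qed
    have "AE X in lborel. X \<notin> cball 0 (\<rho>1 + \<rho>2) \<longrightarrow> B X = 0" using B_supp by simp
    note nf_props = L2_inv_fourier_bounded_support[OF B_L2 this, folded nf]
    define g where "g X = indicator ?A X * L2_fourier (null_form c0 s1 s2 q u2) X" for X
    have g_AE: "AE X in lborel. g X = indicator ?A X * B X"
      using nf_props(2) by eventually_elim (simp add: g_def)
    have g_meas [measurable]: "g \<in> borel_measurable borel"
      unfolding g_def using borel_measurable_L2_space[OF L2_fourier_limit(1)[OF nf_props(1)]] by measurable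
    have g_L2sq: "L2sq g = (\<integral>\<^sup>+ X. (ennreal (cmod (B X)))\<^sup>2 * indicator ?A X \<partial>lborel)"
      unfolding L2sq_def sq using g_AE
      by (intro nn_integral_cong_AE, eventually_elim) (auto simp: indicator_def)
    have "L2sq g \<le> L2sq B"
      unfolding g_L2sq unfolding L2sq_def sq by (intro nn_integral_mono) (auto simp: indicator_def)
    hence g_L2: "g \<in> L2_space"
      using B_L2 g_meas by (auto simp: L2_space_iff intro: order_le_less_trans)
    have g_supp: "AE X in lborel. X \<notin> cball 0 (\<rho>1 + \<rho>2) \<longrightarrow> g X = 0"
      using g_AE by eventually_elim (use B_supp in auto)
    define w where "w = fourier_proj ?A (null_form c0 s1 s2 q u2)"
    have w_L2sq: "ennreal p3 * L2sq w = L2sq g"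
      using L2_inv_fourier_bounded_support(3)[OF g_L2 g_supp]
      unfolding w_def fourier_proj_def g_def[abs_def] p3_def .
    define \<Sigma> where "\<Sigma> = (SUP h. L2_norm (fourier_proj (slab \<omega> {a + h..b + h}) u1))"
    have P_eq: "ennreal p3 * L2sq (fourier_proj (slab \<omega> {c..d}) u1) = L2sq (\<lambda>X. indicator (slab \<omega> {c..d}) X * ?v1 X)" for c d
      unfolding p3_def by (rule fourier_proj_cone(3)[OF u1 s(1) supp1 sets_slab])
    define n1 where "n1 = enn2real \<Sigma>"
    define n2 where "n2 = enn2real (L2_norm u2)"
    have fin_norm: "\<exists>x\<ge>0. L2_norm u = ennreal x" if "u \<in> L2_space" for u
      using that unfolding L2_space_def by (cases "L2_norm u") auto
    have n2: "L2_norm u2 = ennreal n2" "0 \<le> n2" using fin_norm[OF u2] by (auto simp: n2_def)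
    \<comment> \<open>Finiteness has to be shown because \<open>enn2real\<close> sends infinity to
      0; by Plancherel every projection has norm at most that of \<open>u1\<close>.\<close>
    have \<Sigma>: "\<Sigma> = ennreal n1" "0 \<le> n1"
    proof -
      obtain x where x: "0 \<le> x" "L2_norm u1 = ennreal x" using fin_norm[OF u1] by auto
      have "L2_norm (fourier_proj (slab \<omega> {c..d}) u1) \<le> ennreal x" for c d
      proof -
        have "ennreal p3 * L2sq (fourier_proj (slab \<omega> {c..d}) u1) \<le> L2sq ?v1"
          unfolding P_eq unfolding L2sq_def
          by (intro nn_integral_mono ennreal_leI power_mono) (auto simp: indicator_def)
        also have "\<dots> = ennreal p3 * L2sq u1" unfolding p3_def by (rule plancherel_L2[OF u1])
        finally have "L2sq (fourier_proj (slab \<omega> {c..d}) u1) \<le> L2sq u1"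
          using p3 by (subst (asm) ennreal_mult_le_mult_iff) auto
        also have "\<dots> \<le> ennreal (x\<^sup>2)" using x L2_norm_le_iff[OF x(1), of u1] by simp
        finally show ?thesis using L2_norm_le_iff[OF x(1)] by simp
      qed
      hence "\<Sigma> \<le> ennreal x" unfolding \<Sigma>_def by (intro SUP_least)
      hence "\<Sigma> < \<infinity>" by (rule order_le_less_trans) simp
      thus "\<Sigma> = ennreal n1" "0 \<le> n1" by (simp_all add: n1_def)
    qed
    have slab_int: "(\<integral>\<^sup>+ X. (?F X)\<^sup>2 * indicator ?A (X + Y) \<partial>lborel) \<le> ennreal (p3 * n1\<^sup>2)" for Y
    proof -
      \<comment> \<open>With the second frequency fixed at \<open>Y\<close>, the output condition on
        \<open>X + Y\<close> confines \<open>X\<close> to the slab over the interval translated by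
        \<open>h\<close>.\<close>
      define h where "h = - (snd Y \<bullet> \<omega>)"
      have "indicator ?A (X + Y) = (indicator (slab \<omega> {a + h..b + h}) X :: ennreal)" for X
        by (auto simp: indicator_def slab_def h_def inner_add_left case_prod_beta')
      hence "(\<integral>\<^sup>+ X. (?F X)\<^sup>2 * indicator ?A (X + Y) \<partial>lborel)
        = (\<integral>\<^sup>+ X. (?F X)\<^sup>2 * indicator (slab \<omega> {a + h..b + h}) X \<partial>lborel)"
        by simp
      also have "\<dots> \<le> ennreal p3 * L2sq (fourier_proj (slab \<omega> {a + h..b + h}) u1)"
        unfolding P_eq by (rule F2_le)
      also have "\<dots> \<le> ennreal p3 * ennreal (n1\<^sup>2)"
      proof (intro mult_left_mono)
        have "L2_norm (fourier_proj (slab \<omega> {a + h..b + h}) u1) \<le> ennreal n1"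
          unfolding \<Sigma>(1)[symmetric] \<Sigma>_def by (rule SUP_upper) simp
        thus "L2sq (fourier_proj (slab \<omega> {a + h..b + h}) u1) \<le> ennreal (n1\<^sup>2)"
          using L2_norm_le_iff[OF \<Sigma>(2)] by simp
      qed simp
      also have "\<dots> = ennreal (p3 * n1\<^sup>2)" using p3 by (simp flip: ennreal_mult')
      finally show ?thesis .
    qed
    have v2_L2sq: "L2sq ?v2 \<le> ennreal (p3 * n2\<^sup>2)"
    proof -
      have "L2sq ?v2 = ennreal p3 * L2sq u2" unfolding p3_def by (rule plancherel_L2[OF u2])
      also have "\<dots> \<le> ennreal p3 * ennreal (n2\<^sup>2)"
        using n2 L2_norm_le_iff[OF n2(2), of u2] by (intro mult_left_mono) simp_all
      also have "\<dots> = ennreal (p3 * n2\<^sup>2)" using p3 by (simp flip: ennreal_mult')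
      finally show ?thesis .
    qed
    have "ennreal p3 * L2sq w \<le> ennreal K * (ennreal (p3 * n1\<^sup>2) * L2sq ?v2)"
      unfolding w_L2sq g_L2sq G2[symmetric] by (rule B_int[OF sets_slab slab_int])
    also have "\<dots> \<le> ennreal K * (ennreal (p3 * n1\<^sup>2) * ennreal (p3 * n2\<^sup>2))"
      by (intro mult_left_mono v2_L2sq) simp_all
    also have "\<dots> = ennreal (K * ((p3 * n1\<^sup>2) * (p3 * n2\<^sup>2)))"
      using K p3 by (simp only: ennreal_mult mult_nonneg_nonneg zero_le_power2 less_imp_le)
    also have "K * ((p3 * n1\<^sup>2) * (p3 * n2\<^sup>2)) = p3 * (K * p3 * n1\<^sup>2 * n2\<^sup>2)"
      by (simp only: ac_simps)
    also have "ennreal (p3 * (K * p3 * n1\<^sup>2 * n2\<^sup>2)) = ennreal p3 * ennreal (K * p3 * n1\<^sup>2 * n2\<^sup>2)"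
      using p3 by (intro ennreal_mult') simp
    \<comment> \<open>Cancelling one Plancherel constant leaves the square of the claimed
      bound.\<close>
    finally have "L2sq w \<le> ennreal (K * p3 * n1\<^sup>2 * n2\<^sup>2)"
      using p3 by (subst (asm) ennreal_mult_le_mult_iff) auto
    also have "K * p3 * n1\<^sup>2 * n2\<^sup>2 = (C * sqrt (r * L1 * L2) * n1 * n2)\<^sup>2"
    proof -
      have "C\<^sup>2 = C1 * p3" using C1 p3 by (simp add: C_def)
      moreover have "(sqrt (r * L1 * L2))\<^sup>2 = r * L1 * L2" using r L by simp
      ultimately show ?thesis unfolding power_mult_distrib K_def by (simp only: ac_simps)
    qed
    finally have "L2_norm w \<le> ennreal (C * sqrt (r * L1 * L2) * n1 * n2)"
      using C r L \<Sigma>(2) n2(2) by (subst L2_norm_le_iff) (auto intro!: mult_nonneg_nonneg)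
    also have "\<dots> = ennreal (C * sqrt (r * L1 * L2)) * ennreal n1 * ennreal n2"
      using C r L \<Sigma>(2) n2(2) by (simp add: ennreal_mult)
    finally show ?thesis
      unfolding w_def q_def \<Sigma>(1)[symmetric] n2(1)[symmetric] \<Sigma>_def .
  qed
  show ?thesis
    by (intro exI[of _ c0] exI[of _ C] conjI allI impI c0 C) (rule main)
qed

end
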